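(* Let $n$ be an odd prime number. Let $n=a_1n_1+\dots+a_rn_r$, let $M$ be the Levi subgroup of $\mathrm{SL}(n,F)$ associated with this partition, having $a_i$ blocks of size $n_i$ for each $i$, and let $\sigma\in\mathcal E^2(M)$. Let $\mathcal O$ be the orbit of $\sigma$ under twisting by unitary unramified characters of $M$. Then there exists $\sigma'\in\mathcal O$ such that $\sigma'$ is fixed by the action of $W_{\mathcal O}$, i.e. ${}^w\sigma'\simeq\sigma'$ for all $w\in W_{\mathcal O}$.
   Context: $F$ is a non-archimedean local field of characteristic zero. $\mathcal E^2(M)$ is the set of equivalence classes of discrete series representations of $M$. The Levi subgroup of $\mathrm{SL}(n,F)$ associated with a partition of $n$ is $\widetilde M\cap\mathrm{SL}(n,F)$, where $\widetilde M$ is the corresponding block-diagonal Levi subgroup of $\mathrm{GL}(n,F)$. Let $W(M)=N_{\mathrm{SL}(n,F)}(M)/M$, acting by ${}^w\sigma=\sigma(w^{-1}\cdot w)$, and let $\mathcal X^u_{nr}(M)$ be the group of unitary unramified characters of $M$. Then $\mathcal O=\{\sigma\otimes\chi:\chi\in\mathcal X^u_{nr}(M)\}$ and $W_{\mathcal O}=\{w\in W(M):{}^w\sigma\simeq\sigma\otimes\chi\text{ for some }\chi\in\mathcal X^u_{nr}(M)\}$. *)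

theory Defs
  imports
    "HOL-Analysis.Abstract_Metric_Spaces"
    "HOL-Analysis.Bochner_Integration"
    "HOL-Algebra.Group_Action"
    "HOL-Algebra.Coset"
    "HOL-Computational_Algebra.Primes"
    "Jordan_Normal_Form.Determinant"
begin

section \<open>Non-archimedean local fields of characteristic zero\<close>

definition val_topology :: "('f::field \<Rightarrow> real) \<Rightarrow> 'f topology" where
  "val_topology av = Metric_space.mtopology UNIV (\<lambda>x y. av (x - y))"

text \<open>A local field is a non-discrete locally compact field; here its topology is given by a
  nontrivial ultrametric absolute value (nontriviality is non-discreteness). Nothing below depends
  on how the absolute value is normalised.\<close>

locale nonarch_local_field =
  fixes av :: "'f::field_char_0 \<Rightarrow> real"
  assumes av_nonneg: "0 \<le> av x"
    and av_eq_0: "av x = 0 \<longleftrightarrow> x = 0"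
    and av_mult: "av (x * y) = av x * av y"
    and av_ultra: "av (x + y) \<le> max (av x) (av y)"
    and av_nontrivial: "\<exists>x. x \<noteq> 0 \<and> av x \<noteq> 1"
    and av_locally_compact: "locally_compact_space (val_topology av)"
begin

lemma av_one: "av 1 = 1"
  using av_mult[of 1 1] av_eq_0[of 1] by simp

lemma av_minus_one: "av (- 1) = 1"
proof -
  have "av (- 1) ^ 2 = 1" using av_mult[of "- 1" "- 1"] av_one by (simp add: power2_eq_square)
  then show ?thesis using av_nonneg[of "- 1"] by (simp add: power2_eq_1_iff)
qed

lemma Metric_space_av: "Metric_space UNIV (\<lambda>x y. av (x - y))"
proof
  fix x y z :: 'f
  show "0 \<le> av (x - y)" by (rule av_nonneg)
  show "av (x - y) = av (y - x)"
    using av_mult[of "- 1" "y - x"] av_minus_one by simp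
  show "av (x - y) = 0 \<longleftrightarrow> x = y" by (simp add: av_eq_0)
  have "av (x - z) \<le> max (av (x - y)) (av (y - z))"
    using av_ultra[of "x - y" "y - z"] by simp
  then show "av (x - z) \<le> av (x - y) + av (y - z)"
    using av_nonneg[of "x - y"] av_nonneg[of "y - z"] by linarith
qed

end


section \<open>Quotients and Haar measures of topological groups\<close>

text \<open>Topological groups are given by a group \<open>G\<close> of HOL-Algebra together with a topology \<open>T\<close>
  on its carrier.\<close>

definition center :: "('g, 'b) monoid_scheme \<Rightarrow> 'g set" where
  "center G = {z \<in> carrier G. \<forall>g \<in> carrier G. z \<otimes>\<^bsub>G\<^esub> g = g \<otimes>\<^bsub>G\<^esub> z}"

definition quotient_topology ::
    "('g, 'b) monoid_scheme \<Rightarrow> 'g topology \<Rightarrow> 'g set \<Rightarrow> 'g set topology" where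
  "quotient_topology G T N =
     topology (\<lambda>U. U \<subseteq> carrier (G Mod N) \<and> openin T (\<Union>U))"

lemma (in group) openin_quotient_topology:
  assumes "subgroup N G"
  shows "openin (quotient_topology G T N) U \<longleftrightarrow> U \<subseteq> carrier (G Mod N) \<and> openin T (\<Union>U)"
proof -
  have "istopology (\<lambda>U. U \<subseteq> carrier (G Mod N) \<and> openin T (\<Union>U))"
    unfolding istopology_def
  proof (intro conjI allI impI)
    fix S S' assume S: "S \<subseteq> carrier (G Mod N) \<and> openin T (\<Union>S)"
      and S': "S' \<subseteq> carrier (G Mod N) \<and> openin T (\<Union>S')"
    have "\<Union>(S \<inter> S') = \<Union>S \<inter> \<Union>S'"
    proof
      show "\<Union>S \<inter> \<Union>S' \<subseteq> \<Union>(S \<inter> S')"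
      proof
        fix x assume "x \<in> \<Union>S \<inter> \<Union>S'"
        then obtain A B where AB: "A \<in> S" "x \<in> A" "B \<in> S'" "x \<in> B" by blast
        with S S' have "A \<in> rcosets N" "B \<in> rcosets N" by (auto simp: FactGroup_def)
        with AB have "A = B" using rcos_disjoint[OF assms] by (auto simp: pairwise_def disjnt_def)
        with AB show "x \<in> \<Union>(S \<inter> S')" by blast
      qed
    qed blast
    with S S' show "openin T (\<Union>(S \<inter> S'))" by auto
  next
    fix \<K> assume *: "\<forall>S \<in> \<K>. S \<subseteq> carrier (G Mod N) \<and> openin T (\<Union>S)"
    have "\<Union>(\<Union>\<K>) = \<Union>(Union ` \<K>)" by blast
    with * show "openin T (\<Union>(\<Union>\<K>))" by (metis (no_types, lifting) imageE openin_Union)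
  qed blast+
  then show ?thesis by (simp add: quotient_topology_def topology_inverse')
qed

text \<open>Left Haar measures on the Borel sets. For second countable locally compact Hausdorff groups,
  such as those considered here, regularity is automatic.\<close>

definition haar_measure :: "('g, 'b) monoid_scheme \<Rightarrow> 'g topology \<Rightarrow> 'g measure \<Rightarrow> bool" where
  "haar_measure G T \<mu> \<longleftrightarrow>
     space \<mu> = carrier G \<and>
     sets \<mu> = sigma_sets (carrier G) {U. openin T U} \<and>
     (\<forall>g \<in> carrier G. \<forall>A \<in> sets \<mu>. emeasure \<mu> (g <#\<^bsub>G\<^esub> A) = emeasure \<mu> A) \<and>
     (\<forall>K. compactin T K \<longrightarrow> emeasure \<mu> K < \<infinity>) \<and>
     (\<forall>U. openin T U \<and> U \<noteq> {} \<longrightarrow> 0 < emeasure \<mu> U)"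


section \<open>Smooth complex representations\<close>

text \<open>A representation acts on the complex vector space formed by a whole type \<open>'v\<close> with scalar
  multiplication \<open>sc\<close>; its values outside the carrier of the group are irrelevant.\<close>

definition group_rep ::
    "('g, 'b) monoid_scheme \<Rightarrow> (complex \<Rightarrow> 'v \<Rightarrow> 'v::ab_group_add) \<Rightarrow> ('g \<Rightarrow> 'v \<Rightarrow> 'v) \<Rightarrow> bool" where
  "group_rep G sc \<pi> \<longleftrightarrow>
     vector_space sc \<and>
     (\<forall>g \<in> carrier G. Vector_Spaces.linear sc sc (\<pi> g)) \<and>
     \<pi> \<one>\<^bsub>G\<^esub> = id \<and>
     (\<forall>g \<in> carrier G. \<forall>h \<in> carrier G. \<pi> (g \<otimes>\<^bsub>G\<^esub> h) = \<pi> g \<circ> \<pi> h)"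

definition smooth_representation ::
    "('g, 'b) monoid_scheme \<Rightarrow> 'g topology \<Rightarrow> (complex \<Rightarrow> 'v \<Rightarrow> 'v::ab_group_add)
       \<Rightarrow> ('g \<Rightarrow> 'v \<Rightarrow> 'v) \<Rightarrow> bool" where
  "smooth_representation G T sc \<pi> \<longleftrightarrow>
     group_rep G sc \<pi> \<and> (\<forall>v. openin T {g \<in> carrier G. \<pi> g v = v})"

definition irreducible_representation ::
    "('g, 'b) monoid_scheme \<Rightarrow> (complex \<Rightarrow> 'v \<Rightarrow> 'v::ab_group_add) \<Rightarrow> ('g \<Rightarrow> 'v \<Rightarrow> 'v) \<Rightarrow> bool" where
  "irreducible_representation G sc \<pi> \<longleftrightarrow>
     (\<exists>v::'v. v \<noteq> 0) \<and>
     (\<forall>U. module.subspace sc U \<and> (\<forall>g \<in> carrier G. \<forall>u \<in> U. \<pi> g u \<in> U)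
        \<longrightarrow> U = {0} \<or> U = UNIV)"

definition rep_equiv ::
    "('g, 'b) monoid_scheme \<Rightarrow> (complex \<Rightarrow> 'v \<Rightarrow> 'v::ab_group_add) \<Rightarrow> ('g \<Rightarrow> 'v \<Rightarrow> 'v)
       \<Rightarrow> (complex \<Rightarrow> 'w \<Rightarrow> 'w::ab_group_add) \<Rightarrow> ('g \<Rightarrow> 'w \<Rightarrow> 'w) \<Rightarrow> bool" where
  "rep_equiv G sc \<pi> sc' \<pi>' \<longleftrightarrow>
     (\<exists>L. Vector_Spaces.linear sc sc' L \<and> bij L \<and>
          (\<forall>g \<in> carrier G. \<forall>v. L (\<pi> g v) = \<pi>' g (L v)))"

definition smooth_dual ::
    "('g, 'b) monoid_scheme \<Rightarrow> 'g topology \<Rightarrow> (complex \<Rightarrow> 'v \<Rightarrow> 'v::ab_group_add)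
       \<Rightarrow> ('g \<Rightarrow> 'v \<Rightarrow> 'v) \<Rightarrow> ('v \<Rightarrow> complex) set" where
  "smooth_dual G T sc \<pi> =
     {f. Vector_Spaces.linear sc (*) f \<and>
         openin T {g \<in> carrier G. \<forall>v. f (\<pi> g v) = f v}}"

text \<open>Since the central character is unitary, the absolute value of a matrix coefficient descends to
  \<open>G / Z(G)\<close>; below, \<open>F\<close> is the squared absolute value as a function on \<open>G / Z(G)\<close>.\<close>

definition discrete_series ::
    "('g, 'b) monoid_scheme \<Rightarrow> 'g topology \<Rightarrow> (complex \<Rightarrow> 'v \<Rightarrow> 'v::ab_group_add)
       \<Rightarrow> ('g \<Rightarrow> 'v \<Rightarrow> 'v) \<Rightarrow> bool" where
  "discrete_series G T sc \<pi> \<longleftrightarrow>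
     smooth_representation G T sc \<pi> \<and>
     irreducible_representation G sc \<pi> \<and>
     (\<forall>z \<in> center G. \<exists>c. norm c = 1 \<and> (\<forall>v. \<pi> z v = sc c v)) \<and>
     (\<exists>\<mu>. haar_measure (G Mod center G) (quotient_topology G T (center G)) \<mu> \<and>
        (\<forall>v. \<forall>f \<in> smooth_dual G T sc \<pi>.
           \<exists>F :: 'g set \<Rightarrow> real.
             (\<forall>g \<in> carrier G. F (center G #>\<^bsub>G\<^esub> g) = (norm (f (\<pi> g v)))\<^sup>2) \<and>
             integrable \<mu> F))"

definition twist ::
    "(complex \<Rightarrow> 'v \<Rightarrow> 'v::ab_group_add) \<Rightarrow> ('g \<Rightarrow> complex) \<Rightarrow> ('g \<Rightarrow> 'v \<Rightarrow> 'v) \<Rightarrow> 'g \<Rightarrow> 'v \<Rightarrow> 'v" where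
  "twist sc \<eta> \<pi> = (\<lambda>g v. sc (\<eta> g) (\<pi> g v))"

text \<open>The action of a single element \<open>g\<close> of the normaliser of \<open>M\<close> in \<open>G\<close> on representations of \<open>M\<close>.\<close>

definition conj_rep ::
    "('g, 'b) monoid_scheme \<Rightarrow> 'g \<Rightarrow> ('g \<Rightarrow> 'v \<Rightarrow> 'v) \<Rightarrow> 'g \<Rightarrow> 'v \<Rightarrow> 'v" where
  "conj_rep G g \<pi> = (\<lambda>m. \<pi> (inv\<^bsub>G\<^esub> g \<otimes>\<^bsub>G\<^esub> m \<otimes>\<^bsub>G\<^esub> g))"


section \<open>Levi subgroups of the special linear group\<close>

definition SL :: "nat \<Rightarrow> 'f::field mat monoid" where
  "SL n = \<lparr>carrier = {A \<in> carrier_mat n n. det A = 1}, mult = (*), one = 1\<^sub>m n\<rparr>"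

lemma group_SL: "group (SL n :: 'f::field mat monoid)"
proof (rule groupI)
  fix A :: "'f mat" assume "A \<in> carrier (SL n)"
  then have A: "A \<in> carrier_mat n n" "det A = 1" by (auto simp: SL_def)
  then obtain B where B: "B \<in> carrier_mat n n" "B * A = 1\<^sub>m n"
    using det_non_zero_imp_unit[of A n "()"] by (auto simp: Units_def ring_mat_def)
  then have "det B = 1" using det_mult[of B n A] A by simp
  with B show "\<exists>B \<in> carrier (SL n). B \<otimes>\<^bsub>SL n\<^esub> A = \<one>\<^bsub>SL n\<^esub>" by (auto simp: SL_def)
qed (auto simp: SL_def det_mult)

definition GL_levi :: "nat list \<Rightarrow> 'f::field mat set" where
  "GL_levi ds = {diag_block_mat Bs | Bs.
     list_all2 (\<lambda>B d. B \<in> carrier_mat d d \<and> invertible_mat B) Bs ds}"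

definition SL_levi :: "nat \<Rightarrow> nat list \<Rightarrow> 'f::field mat set" where
  "SL_levi n ds = GL_levi ds \<inter> carrier (SL n)"

definition SL_levi_group :: "nat \<Rightarrow> nat list \<Rightarrow> 'f::field mat monoid" where
  "SL_levi_group n ds = (SL n)\<lparr>carrier := SL_levi n ds\<rparr>"

text \<open>The topology of entrywise convergence.\<close>

definition mat_topology :: "('f::field \<Rightarrow> real) \<Rightarrow> nat \<Rightarrow> 'f mat topology" where
  "mat_topology av n =
     pullback_topology (carrier_mat n n) (\<lambda>A. \<lambda>p \<in> {..<n} \<times> {..<n}. A $$ p)
       (product_topology (\<lambda>_. val_topology av) ({..<n} \<times> {..<n}))"

definition SL_levi_topology :: "('f::field \<Rightarrow> real) \<Rightarrow> nat \<Rightarrow> nat list \<Rightarrow> 'f mat topology" where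
  "SL_levi_topology av n ds = subtopology (mat_topology av n) (SL_levi n ds)"

text \<open>The block sizes of the partition \<open>n = a\<^sub>1 n\<^sub>1 + \<dots> + a\<^sub>r n\<^sub>r\<close> with \<open>a\<^sub>i\<close> blocks of size
  \<open>n\<^sub>i = d i\<close>.\<close>

definition block_sizes :: "nat \<Rightarrow> (nat \<Rightarrow> nat) \<Rightarrow> (nat \<Rightarrow> nat) \<Rightarrow> nat list" where
  "block_sizes r a d = concat (map (\<lambda>i. replicate (a i) (d i)) [1..<Suc r])"


section \<open>Unramified characters\<close>

definition units_group :: "'k::field monoid" where
  "units_group = \<lparr>carrier = UNIV - {0}, mult = (*), one = 1\<rparr>"

inductive_set poly_funs :: "nat \<Rightarrow> ('f::field mat \<Rightarrow> 'f) set" for n where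
  const: "(\<lambda>_. c) \<in> poly_funs n"
| entry: "i < n \<Longrightarrow> j < n \<Longrightarrow> (\<lambda>A. A $$ (i, j)) \<in> poly_funs n"
| add: "p \<in> poly_funs n \<Longrightarrow> q \<in> poly_funs n \<Longrightarrow> (\<lambda>A. p A + q A) \<in> poly_funs n"
| mult: "p \<in> poly_funs n \<Longrightarrow> q \<in> poly_funs n \<Longrightarrow> (\<lambda>A. p A * q A) \<in> poly_funs n"

text \<open>A Levi subgroup \<open>M\<close> of \<open>SL\<^sub>n\<close> is closed in the affine space of all \<open>n \<times> n\<close> matrices, so its
  regular functions are the restrictions of polynomials in the matrix entries (no inverse of the
  determinant is needed); and as \<open>F\<close> is infinite, the rational points are Zariski dense, so that
  characters of \<open>M\<close> defined over \<open>F\<close> can be regarded as functions on \<open>M(F)\<close>.\<close>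

definition rational_characters :: "nat \<Rightarrow> nat list \<Rightarrow> ('f::field mat \<Rightarrow> 'f) set" where
  "rational_characters n ds =
     {\<psi> \<in> hom (SL_levi_group n ds) units_group.
        \<exists>p \<in> poly_funs n. \<forall>m \<in> SL_levi n ds. \<psi> m = p m}"

text \<open>The subgroup \<open>M\<^sup>1\<close>, the common kernel of all \<open>|\<psi>|\<close>. It is open in \<open>M\<close>, so
  characters trivial on it are automatically continuous.\<close>

definition SL_levi_1 :: "('f::field \<Rightarrow> real) \<Rightarrow> nat \<Rightarrow> nat list \<Rightarrow> 'f mat set" where
  "SL_levi_1 av n ds =
     {m \<in> SL_levi n ds. \<forall>\<psi> \<in> rational_characters n ds. av (\<psi> m) = 1}"

definition unitary_unramified_characters ::
    "('f::field \<Rightarrow> real) \<Rightarrow> nat \<Rightarrow> nat list \<Rightarrow> ('f mat \<Rightarrow> complex) set" where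
  "unitary_unramified_characters av n ds =
     {\<eta> \<in> hom (SL_levi_group n ds) units_group.
        (\<forall>m \<in> SL_levi_1 av n ds. \<eta> m = 1) \<and> (\<forall>m \<in> SL_levi n ds. norm (\<eta> m) = 1)}"


section \<open>Orbits and their stabilisers\<close>

definition unramified_orbit ::
    "('f::field \<Rightarrow> real) \<Rightarrow> nat \<Rightarrow> nat list \<Rightarrow> (complex \<Rightarrow> 'v \<Rightarrow> 'v::ab_group_add)
       \<Rightarrow> ('f mat \<Rightarrow> 'v \<Rightarrow> 'v) \<Rightarrow> ('f mat \<Rightarrow> 'v \<Rightarrow> 'v) set" where
  "unramified_orbit av n ds sc \<sigma> =
     {twist sc \<eta> \<sigma> | \<eta>. \<eta> \<in> unitary_unramified_characters av n ds}"

definition weyl_group :: "nat \<Rightarrow> nat list \<Rightarrow> 'f::field mat set monoid" where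
  "weyl_group n ds =
     (SL n)\<lparr>carrier := normalizer (SL n) (SL_levi n ds)\<rparr> Mod SL_levi n ds"

text \<open>Elements \<open>w\<close> of \<open>W(M)\<close> are cosets. Up to equivalence of representations, \<open>\<^sup>w\<sigma>\<close> is given by
  \<open>conj_rep\<close> for an arbitrary representative \<open>g \<in> w\<close>: two representatives differ by an element of
  \<open>M\<close>, and the following lemma applies.\<close>

lemma (in group) rep_equiv_conj_rep:
  assumes M: "subgroup M G" and \<pi>: "group_rep (G\<lparr>carrier := M\<rparr>) sc \<pi>"
    and g: "g \<in> normalizer G M" and m: "m \<in> M"
  shows "rep_equiv (G\<lparr>carrier := M\<rparr>) sc (conj_rep G (m \<otimes> g) \<pi>) sc (conj_rep G g \<pi>)"
proof -
  have gG: "g \<in> carrier G" and gM: "g <# M #> inv g = M"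
    using g subgroup.subset[OF M] by (auto simp: normalizer_def stabilizer_def)
  have sub: "x \<in> carrier G" if "x \<in> M" for x
    using that subgroup.subset[OF M] by blast
  have conjM: "inv g \<otimes> x \<otimes> g \<in> M" if x: "x \<in> M" for x
  proof -
    from x gM obtain y where y: "y \<in> M" "x = g \<otimes> y \<otimes> inv g"
      by (auto simp: l_coset_def r_coset_def)
    then have "inv g \<otimes> x \<otimes> g = y" using gG sub by (simp add: m_assoc inv_solve_left')
    with y show ?thesis by simp
  qed
  have hom: "\<pi> (x \<otimes> y) = \<pi> x \<circ> \<pi> y" if "x \<in> M" "y \<in> M" for x y
    using \<pi> that by (auto simp: group_rep_def)
  have lin: "Vector_Spaces.linear sc sc (\<pi> x)" if "x \<in> M" for x
    using \<pi> that by (auto simp: group_rep_def)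
  define k where "k = inv g \<otimes> m \<otimes> g"
  have k: "k \<in> M" using conjM[OF m] by (simp add: k_def)
  have ik: "inv k \<in> M" using subgroup.m_inv_closed[OF M k] .
  have one: "\<pi> \<one> = id" using \<pi> by (simp add: group_rep_def)
  have 1: "\<pi> k \<circ> \<pi> (inv k) = id" "\<pi> (inv k) \<circ> \<pi> k = id"
    using hom[OF k ik] hom[OF ik k] k sub by (simp_all add: one)
  have "bij (\<pi> k)" using o_bij[OF 1(2) 1(1)] .
  moreover have "\<pi> k (conj_rep G (m \<otimes> g) \<pi> x v) = conj_rep G g \<pi> x (\<pi> k v)"
    if x: "x \<in> M" for x v
  proof -
    have gi: "g \<otimes> (inv g \<otimes> z) = z" if "z \<in> carrier G" for z
      using that gG m_assoc[of g "inv g" z] by simp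
    have mi: "m \<otimes> (inv m \<otimes> z) = z" if "z \<in> carrier G" for z
      using that sub[OF m] m_assoc[of m "inv m" z] by simp
    have mem: "inv (m \<otimes> g) \<otimes> x \<otimes> (m \<otimes> g) \<in> M"
    proof -
      have "inv m \<otimes> x \<otimes> m \<in> M"
        using M m x by (simp add: subgroup.m_closed subgroup.m_inv_closed)
      from conjM[OF this] show ?thesis
        using gG sub[OF m] sub[OF x] by (simp add: inv_mult_group m_assoc)
    qed
    have "k \<otimes> (inv (m \<otimes> g) \<otimes> x \<otimes> (m \<otimes> g)) = (inv g \<otimes> x \<otimes> g) \<otimes> k"
      using gG sub[OF m] sub[OF x] by (simp add: k_def inv_mult_group m_assoc gi mi)
    then have "\<pi> k \<circ> \<pi> (inv (m \<otimes> g) \<otimes> x \<otimes> (m \<otimes> g)) = \<pi> (inv g \<otimes> x \<otimes> g) \<circ> \<pi> k"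
      using hom[OF k mem] hom[OF conjM[OF x] k] by simp
    then show ?thesis by (simp add: conj_rep_def fun_eq_iff)
  qed
  ultimately show ?thesis
    unfolding rep_equiv_def using lin[OF k] by auto
qed

definition weyl_stabilizer ::
    "('f::field \<Rightarrow> real) \<Rightarrow> nat \<Rightarrow> nat list \<Rightarrow> (complex \<Rightarrow> 'v \<Rightarrow> 'v::ab_group_add)
       \<Rightarrow> ('f mat \<Rightarrow> 'v \<Rightarrow> 'v) \<Rightarrow> 'f mat set set" where
  "weyl_stabilizer av n ds sc \<sigma> =
     {w \<in> carrier (weyl_group n ds).
        \<exists>g \<in> w. \<exists>\<eta> \<in> unitary_unramified_characters av n ds.
          rep_equiv (SL_levi_group n ds) sc (conj_rep (SL n) g \<sigma>) sc (twist sc \<eta> \<sigma>)}"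

end

theory Submission
  imports
    Defs
    "HOL-Algebra.Zassenhaus"
    "HOL-Computational_Algebra.Fundamental_Theorem_Algebra"
begin

text \<open>The square-integrability of all smooth matrix coefficients forces the vectors fixed by
  an open compact subgroup to be finite-dimensional. If not all blocks have the same size, the total
  size of the blocks of one fixed size is prime to \<open>n\<close>, so there is a cocharacter
  \<open>s\<close> of the centre of the Levi subgroup \<open>M'\<close> of \<open>GL\<^sub>n\<close>
  with the same blocks, invariant under the normaliser of \<open>M\<close>, with \<open>det (s t) =
  t\<close>. Hence \<open>M' = M \<times> s(F*)\<close>, and \<open>\<sigma>\<close> extends to a
  representation of the product \<open>M'\<close> of general linear groups in a way compatible with
  the Weyl group. By finite-dimensionality the restrictions to the factors determine this
  representation, as for an external tensor product. So one may twist factor by factor, and chooses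
  the twists such that the factors in one orbit of \<open>W\<^sub>O\<close> become conjugate to each
  other. If all blocks have the same size, then \<open>n\<close> being prime, \<open>M\<close> is
  either \<open>SL\<^sub>n\<close>, with trivial Weyl group, or the diagonal torus, where
  \<open>\<sigma>\<close> is a character and may be made trivial on the powers of a uniformiser.\<close>

section \<open>Eigenvectors of operators on finite-dimensional invariant subspaces\<close>

section \<open>Operators on complex vector spaces\<close>

text \<open>The determinant condition is the obstacle: the determinants of the blocks of an element
  of M multiply to 1, so neither \<sigma> nor a twist splits directly into independent contributions
  of the blocks. The cocharacter s removes this, and as it must be fixed by the normaliser, its
  exponents agree on blocks of equal size; if all sizes agree, the exponent sum is a multiple of n
  and cannot be 1, hence the separate case. The extension to M' is never formed: \<open>R\<close>
  composes the passage to a set of blocks with the projection of M' = M x s(F^x) onto M, so that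
  everything happens inside M. Nor are tensor products formed. In their place stand operators p, one
  for each block, in the bicommutant of that block's action, such that p a p is a scalar multiple of
  p for every a in the action; they behave like rank one operators on one tensor factor, and their
  scalars determine the joint representation. Finding p means minimising a rank, and
  square-integrability supplies the finite-dimensional space for it. Transports between blocks along
  different elements of the stabiliser must agree up to isomorphism: an element fixing a block acts
  on it like an element of M (\<open>inner\<close>).\<close>

locale complex_vector_space = vector_space scale
  for scale :: "complex \<Rightarrow> 'v::ab_group_add \<Rightarrow> 'v" (infixr "*\<^sub>C" 75)
begin

abbreviation lin :: "('v \<Rightarrow> 'v) \<Rightarrow> bool" where
  "lin \<equiv> Vector_Spaces.linear scale scale"

lemma lin_iff: "lin f \<longleftrightarrow> (\<forall>x y. f (x + y) = f x + f y) \<and> (\<forall>c x. f (c *\<^sub>C x) = c *\<^sub>C f x)"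
  using vector_space_axioms by (simp add: Vector_Spaces.linear_iff)

lemma lin_add: "lin f \<Longrightarrow> f (x + y) = f x + f y"
  and lin_scale: "lin f \<Longrightarrow> f (c *\<^sub>C x) = c *\<^sub>C f x"
  by (simp_all add: lin_iff)

lemma lin_zero: "lin f \<Longrightarrow> f 0 = 0"
  using lin_add[of f 0 0] by simp

lemma lin_minus: "lin f \<Longrightarrow> f (- x) = - f x"
  using lin_add[of f x "- x"] lin_zero[of f] by (simp add: minus_unique)

lemma lin_diff: "lin f \<Longrightarrow> f (x - y) = f x - f y"
  using lin_add[of f x "- y"] lin_minus[of f y] by simp

lemma lin_sum: "lin f \<Longrightarrow> f (sum g A) = (\<Sum>x\<in>A. f (g x))"
  by (induction A rule: infinite_finite_induct) (simp_all add: lin_zero lin_add)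

lemma lin_comp: "lin f \<Longrightarrow> lin g \<Longrightarrow> lin (f \<circ> g)"
  by (simp add: lin_iff)

lemma lin_id: "lin id" "lin (\<lambda>x. x)"
  by (simp_all add: lin_iff)

lemma lin_scaled: "lin f \<Longrightarrow> lin (\<lambda>x. c *\<^sub>C f x)"
  by (simp add: lin_iff scale_right_distrib scale_left_commute)

lemma lin_sub: "lin f \<Longrightarrow> lin g \<Longrightarrow> lin (\<lambda>x. f x - g x)"
  by (simp add: lin_iff scale_right_diff_distrib)

lemma lin_inv_into:
  assumes "lin f" "bij f" shows "lin (inv_into UNIV f)"
proof -
  have "inv_into UNIV f (x + y) = inv_into UNIV f x + inv_into UNIV f y" for x y
    by (metis assms bij_inv_eq_iff lin_add)
  moreover have "inv_into UNIV f (c *\<^sub>C x) = c *\<^sub>C inv_into UNIV f x" for c x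
    by (metis assms bij_inv_eq_iff lin_scale)
  ultimately show ?thesis by (simp add: lin_iff)
qed

lemma lin_image_span: 
  assumes "lin f" shows "f ` span B = span (f ` B)"
  by (metis assms linear_iff_module_hom module_hom.span_image)

definition poly_act :: "('v \<Rightarrow> 'v) \<Rightarrow> 'v \<Rightarrow> complex poly \<Rightarrow> 'v" where
  "poly_act T w P = (\<Sum>j\<le>degree P. coeff P j *\<^sub>C (T ^^ j) w)"

lemma poly_act_bound:
  assumes "degree P \<le> m"
  shows "poly_act T w P = (\<Sum>j\<le>m. coeff P j *\<^sub>C (T ^^ j) w)"
  unfolding poly_act_def
  by (rule sum.mono_neutral_left) (use assms in \<open>auto simp: coeff_eq_0\<close>)

lemma poly_act_linear_factor:
  assumes T: "lin T"
  shows "poly_act T w ([:- l, 1:] * Q) = T (poly_act T w Q) - l *\<^sub>C poly_act T w Q"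
proof -
  let ?m = "Suc (degree Q)"
  have "degree ([:- l, 1:] * Q) \<le> ?m"
    using degree_mult_le[of "[:- l, 1:]" Q] by simp
  then have "poly_act T w ([:- l, 1:] * Q)
      = (\<Sum>j\<le>?m. (coeff (pCons 0 Q) j - l * coeff Q j) *\<^sub>C (T ^^ j) w)"
    by (simp add: poly_act_bound)
  also have "\<dots> = (\<Sum>j\<le>?m. coeff (pCons 0 Q) j *\<^sub>C (T ^^ j) w)
      - (\<Sum>j\<le>?m. (l * coeff Q j) *\<^sub>C (T ^^ j) w)"
    by (simp only: scale_left_diff_distrib sum_subtractf)
  also have "(\<Sum>j\<le>?m. coeff (pCons 0 Q) j *\<^sub>C (T ^^ j) w) = T (poly_act T w Q)"
    unfolding sum.atMost_Suc_shift poly_act_def by (simp add: lin_sum[OF T] lin_scale[OF T])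
  also have "(\<Sum>j\<le>?m. (l * coeff Q j) *\<^sub>C (T ^^ j) w) = l *\<^sub>C (\<Sum>j\<le>?m. coeff Q j *\<^sub>C (T ^^ j) w)"
    by (simp add: scale_sum_right scale_right_distrib)
  also have "(\<Sum>j\<le>?m. coeff Q j *\<^sub>C (T ^^ j) w) = poly_act T w Q"
    by (rule poly_act_bound[symmetric]) simp
  finally show ?thesis .
qed

text \<open>The relation is between indexed vectors rather than members of a set, because the powers
  \<open>(T ^^ j) w\<close> to which it is applied may coincide; a coincidence is itself a relation,
  with coefficients 1 and -1.\<close>

lemma linear_relation_exists:
  fixes f :: "nat \<Rightarrow> 'v"
  assumes "finite B" "\<And>j. f j \<in> span B"
  shows "\<exists>c. (\<exists>j\<le>card B. c j \<noteq> 0) \<and> (\<Sum>j\<le>card B. c j *\<^sub>C f j) = 0"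
proof (cases "inj_on f {..card B}")
  case True
  have "\<not> independent (f ` {..card B})"
    using independent_span_bound[OF assms(1), of "f ` {..card B}"] assms(2) card_image[OF True] by auto
  then obtain u where u: "\<exists>v\<in>f ` {..card B}. u v \<noteq> 0" "(\<Sum>v\<in>f ` {..card B}. u v *\<^sub>C v) = 0"
    by (subst (asm) dependent_finite) auto
  then have "(\<Sum>j\<le>card B. u (f j) *\<^sub>C f j) = 0"
    by (simp add: sum.reindex[OF True])
  with u(1) show ?thesis by (intro exI[of _ "\<lambda>j. u (f j)"]) auto
next
  case False
  then obtain i j where ij: "i \<le> card B" "j \<le> card B" "f i = f j" "i \<noteq> j"
    by (auto simp: inj_on_def)
  define c :: "nat \<Rightarrow> complex" where "c = (\<lambda>l. if l = i then 1 else if l = j then - 1 else 0)"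
  have "(\<Sum>l\<le>card B. c l *\<^sub>C f l) = (\<Sum>l\<in>{i, j}. c l *\<^sub>C f l)"
    by (rule sum.mono_neutral_right) (use ij in \<open>auto simp: c_def\<close>)
  also have "\<dots> = 0" using ij by (simp add: c_def)
  finally show ?thesis using ij(1) by (intro exI[of _ c]) (auto simp: c_def)
qed

text \<open>The polynomial P of least degree annihilating w has a root l; writing P as
  \<open>[:- l, 1:] * Q\<close>, the vector Q(T) w is nonzero by minimality and is killed by T - l.
  Finite-dimensionality of W is expressed by its lying in the span of a finite set.\<close>

lemma exists_eigenvector:
  assumes T: "lin T" and "subspace W" and TW: "T ` W \<subseteq> W"
    and B: "finite B" "W \<subseteq> span B" and w: "w \<in> W" "w \<noteq> 0"
  obtains l x where "x \<in> W" "x \<noteq> 0" "T x = l *\<^sub>C x"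
proof -
  have fW: "(T ^^ j) w \<in> W" for j
    by (induction j) (use w TW in auto)
  then obtain c where c: "\<exists>j\<le>card B. c j \<noteq> 0" "(\<Sum>j\<le>card B. c j *\<^sub>C (T ^^ j) w) = 0"
    using linear_relation_exists[OF B(1), of "\<lambda>j. (T ^^ j) w"] B(2) by blast
  define P0 where "P0 = (\<Sum>j\<le>card B. monom (c j) j)"
  have cP0: "coeff P0 j = (if j \<le> card B then c j else 0)" for j
    by (simp add: P0_def coeff_sum)
  have "degree P0 \<le> card B" by (rule degree_le) (simp add: cP0)
  then have "poly_act T w P0 = 0" using c(2) by (simp add: poly_act_bound cP0)
  moreover have "P0 \<noteq> 0" using c(1) cP0 by (metis coeff_0)
  ultimately have ex: "\<exists>P. P \<noteq> 0 \<and> poly_act T w P = 0" by blast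
  define P where "P = arg_min degree (\<lambda>P. P \<noteq> 0 \<and> poly_act T w P = 0)"
  have P: "P \<noteq> 0" "poly_act T w P = 0"
    using arg_min_natI[of "\<lambda>P. P \<noteq> 0 \<and> poly_act T w P = 0" _ degree] ex
    unfolding P_def by blast+
  have P_min: "degree P \<le> degree Q" if "Q \<noteq> 0" "poly_act T w Q = 0" for Q
    using arg_min_nat_le[of "\<lambda>P. P \<noteq> 0 \<and> poly_act T w P = 0" Q degree] that
    unfolding P_def by blast
  have "degree P \<noteq> 0"
  proof
    assume "degree P = 0"
    then have "poly_act T w P = coeff P 0 *\<^sub>C w" "coeff P 0 \<noteq> 0"
      using P(1) leading_coeff_0_iff[of P] by (simp_all add: poly_act_def)
    then show False using P(2) w(2) by simp
  qed
  then have "\<not> constant (poly P)" by (simp add: constant_degree)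
  then obtain l where "poly P l = 0" using fundamental_theorem_of_algebra by blast
  then obtain Q where Q: "P = [:- l, 1:] * Q" by (meson dvdE poly_eq_0_iff_dvd)
  have "Q \<noteq> 0" using P(1) Q by auto
  moreover have "degree P = Suc (degree Q)"
    using \<open>Q \<noteq> 0\<close> unfolding Q by (subst degree_mult_eq) auto
  ultimately have "poly_act T w Q \<noteq> 0" using P_min[of Q] by auto
  moreover have "poly_act T w Q \<in> W"
    unfolding poly_act_def using fW assms(2) by (intro subspace_sum subspace_scale) auto
  moreover have "T (poly_act T w Q) = l *\<^sub>C poly_act T w Q"
    using P(2) poly_act_linear_factor[OF T, of w l Q] Q by simp
  ultimately show ?thesis using that by blast
qed

end

section \<open>Averaging over groups of operators with finite orbits\<close>

context complex_vector_space begin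

text \<open>Only finitely many differences k u - u enter into v. K permutes the finite union S of
  the orbits of their u through a finite set Q of permutations, and the sum over Q kills each
  difference while it multiplies the fixed vector v by card Q.\<close>

lemma finite_orbit_projection_unique:
  fixes K :: "('v \<Rightarrow> 'v) set"
  assumes lin: "\<And>k. k \<in> K \<Longrightarrow> lin k"
    and comp: "\<And>k l. k \<in> K \<Longrightarrow> l \<in> K \<Longrightarrow> k \<circ> l \<in> K"
    and id: "id \<in> K"
    and inv: "\<And>k. k \<in> K \<Longrightarrow> \<exists>l\<in>K. l \<circ> k = id"
    and fin: "\<And>v. finite ((\<lambda>k. k v) ` K)"
    and v: "v \<in> span {k u - u | k u. k \<in> K}" "\<And>k. k \<in> K \<Longrightarrow> k v = v"
  shows "v = 0"
proof -
  obtain t r where t: "finite t" "t \<subseteq> {k u - u | k u. k \<in> K}" "v = (\<Sum>a\<in>t. r a *\<^sub>C a)"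
    using v(1) unfolding span_explicit by blast
  have "\<forall>a\<in>t. \<exists>k u. k \<in> K \<and> a = k u - u" using t(2) by blast
  then obtain \<kappa> \<upsilon> where \<kappa>: "\<And>a. a \<in> t \<Longrightarrow> \<kappa> a \<in> K" "\<And>a. a \<in> t \<Longrightarrow> a = \<kappa> a (\<upsilon> a) - \<upsilon> a"
    by metis
  define S where "S = (\<Union>a\<in>t. (\<lambda>k. k (\<upsilon> a)) ` K)"
  have S: "finite S" using t(1) fin by (auto simp: S_def)
  have S_stable: "k u \<in> S" if "k \<in> K" "u \<in> S" for k u
  proof -
    obtain a l where "a \<in> t" "l \<in> K" "u = l (\<upsilon> a)" using \<open>u \<in> S\<close> by (auto simp: S_def)
    moreover from this have "k \<circ> l \<in> K" using comp[OF that(1)] by blast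
    ultimately show ?thesis unfolding S_def by (auto intro!: bexI[of _ a] image_eqI[of _ _ "k \<circ> l"])
  qed
  have \<upsilon>S: "\<upsilon> a \<in> S" if "a \<in> t" for a
    unfolding S_def using that id by (auto intro!: bexI[of _ a] image_eqI[of _ _ id])
  define Q where "Q = (\<lambda>k. restrict k S) ` K"
  have "Q \<subseteq> S \<rightarrow>\<^sub>E S" using S_stable by (auto simp: Q_def)
  then have Q: "finite Q" using S finite_PiE[of S "\<lambda>_. S"] finite_subset by blast
  have "\<forall>q\<in>Q. \<exists>k. k \<in> K \<and> restrict k S = q" by (auto simp: Q_def)
  then obtain \<rho> where \<rho>: "\<And>q. q \<in> Q \<Longrightarrow> \<rho> q \<in> K" "\<And>q. q \<in> Q \<Longrightarrow> restrict (\<rho> q) S = q"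
    by metis
  have \<rho>S: "\<rho> q u = q u" if "q \<in> Q" "u \<in> S" for q u
    using \<rho>(2)[OF that(1)] that(2) by (metis restrict_apply')
  \<comment> \<open>An element q of Q carries information on S only, so a representative
    \<open>\<rho> q\<close> in K is summed instead. The sum is linear everywhere; its invariance is
    available on S, where the vectors \<open>\<upsilon> a\<close> and their translates lie.\<close>
  define A where "A = (\<lambda>x. \<Sum>q\<in>Q. \<rho> q x)"
  have \<rho>_lin: "lin (\<rho> q)" if "q \<in> Q" for q using lin \<rho>(1) that by blast
  have A: "lin A"
    unfolding lin_iff A_def sum.distrib[symmetric] scale_sum_right
    using lin_add[OF \<rho>_lin] lin_scale[OF \<rho>_lin] by (auto intro: sum.cong)
  have A_inv: "A (k u) = A u" if k: "k \<in> K" and u: "u \<in> S" for k u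
  proof -
    \<comment> \<open>Composition with k on the right permutes Q, which makes the sum over Q
      invariant under u \<mapsto> k u.\<close>
    define \<phi> :: "('v \<Rightarrow> 'v) \<Rightarrow> 'v \<Rightarrow> 'v" where "\<phi> = (\<lambda>q. restrict (q \<circ> k) S)"
    have "\<phi> ` Q \<subseteq> Q"
    proof
      fix q' assume "q' \<in> \<phi> ` Q"
      then obtain l where l: "l \<in> K" "q' = \<phi> (restrict l S)" by (auto simp: Q_def)
      have "q' = restrict (l \<circ> k) S"
        unfolding l(2) \<phi>_def using S_stable[OF k] by (auto simp: restrict_def fun_eq_iff)
      then show "q' \<in> Q" using comp[OF l(1) k] by (auto simp: Q_def)
    qed
    moreover have "inj_on \<phi> Q"
    proof (rule inj_onI)
      fix q q' assume q: "q \<in> Q" "q' \<in> Q" "\<phi> q = \<phi> q'"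
      obtain l where l: "l \<in> K" "l \<circ> k = id" using inv[OF k] by blast
      have "inj k" using l(2) by (metis inj_on_id inj_on_imageI2)
      then have "k ` S = S" using S S_stable[OF k] by (intro endo_inj_surj) (auto intro: inj_on_subset)
      have "q x = q' x" for x
      proof (cases "x \<in> S")
        case True
        then obtain y where "y \<in> S" "x = k y" using \<open>k ` S = S\<close> by blast
        then show ?thesis using fun_cong[OF q(3), of y] by (simp add: \<phi>_def)
      next
        case False
        then show ?thesis using q(1,2) by (auto simp: Q_def)
      qed
      then show "q = q'" by blast
    qed
    ultimately have bij: "bij_betw \<phi> Q Q"
      using Q by (simp add: bij_betw_def endo_inj_surj)
    have "A (k u) = (\<Sum>q\<in>Q. q (k u))"
      unfolding A_def by (rule sum.cong) (use \<rho>S S_stable[OF k u] in auto)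
    also have "\<dots> = (\<Sum>q\<in>Q. \<phi> q u)" using u by (simp add: \<phi>_def)
    also have "\<dots> = (\<Sum>q\<in>Q. q u)" by (rule sum.reindex_bij_betw[OF bij])
    also have "\<dots> = A u"
      unfolding A_def by (rule sum.cong) (use \<rho>S u in auto)
    finally show ?thesis .
  qed
  have "A v = (\<Sum>a\<in>t. r a *\<^sub>C A (\<kappa> a (\<upsilon> a) - \<upsilon> a))"
    unfolding t(3) lin_sum[OF A] lin_scale[OF A] by (rule sum.cong) (use \<kappa> in auto)
  also have "\<dots> = 0"
    by (rule sum.neutral) (use A_inv \<kappa>(1) \<upsilon>S in \<open>simp add: lin_diff[OF A]\<close>)
  finally have "A v = 0" .
  moreover have "A v = of_nat (card Q) *\<^sub>C v"
  proof -
    have "A v = (\<Sum>q\<in>Q. v)" unfolding A_def by (rule sum.cong) (use v(2) \<rho>(1) in auto)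
    then show ?thesis by (simp only: sum_constant_scale)
  qed
  moreover have "card Q \<noteq> 0" using Q id by (auto simp: Q_def)
  ultimately show ?thesis by simp
qed

text \<open>E is the projection onto the K-invariant vectors along the span W of all k u - u.
  Averaging v over its own finite orbit gives one decomposition, and its uniqueness, by the previous
  lemma, yields linearity and commutation with every operator that commutes with K. This takes the
  place of averaging over a compact group by Haar measure.\<close>

lemma finite_orbit_projection:
  fixes K :: "('v \<Rightarrow> 'v) set"
  assumes lin: "\<And>k. k \<in> K \<Longrightarrow> lin k"
    and comp: "\<And>k l. k \<in> K \<Longrightarrow> l \<in> K \<Longrightarrow> k \<circ> l \<in> K"
    and id: "id \<in> K"
    and inv: "\<And>k. k \<in> K \<Longrightarrow> \<exists>l\<in>K. l \<circ> k = id"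
    and fin: "\<And>v. finite ((\<lambda>k. k v) ` K)"
  obtains E where "lin E"
    "\<And>k v. k \<in> K \<Longrightarrow> k (E v) = E v" "\<And>k v. k \<in> K \<Longrightarrow> E (k v) = E v"
    "\<And>v. (\<And>k. k \<in> K \<Longrightarrow> k v = v) \<Longrightarrow> E v = v"
    "\<And>T v. lin T \<Longrightarrow> (\<And>k v. k \<in> K \<Longrightarrow> T (k v) = k (T v)) \<Longrightarrow> T (E v) = E (T v)"
proof -
  define I where "I = {v. \<forall>k\<in>K. k v = v}"
  define W where "W = span {k u - u | k u. k \<in> K}"
  have I: "subspace I"
    using lin by (auto simp: I_def subspace_def lin_zero lin_add lin_scale)
  have W: "subspace W" by (simp add: W_def)
  have IW: "v = 0" if "v \<in> I" "v \<in> W" for v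
    using finite_orbit_projection_unique[of K v, OF lin comp id inv fin] that
    by (auto simp: I_def W_def)
  have ex: "\<exists>e. e \<in> I \<and> v - e \<in> W" for v
  proof -
    define X where "X = (\<lambda>k. k v) ` K"
    have X: "finite X" "X \<noteq> {}" using fin id by (auto simp: X_def)
    define e where "e = (1 / of_nat (card X)) *\<^sub>C \<Sum>X"
    have "k e = e" if k: "k \<in> K" for k
    proof -
      obtain l where l: "l \<in> K" "l \<circ> k = id" using inv[OF k] by blast
      have "inj k" using l(2) by (metis inj_on_id inj_on_imageI2)
      moreover have kO: "k ` X \<subseteq> X"
      proof
        fix y assume "y \<in> k ` X"
        then obtain l where "l \<in> K" "y = (k \<circ> l) v" by (auto simp: X_def)
        then show "y \<in> X" unfolding X_def using comp[OF k] by blast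
      qed
      ultimately have "bij_betw k X X"
        using X(1) inj_on_subset[of k UNIV X] by (auto simp: bij_betw_def endo_inj_surj)
      then have "(\<Sum>x\<in>X. k x) = \<Sum>X" by (rule sum.reindex_bij_betw)
      then show ?thesis by (simp add: e_def lin_scale[OF lin[OF k]] lin_sum[OF lin[OF k]])
    qed
    then have "e \<in> I" by (simp add: I_def)
    moreover have "v - e \<in> W"
    proof -
      have "v - e = (1 / of_nat (card X)) *\<^sub>C (of_nat (card X) *\<^sub>C v - \<Sum>X)"
        using X by (simp add: e_def scale_right_diff_distrib)
      also have "of_nat (card X) *\<^sub>C v - \<Sum>X = (\<Sum>x\<in>X. v - x)"
        by (simp add: sum_subtractf sum_constant_scale)
      also have "(1 / of_nat (card X)) *\<^sub>C \<dots> \<in> W"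
      proof (intro subspace_scale[OF W] subspace_sum[OF W])
        fix x assume "x \<in> X"
        then obtain k where "k \<in> K" "x = k v" by (auto simp: X_def)
        then have "x - v \<in> W" unfolding W_def by (intro span_base) blast
        then have "- (x - v) \<in> W" by (rule subspace_neg[OF W])
        then show "v - x \<in> W" by simp
      qed
      finally show ?thesis .
    qed
    ultimately show ?thesis by blast
  qed
  have uniq: "e = e'" if "e \<in> I" "v - e \<in> W" "e' \<in> I" "v - e' \<in> W" for v e e'
  proof -
    have "(v - e') - (v - e) \<in> W" using subspace_diff[OF W] that by blast
    moreover have "e - e' \<in> I" using subspace_diff[OF I] that by blast
    ultimately show ?thesis using IW[of "e - e'"] by simp
  qed
  define E where "E = (\<lambda>v. SOME e. e \<in> I \<and> v - e \<in> W)"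
  have E: "E v \<in> I" "v - E v \<in> W" for v
    using someI_ex[OF ex[of v]] by (auto simp: E_def)
  have E_eq: "E v = e" if "e \<in> I" "v - e \<in> W" for v e
    using uniq[OF E that] .
  have "E (x + y) = E x + E y" for x y
  proof (rule E_eq)
    have "(x - E x) + (y - E y) \<in> W" by (intro subspace_add[OF W] E)
    then show "x + y - (E x + E y) \<in> W" by (simp add: algebra_simps)
  qed (intro subspace_add[OF I] E)
  moreover have "E (c *\<^sub>C x) = c *\<^sub>C E x" for c x
    by (rule E_eq) (use E in \<open>auto simp flip: scale_right_diff_distrib
      intro: subspace_scale[OF W] subspace_scale[OF I]\<close>)
  ultimately have "lin E" by (simp add: lin_iff)
  moreover have "k (E v) = E v" if "k \<in> K" for k v using E(1) that by (simp add: I_def)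
  moreover have "E (k v) = E v" if "k \<in> K" for k v
  proof (rule E_eq)
    have "k v - v \<in> W" using that unfolding W_def by (intro span_base) blast
    then have "(k v - v) + (v - E v) \<in> W" by (intro subspace_add[OF W] E)
    then show "k v - E v \<in> W" by simp
  qed (rule E)
  moreover have "E v = v" if "\<And>k. k \<in> K \<Longrightarrow> k v = v" for v
    by (rule E_eq) (use that subspace_0[OF W] in \<open>auto simp: I_def\<close>)
  moreover have "T (E v) = E (T v)" if T: "lin T" "\<And>k v. k \<in> K \<Longrightarrow> T (k v) = k (T v)" for T v
  proof (rule E_eq[symmetric])
    show "T (E v) \<in> I" using E(1)[of v] T(2) by (auto simp: I_def) (metis)
    have "T ` W \<subseteq> W"
      unfolding W_def lin_image_span[OF T(1)]
    proof (intro span_mono subsetI)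
      fix y assume "y \<in> T ` {k u - u | k u. k \<in> K}"
      then obtain k u where "k \<in> K" "y = T (k u - u)" by blast
      then have "y = k (T u) - T u" by (simp add: lin_diff[OF T(1)] T(2))
      then show "y \<in> {k u - u | k u. k \<in> K}" using \<open>k \<in> K\<close> by blast
    qed
    then show "T v - T (E v) \<in> W" using E(2)[of v] by (auto simp flip: lin_diff[OF T(1)])
  qed
  ultimately show ?thesis using that by blast
qed

end

section \<open>Bicommutants and operators of minimal rank\<close>

context complex_vector_space begin

text \<open>The double commutant inside the algebra of linear operators. It is preferred to the
  algebra generated by A because it also contains the projection obtained by averaging over a group
  in A, which need not be a finite linear combination of products of elements of A.\<close>

definition bicommutant :: "('v \<Rightarrow> 'v) set \<Rightarrow> ('v \<Rightarrow> 'v) set" where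
  "bicommutant A = {p. lin p \<and> (\<forall>T. lin T \<and> (\<forall>a\<in>A. \<forall>x. T (a x) = a (T x)) \<longrightarrow> (\<forall>x. T (p x) = p (T x)))}"

lemma bicommutant_lin: "p \<in> bicommutant A \<Longrightarrow> lin p"
  by (simp add: bicommutant_def)

lemma bicommutant_commute:
  "p \<in> bicommutant A \<Longrightarrow> lin T \<Longrightarrow> (\<And>a x. a \<in> A \<Longrightarrow> T (a x) = a (T x)) \<Longrightarrow> T (p x) = p (T x)"
  by (simp add: bicommutant_def)

lemma bicommutantI:
  "lin p \<Longrightarrow> (\<And>T x. lin T \<Longrightarrow> (\<And>a x. a \<in> A \<Longrightarrow> T (a x) = a (T x)) \<Longrightarrow> T (p x) = p (T x))
    \<Longrightarrow> p \<in> bicommutant A"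
  unfolding bicommutant_def by blast

lemma bicommutant_base: "a \<in> A \<Longrightarrow> lin a \<Longrightarrow> a \<in> bicommutant A"
  by (rule bicommutantI) assumption+

lemma bicommutant_comp:
  assumes p: "p \<in> bicommutant A" and q: "q \<in> bicommutant A"
  shows "p \<circ> q \<in> bicommutant A"
proof (rule bicommutantI)
  fix T x assume T: "lin T" "\<And>a x. a \<in> A \<Longrightarrow> T (a x) = a (T x)"
  have Tp: "T (p y) = p (T y)" for y
    by (rule bicommutant_commute[OF p T(1)]) (rule T(2))
  have Tq: "T (q y) = q (T y)" for y
    by (rule bicommutant_commute[OF q T(1)]) (rule T(2))
  show "T ((p \<circ> q) x) = (p \<circ> q) (T x)"
    unfolding comp_apply Tp Tq ..
qed (intro lin_comp bicommutant_lin[OF p] bicommutant_lin[OF q])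

lemma bicommutant_scaled:
  assumes p: "p \<in> bicommutant A" shows "(\<lambda>x. c *\<^sub>C p x) \<in> bicommutant A"
proof (rule bicommutantI)
  fix T x assume T: "lin T" "\<And>a x. a \<in> A \<Longrightarrow> T (a x) = a (T x)"
  have Tp: "T (p y) = p (T y)" for y
    by (rule bicommutant_commute[OF p T(1)]) (rule T(2))
  show "T (c *\<^sub>C p x) = c *\<^sub>C p (T x)"
    unfolding lin_scale[OF T(1)] Tp ..
qed (intro lin_scaled bicommutant_lin[OF p])

lemma bicommutant_sub:
  assumes p: "p \<in> bicommutant A" and q: "q \<in> bicommutant A"
  shows "(\<lambda>x. p x - q x) \<in> bicommutant A"
proof (rule bicommutantI)
  fix T x assume T: "lin T" "\<And>a x. a \<in> A \<Longrightarrow> T (a x) = a (T x)"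
  have Tp: "T (p y) = p (T y)" for y
    by (rule bicommutant_commute[OF p T(1)]) (rule T(2))
  have Tq: "T (q y) = q (T y)" for y
    by (rule bicommutant_commute[OF q T(1)]) (rule T(2))
  show "T (p x - q x) = p (T x) - q (T x)"
    unfolding lin_diff[OF T(1)] Tp Tq ..
qed (intro lin_sub bicommutant_lin[OF p] bicommutant_lin[OF q])

text \<open>If \<open>p\<close> maps \<open>range (E \<circ> E')\<close> into the span of as few vectors as possible without vanishing
  there, then \<open>p \<circ> a\<close> has an eigenvalue \<open>c\<close> on the image, and \<open>p \<circ> a \<circ> p - c p\<close> has smaller image,
  hence is zero.\<close>

lemma exists_minimal_operator:
  assumes linA: "\<And>a. a \<in> A \<Longrightarrow> lin a" and linB: "\<And>b. b \<in> B \<Longrightarrow> lin b"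
    and idB: "id \<in> B" and compB: "\<And>b c. b \<in> B \<Longrightarrow> c \<in> B \<Longrightarrow> b \<circ> c \<in> B"
    and AB: "\<And>a b x. a \<in> A \<Longrightarrow> b \<in> B \<Longrightarrow> a (b x) = b (a x)"
    and irred: "\<And>N. subspace N \<Longrightarrow> (\<And>a x. a \<in> A \<Longrightarrow> x \<in> N \<Longrightarrow> a x \<in> N) \<Longrightarrow>
      (\<And>b x. b \<in> B \<Longrightarrow> x \<in> N \<Longrightarrow> b x \<in> N) \<Longrightarrow> N = {0} \<or> N = UNIV"
    and E: "E \<in> bicommutant A" "\<And>x. E (E x) = E x"
    and E': "lin E'" "\<And>x. E' (E' x) = E' x" "\<And>a x. a \<in> A \<Longrightarrow> E' (a x) = a (E' x)"
    and fin: "finite F" "\<And>x. E (E' x) \<in> span F"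
    and nz: "E (E' x0) \<noteq> 0"
  obtains p where "p \<in> bicommutant A" "\<exists>x. p x \<noteq> 0"
    "\<And>a. a \<in> A \<Longrightarrow> \<exists>c. \<forall>x. p (a (p x)) = c *\<^sub>C p x"
proof -
  \<comment> \<open>The corner E A'' E of the bicommutant A'' of A.\<close>
  define \<P> where "\<P> = {p \<in> bicommutant A. (\<forall>x. E (p x) = p x) \<and> (\<forall>x. p (E x) = p x)}"
  have \<P>_bi: "p \<in> bicommutant A" and \<P>E: "E (p x) = p x" "p (E x) = p x" if "p \<in> \<P>" for p x
    using that by (auto simp: \<P>_def)
  have \<P>E': "E' (p x) = p (E' x)" if "p \<in> \<P>" for p x
    by (rule bicommutant_commute[OF \<P>_bi[OF that] E'(1,3)])
  have linE: "lin E" using E(1) by (rule bicommutant_lin)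
  have E_\<P>: "E \<in> \<P>" using E by (simp add: \<P>_def)
  \<comment> \<open>The rank of p on the range of E' is measured by the size of a finite set whose
    span contains the image, so that a minimum exists without speaking of dimensions.\<close>
  define good where "good = (\<lambda>X. finite X \<and>
    (\<exists>p\<in>\<P>. (\<exists>x. p (E' x) \<noteq> 0) \<and> (\<forall>x. p (E' x) \<in> span X)))"
  have goodI: "good Y" if "finite Y" "r \<in> \<P>" "r (E' x) \<noteq> 0" "\<And>x. r (E' x) \<in> span Y" for Y r x
    unfolding good_def by (intro conjI bexI[OF _ that(2)] exI[of _ x] allI that)
  have "good F" by (rule goodI[OF fin(1) E_\<P> nz fin(2)])
  define X where "X = arg_min card good"
  have X: "good X" and X_min: "\<And>Y. good Y \<Longrightarrow> card X \<le> card Y"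
    using arg_min_natI[of good F card] arg_min_nat_le[of good _ card] \<open>good F\<close> unfolding X_def by auto
  then obtain p where p: "p \<in> \<P>" "\<exists>x. p (E' x) \<noteq> 0" "\<And>x. p (E' x) \<in> span X" and "finite X"
    unfolding good_def by blast
  have linp: "lin p" using \<P>_bi[OF p(1)] by (rule bicommutant_lin)
  \<comment> \<open>Minimality controls r on the range of E' only. The vectors y for which E' kills
    every b y form a subspace N stable under A and B; it omits x0, so it is 0, and it contains r
    x.\<close>
  have vanish: "r x = 0" if r: "r \<in> \<P>" and rE': "\<And>x. r (E' x) = 0" for r x
  proof -
    have linr: "lin r" using \<P>_bi[OF r] by (rule bicommutant_lin)
    define N where "N = {y. \<forall>b\<in>B. E' (b y) = 0}"
    have "subspace N"
      by (auto simp: N_def subspace_def lin_zero[OF linB] lin_zero[OF E'(1)] lin_add[OF linB]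
          lin_add[OF E'(1)] lin_scale[OF linB] lin_scale[OF E'(1)])
    moreover have "a y \<in> N" if "a \<in> A" "y \<in> N" for a y
    proof -
      have "E' (b (a y)) = 0" if b: "b \<in> B" for b
      proof -
        have "E' (b (a y)) = E' (a (b y))" by (simp only: AB[OF \<open>a \<in> A\<close> b])
        also have "\<dots> = a (E' (b y))" by (rule E'(3)[OF \<open>a \<in> A\<close>])
        finally have "E' (b (a y)) = a (E' (b y))" .
        then show ?thesis using \<open>y \<in> N\<close> b lin_zero[OF linA[OF \<open>a \<in> A\<close>]] by (simp add: N_def)
      qed
      then show ?thesis by (simp add: N_def)
    qed
    moreover have "b y \<in> N" if "b \<in> B" "y \<in> N" for b y
      using that compB[OF _ that(1)] by (fastforce simp: N_def)
    ultimately have "N = {0} \<or> N = UNIV" by (rule irred)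
    moreover have "x0 \<notin> N"
      unfolding N_def using nz idB lin_zero[OF linE] by fastforce
    ultimately have "N = {0}" by blast
    moreover have "r x \<in> N"
    proof -
      have "E' (b (r x)) = 0" if b: "b \<in> B" for b
      proof -
        have "b (r x) = r (b x)"
          by (rule bicommutant_commute[OF \<P>_bi[OF r] linB[OF b]]) (rule AB[symmetric, OF _ b])
        then show ?thesis by (simp add: \<P>E'[OF r] rE')
      qed
      then show ?thesis by (simp add: N_def)
    qed
    ultimately show ?thesis by simp
  qed
  have "\<exists>c. \<forall>x. p (a (p x)) = c *\<^sub>C p x" if a: "a \<in> A" for a
  proof -
    define W where "W = range (\<lambda>x. p (E' x))"
    define T where "T = (\<lambda>x. p (a x))"
    have linT: "lin T" using lin_comp[OF linp linA[OF a]] by (simp add: T_def comp_def)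
    have "module_hom scale scale (\<lambda>x. p (E' x))"
      using lin_comp[OF linp E'(1)] by (simp add: comp_def linear_iff_module_hom)
    then have "subspace W" unfolding W_def by (rule module_hom.subspace_image) simp
    have TW: "T (p (E' x)) = p (E' (a (p x)))" for x
      by (simp add: T_def E'(3)[OF a] \<P>E'[OF p(1)])
    then have TW': "T ` W \<subseteq> W" unfolding W_def by auto
    have WX: "W \<subseteq> span X" using p(3) by (auto simp: W_def)
    obtain x1 where x1: "p (E' x1) \<noteq> 0" using p(2) by blast
    have x1W: "p (E' x1) \<in> W" by (simp add: W_def)
    obtain c w where w: "w \<in> W" "w \<noteq> 0" "T w = c *\<^sub>C w"
      by (rule exists_eigenvector[OF linT \<open>subspace W\<close> TW' \<open>finite X\<close> WX x1W x1])
    have "w \<in> span X" using w(1) WX by blast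
    then obtain u where u: "w = (\<Sum>v\<in>X. u v *\<^sub>C v)"
      by (auto simp: span_finite[OF \<open>finite X\<close>])
    have "\<exists>y\<in>X. u y \<noteq> 0"
    proof (rule ccontr)
      assume "\<not> (\<exists>y\<in>X. u y \<noteq> 0)"
      then have "w = 0" unfolding u by (intro sum.neutral) auto
      then show False using w(2) by simp
    qed
    then obtain y where y: "y \<in> X" "u y \<noteq> 0" by blast
    define S where "S = (\<lambda>x. T x - c *\<^sub>C x)"
    have linS: "lin S" unfolding S_def by (intro lin_sub linT lin_scaled lin_id)
    define Y where "Y = S ` (X - {y})"
    have "card Y < card X"
      using card_image_le[of "X - {y}" S] \<open>finite X\<close> y(1) card_Diff1_less[of X y]
      unfolding Y_def by fastforce
    \<comment> \<open>Since \<open>u y\<close> is nonzero, the relation S w = 0 expresses S y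
      through the other S v; thus S maps the span of X into the span of fewer vectors.\<close>
    have Sy: "S y \<in> span Y"
    proof -
      have "0 = S w" using w(3) by (simp add: S_def)
      also have "S w = (\<Sum>v\<in>X. u v *\<^sub>C S v)" by (simp add: u lin_sum[OF linS] lin_scale[OF linS])
      also have "\<dots> = u y *\<^sub>C S y + (\<Sum>v\<in>X - {y}. u v *\<^sub>C S v)"
        by (rule sum.remove[OF \<open>finite X\<close> y(1)])
      finally have "u y *\<^sub>C S y = - (\<Sum>v\<in>X - {y}. u v *\<^sub>C S v)"
        by (simp add: eq_neg_iff_add_eq_0)
      also have "\<dots> \<in> span Y"
        by (intro span_neg span_sum span_scale span_base) (auto simp: Y_def)
      finally have "inverse (u y) *\<^sub>C (u y *\<^sub>C S y) \<in> span Y" by (rule span_scale)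
      then show ?thesis using y(2) by simp
    qed
    have "S ` span X \<subseteq> span Y"
      unfolding lin_image_span[OF linS]
    proof (rule span_minimal)
      show "S ` X \<subseteq> span Y" using Sy by (auto simp: Y_def intro: span_base)
    qed simp
    then have SW: "S x \<in> span Y" if "x \<in> W" for x using that WX by blast
    define r where "r = (\<lambda>x. p (a (p x)) - c *\<^sub>C p x)"
    have "p \<circ> (a \<circ> p) \<in> bicommutant A"
      by (rule bicommutant_comp[OF \<P>_bi[OF p(1)] bicommutant_comp[OF
          bicommutant_base[OF a linA[OF a]] \<P>_bi[OF p(1)]]])
    from bicommutant_sub[OF this bicommutant_scaled[OF \<P>_bi[OF p(1)]], of c]
    have "r \<in> bicommutant A" by (simp add: r_def)
    then have r: "r \<in> \<P>"
      by (simp add: \<P>_def r_def \<P>E[OF p(1)] lin_diff[OF linE] lin_scale[OF linE])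
    have rS: "r (E' x) = S (p (E' x))" for x by (simp add: r_def S_def T_def)
    have rY: "r (E' x) \<in> span Y" for x unfolding rS by (rule SW) (simp add: W_def)
    have "finite Y" using \<open>finite X\<close> by (simp add: Y_def)
    moreover have "\<not> good Y" using X_min[of Y] \<open>card Y < card X\<close> by auto
    ultimately have "r (E' x) = 0" for x using goodI[OF _ r _ rY] by blast
    then have "r x = 0" for x using vanish[OF r] by blast
    then show ?thesis by (auto simp: r_def)
  qed
  moreover have "\<exists>x. p x \<noteq> 0" using p(2) by blast
  ultimately show ?thesis by (intro that[OF \<P>_bi[OF p(1)]])
qed

end

section \<open>Irreducible commuting families, in place of external tensor products\<close>

section \<open>Commuting families of operators\<close>


text \<open>What remains of an external tensor product when the factors are not separated: k
  mutually commuting actions that are jointly irreducible. All are indexed by the same monoid X; in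
  the application the i-th action of m sees the i-th block of m only.\<close>

locale commuting_family = complex_vector_space scale
  for scale :: "complex \<Rightarrow> 'v::ab_group_add \<Rightarrow> 'v" (infixr "*\<^sub>C" 75) +
  fixes k :: nat and X :: "'m set" and mlt :: "'m \<Rightarrow> 'm \<Rightarrow> 'm" and e :: 'm
    and \<beta> :: "nat \<Rightarrow> 'm \<Rightarrow> 'v \<Rightarrow> 'v"
  assumes lin_op: "i < k \<Longrightarrow> m \<in> X \<Longrightarrow> lin (\<beta> i m)"
    and mlt_closed: "m \<in> X \<Longrightarrow> l \<in> X \<Longrightarrow> mlt m l \<in> X"
    and unit_closed: "e \<in> X"
    and op_mlt: "i < k \<Longrightarrow> m \<in> X \<Longrightarrow> l \<in> X \<Longrightarrow> \<beta> i (mlt m l) x = \<beta> i m (\<beta> i l x)"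
    and op_unit: "i < k \<Longrightarrow> \<beta> i e x = x"
    and op_commute: "i < k \<Longrightarrow> j < k \<Longrightarrow> i \<noteq> j \<Longrightarrow> m \<in> X \<Longrightarrow> l \<in> X
      \<Longrightarrow> \<beta> i m (\<beta> j l x) = \<beta> j l (\<beta> i m x)"
    and irreducible: "subspace N \<Longrightarrow> (\<And>i m x. i < k \<Longrightarrow> m \<in> X \<Longrightarrow> x \<in> N \<Longrightarrow> \<beta> i m x \<in> N)
      \<Longrightarrow> N = {0} \<or> N = UNIV"
begin

primrec word :: "(nat \<Rightarrow> 'm) \<Rightarrow> nat \<Rightarrow> 'v \<Rightarrow> 'v" where
  "word \<mu> 0 = id"
| "word \<mu> (Suc j) = word \<mu> j \<circ> \<beta> j (\<mu> j)"

lemma word_cong: "(\<And>i. i < j \<Longrightarrow> \<mu> i = \<nu> i) \<Longrightarrow> word \<mu> j = word \<nu> j"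
  by (induction j) auto

text \<open>Operators of different factors commute, so \<open>\<beta> i m\<close> moves left through
  the word until it merges with the i-th letter. Hence the words absorb the whole action.\<close>

lemma word_op:
  assumes "i < j" "j \<le> k" "\<And>l. l < j \<Longrightarrow> \<mu> l \<in> X" "m \<in> X"
  shows "word \<mu> j (\<beta> i m x) = word (\<mu>(i := mlt (\<mu> i) m)) j x"
  using assms
proof (induction j arbitrary: x)
  case (Suc j)
  show ?case
  proof (cases "i = j")
    case True
    have "word (\<mu>(j := mlt (\<mu> j) m)) j = word \<mu> j" by (rule word_cong) simp
    then show ?thesis using Suc.prems True by (simp add: op_mlt fun_upd_def)
  next
    case False
    then show ?thesis using Suc by (simp add: op_commute[of j i])
  qed
qed simp

lemma word_bicommutant:
  assumes "j \<le> i" "i < k" "p \<in> bicommutant (\<beta> i ` X)" "\<And>l. l < j \<Longrightarrow> \<mu> l \<in> X"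
  shows "p (word \<mu> j x) = word \<mu> j (p x)"
  using assms
proof (induction j arbitrary: x)
  case (Suc j)
  have "\<beta> j (\<mu> j) (p y) = p (\<beta> j (\<mu> j) y)" for y
    by (rule bicommutant_commute[OF Suc.prems(3)]) (use Suc.prems in \<open>auto intro: lin_op op_commute\<close>)
  then show ?case using Suc by simp
qed simp

end

text \<open>In a tensor product \<open>p i\<close> would be a rank one operator on the i-th factor
  and \<open>c i\<close> the associated matrix coefficient. It is through a common \<open>c\<close>
  that two families are compared below.\<close>

locale commuting_family_minimal = commuting_family scale k X mlt e \<beta>
  for scale :: "complex \<Rightarrow> 'v::ab_group_add \<Rightarrow> 'v" (infixr "*\<^sub>C" 75)
    and k :: nat and X :: "'m set" and mlt e and \<beta> :: "nat \<Rightarrow> 'm \<Rightarrow> 'v \<Rightarrow> 'v" +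
  fixes p :: "nat \<Rightarrow> 'v \<Rightarrow> 'v" and c :: "nat \<Rightarrow> 'm \<Rightarrow> complex"
  assumes p_bicommutant: "i < k \<Longrightarrow> p i \<in> bicommutant (\<beta> i ` X)"
    and p_nonzero: "i < k \<Longrightarrow> \<exists>x. p i x \<noteq> 0"
    and p_minimal: "i < k \<Longrightarrow> m \<in> X \<Longrightarrow> p i (\<beta> i m (p i x)) = c i m *\<^sub>C p i x"
begin

primrec q :: "nat \<Rightarrow> 'v \<Rightarrow> 'v" where
  "q 0 = id"
| "q (Suc j) = q j \<circ> p j"

lemma lin_q: "j \<le> k \<Longrightarrow> lin (q j)"
proof (induction j)
  case (Suc j)
  then have "lin (q j)" "lin (p j)" using bicommutant_lin[OF p_bicommutant[of j]] by simp_all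
  then show ?case by (simp only: q.simps lin_comp)
qed (simp add: lin_id)

lemma q_commute:
  assumes "j \<le> i" "i < k" "lin T" "\<And>l m x. l < j \<Longrightarrow> m \<in> X \<Longrightarrow> T (\<beta> l m x) = \<beta> l m (T x)"
  shows "T (q j x) = q j (T x)"
  using assms
proof (induction j arbitrary: x)
  case (Suc j)
  have "T (p j y) = p j (T y)" for y
    by (rule bicommutant_commute[OF p_bicommutant]) (use Suc.prems in auto)
  then show ?case using Suc by simp
qed simp

lemma op_q: "j \<le> i \<Longrightarrow> i < k \<Longrightarrow> m \<in> X \<Longrightarrow> \<beta> i m (q j x) = q j (\<beta> i m x)"
  by (rule q_commute) (auto intro: lin_op op_commute)

lemma p_q: "j \<le> i \<Longrightarrow> i < k \<Longrightarrow> p i (q j x) = q j (p i x)"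
proof (rule q_commute)
  fix l m x assume *: "j \<le> i" "i < k" "l < j" "m \<in> X"
  have "\<beta> l m (p i x) = p i (\<beta> l m x)"
    by (rule bicommutant_commute[OF p_bicommutant]) (use * in \<open>auto intro: lin_op op_commute\<close>)
  then show "p i (\<beta> l m x) = \<beta> l m (p i x)" by simp
qed (auto intro: bicommutant_lin p_bicommutant)

text \<open>\<open>p i\<close> commutes with the families other than the i-th, so the sandwich
  separates into the factors \<open>p i (\<beta> i m (p i x))\<close>, and only a product of scalars
  remains.\<close>

lemma q_word_q:
  assumes "j \<le> k" "\<And>i. i < j \<Longrightarrow> \<mu> i \<in> X"
  shows "q j (word \<mu> j (q j x)) = (\<Prod>i<j. c i (\<mu> i)) *\<^sub>C (q j x)"
  using assms
proof (induction j arbitrary: x)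
  case (Suc j)
  have j: "j \<le> j" "j < k" "\<mu> j \<in> X" using Suc.prems by auto
  have "q (Suc j) (word \<mu> (Suc j) (q (Suc j) x)) = q j (p j (word \<mu> j (q j (\<beta> j (\<mu> j) (p j x)))))"
    by (simp add: op_q[OF j])
  also have "\<dots> = q j (word \<mu> j (q j (p j (\<beta> j (\<mu> j) (p j x)))))"
    using Suc.prems by (simp add: word_bicommutant[OF _ _ p_bicommutant] p_q)
  also have "\<dots> = (\<Prod>i<j. c i (\<mu> i)) *\<^sub>C (q j (p j (\<beta> j (\<mu> j) (p j x))))"
    using Suc by simp
  also have "\<dots> = (\<Prod>i<Suc j. c i (\<mu> i)) *\<^sub>C (q (Suc j) x)"
    using lin_q[of j] j by (simp add: p_minimal lin_scale mult.commute)
  finally show ?case .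
qed simp

text \<open>The vectors that \<open>p j\<close> kills even after any \<open>\<beta> j m\<close> form
  a stable proper subspace, hence 0. So \<open>q j y\<close>, nonzero by induction, can be moved out
  of the kernel of \<open>p j\<close> by some \<open>\<beta> j m\<close>, which commutes with
  \<open>q j\<close>.\<close>

lemma q_nonzero:
  assumes "j \<le> k" and ne: "x0 \<noteq> (0::'v)" shows "\<exists>x. q j x \<noteq> 0"
  using assms(1)
proof (induction j)
  case 0
  then show ?case using ne by auto
next
  case (Suc j)
  then obtain y where y: "q j y \<noteq> 0" by auto
  have j: "j \<le> j" "j < k" using Suc.prems by auto
  define N where "N = {y. \<forall>m\<in>X. p j (\<beta> j m y) = 0}"
  have linp: "lin (p j)" by (rule bicommutant_lin[OF p_bicommutant[OF j(2)]])
  have "subspace N"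
    by (auto simp: N_def subspace_def lin_zero[OF lin_op[OF j(2)]] lin_zero[OF linp]
        lin_add[OF lin_op[OF j(2)]] lin_add[OF linp] lin_scale[OF lin_op[OF j(2)]] lin_scale[OF linp])
  moreover have "\<beta> i m y \<in> N" if i: "i < k" and m: "m \<in> X" and y: "y \<in> N" for i m y
  proof -
    have "p j (\<beta> j l (\<beta> i m y)) = 0" if l: "l \<in> X" for l
    proof (cases "i = j")
      case True
      have "p j (\<beta> j (mlt l m) y) = 0" using y mlt_closed[OF l m] by (simp add: N_def)
      then show ?thesis unfolding op_mlt[OF j(2) l m] True .
    next
      case False
      have "\<beta> i m (p j z) = p j (\<beta> i m z)" for z
        by (rule bicommutant_commute[OF p_bicommutant])
          (use i j m False in \<open>auto intro: lin_op op_commute\<close>)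
      then have "p j (\<beta> j l (\<beta> i m y)) = \<beta> i m (p j (\<beta> j l y))"
        using op_commute[of j i l m y] i j m l False by simp
      then show ?thesis using y l lin_zero[OF lin_op[OF i m]] by (simp add: N_def)
    qed
    then show ?thesis by (simp add: N_def)
  qed
  ultimately have "N = {0} \<or> N = UNIV" by (rule irreducible)
  moreover have "N \<noteq> UNIV"
  proof
    assume "N = UNIV"
    then have "p j (\<beta> j e x) = 0" for x using unit_closed by (auto simp: N_def)
    then show False using p_nonzero[OF j(2)] op_unit[OF j(2)] by simp
  qed
  ultimately have "q j y \<notin> N" using y by auto
  then obtain m where m: "m \<in> X" "p j (\<beta> j m (q j y)) \<noteq> 0" by (auto simp: N_def)
  then have "q (Suc j) (\<beta> j m y) \<noteq> 0" using j by (simp add: op_q p_q)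
  then show ?case by blast
qed

end

context complex_vector_space begin

text \<open>The two families generate, from a pair of vectors in the (one-dimensional) ranges of the
  products \<open>q\<close> of the minimal operators, the graph of the required isomorphism: both \<open>q\<close> act on the
  generated pairs by a common scalar, so that the subspace of pairs contains no \<open>(0, v)\<close>.\<close>

lemma joint_equivalence:
  fixes \<beta> \<beta>' :: "nat \<Rightarrow> 'm \<Rightarrow> 'v \<Rightarrow> 'v"
  assumes F: "commuting_family scale k X mlt e \<beta>" and F': "commuting_family scale k X mlt e \<beta>'"
    and ne: "v0 \<noteq> (0::'v)"
    and p: "\<And>i. i < k \<Longrightarrow> p i \<in> bicommutant (\<beta> i ` X)" "\<And>i. i < k \<Longrightarrow> \<exists>x. p i x \<noteq> 0"
      "\<And>i m. i < k \<Longrightarrow> m \<in> X \<Longrightarrow> \<exists>c. \<forall>x. p i (\<beta> i m (p i x)) = c *\<^sub>C p i x"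
    and L: "\<And>i. i < k \<Longrightarrow> lin (L i)" "\<And>i. i < k \<Longrightarrow> bij (L i)"
      "\<And>i m x. i < k \<Longrightarrow> m \<in> X \<Longrightarrow> L i (\<beta> i m x) = \<beta>' i m (L i x)"
  obtains K where "lin K" "bij K" "\<And>i m x. i < k \<Longrightarrow> m \<in> X \<Longrightarrow> K (\<beta> i m x) = \<beta>' i m (K x)"
proof -
  interpret F: commuting_family scale k X mlt e \<beta> by (rule F)
  interpret F': commuting_family scale k X mlt e \<beta>' by (rule F')
  have "\<exists>c. \<forall>i m. i < k \<and> m \<in> X \<longrightarrow> (\<forall>x. p i (\<beta> i m (p i x)) = c i m *\<^sub>C p i x)"
    using p(3) by metis
  then obtain c where c: "\<And>i m x. i < k \<Longrightarrow> m \<in> X \<Longrightarrow> p i (\<beta> i m (p i x)) = c i m *\<^sub>C p i x"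
    by blast
  define I where "I = (\<lambda>i. inv_into UNIV (L i))"
  have I: "lin (I i)" "I i (L i x) = x" "L i (I i x) = x" if "i < k" for i x
    using L(1,2)[OF that] unfolding I_def
    by (auto intro: lin_inv_into inv_into_f_f f_inv_into_f simp: bij_is_inj bij_is_surj)
  have I_op: "I i (\<beta>' i m x) = \<beta> i m (I i x)" if "i < k" "m \<in> X" for i m x
    using L(3)[OF that, of "I i x"] I(2,3)[OF that(1)] by metis
  \<comment> \<open>Transport by \<open>L i\<close> turns the minimal operators of \<beta> into
    minimal operators of \<beta>' with the same scalars c; here the blockwise isomorphisms
    enter.\<close>
  define p' where "p' = (\<lambda>i x. L i (p i (I i x)))"
  have lin_p: "lin (p i)" if "i < k" for i using bicommutant_lin[OF p(1)[OF that]] .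
  interpret M: commuting_family_minimal scale k X mlt e \<beta> p c
    by unfold_locales (use p c in auto)
  interpret M': commuting_family_minimal scale k X mlt e \<beta>' p' c
  proof unfold_locales
    fix i assume i: "i < k"
    show "p' i \<in> bicommutant (\<beta>' i ` X)"
    proof (rule bicommutantI)
      show "lin (p' i)"
        using lin_comp[OF L(1)[OF i] lin_comp[OF lin_p[OF i] I(1)[OF i]]] by (simp add: p'_def comp_def)
      fix T x assume T: "lin T" "\<And>a x. a \<in> \<beta>' i ` X \<Longrightarrow> T (a x) = a (T x)"
      define S where "S = (\<lambda>x. I i (T (L i x)))"
      have "lin S"
        using lin_comp[OF I(1)[OF i] lin_comp[OF T(1) L(1)[OF i]]] by (simp add: S_def comp_def)
      moreover have "S (a y) = a (S y)" if a: "a \<in> \<beta> i ` X" for a y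
      proof -
        obtain m where m: "m \<in> X" "a = \<beta> i m" using a by blast
        have "T (\<beta>' i m (L i y)) = \<beta>' i m (T (L i y))" using T(2) m(1) by blast
        then show ?thesis by (simp add: S_def m(2) L(3)[OF i m(1)] I_op[OF i m(1)])
      qed
      ultimately have "S (p i (I i x)) = p i (S (I i x))"
        by (rule bicommutant_commute[OF p(1)[OF i]])
      then have "L i (S (p i (I i x))) = L i (p i (S (I i x)))" by simp
      then show "T (p' i x) = p' i (T x)" by (simp add: S_def p'_def I[OF i])
    qed
    obtain x where x: "p i x \<noteq> 0" using p(2)[OF i] by blast
    have "p' i (L i x) = L i (p i x)" by (simp add: p'_def I(2)[OF i])
    moreover have "L i (p i x) \<noteq> 0"
      using x I(2)[OF i, of "p i x"] lin_zero[OF I(1)[OF i]] by metis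
    ultimately show "\<exists>x. p' i x \<noteq> 0" by metis
    fix m x assume m: "m \<in> X"
    show "p' i (\<beta>' i m (p' i x)) = c i m *\<^sub>C p' i x"
      by (simp add: p'_def I_op[OF i m] I(2)[OF i] c[OF i m] lin_scale[OF L(1)[OF i]])
  qed
  obtain u0 where "M.q k u0 \<noteq> 0" using M.q_nonzero[OF le_refl ne] by blast
  obtain u0' where "M'.q k u0' \<noteq> 0" using M'.q_nonzero[OF le_refl ne] by blast
  define u where "u = M.q k u0"
  define u' where "u' = M'.q k u0'"
  have u: "u \<noteq> 0" "u' \<noteq> 0" using \<open>M.q k u0 \<noteq> 0\<close> \<open>M'.q k u0' \<noteq> 0\<close> by (auto simp: u_def u'_def)
  \<comment> \<open>The invariant of the generated pairs: every word, followed by q, sends v and v'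
    to the same multiple of u and u' respectively. Testing against all words makes the invariant
    stable under the operators, by \<open>word_op\<close>.\<close>
  define P where "P = (\<lambda>v v'. \<forall>\<mu>. (\<forall>i<k. \<mu> i \<in> X) \<longrightarrow>
    (\<exists>c. M.q k (F.word \<mu> k v) = c *\<^sub>C u \<and> M'.q k (F'.word \<mu> k v') = c *\<^sub>C u'))"
  define cl where "cl = (\<lambda>R. R u u' \<and> (\<forall>x x' y y'. R x x' \<longrightarrow> R y y' \<longrightarrow> R (x + y) (x' + y'))
    \<and> (\<forall>x x' c. R x x' \<longrightarrow> R (c *\<^sub>C x) (c *\<^sub>C x'))
    \<and> (\<forall>x x' i m. R x x' \<longrightarrow> i < k \<longrightarrow> m \<in> X \<longrightarrow> R (\<beta> i m x) (\<beta>' i m x')))"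
  have cl: "cl R \<Longrightarrow> R u u'" "cl R \<Longrightarrow> R x x' \<Longrightarrow> R y y' \<Longrightarrow> R (x + y) (x' + y')"
    "cl R \<Longrightarrow> R x x' \<Longrightarrow> R (b *\<^sub>C x) (b *\<^sub>C x')"
    "cl R \<Longrightarrow> R x x' \<Longrightarrow> i < k \<Longrightarrow> m \<in> X \<Longrightarrow> R (\<beta> i m x) (\<beta>' i m x')"
    for R x x' y y' b i m
    unfolding cl_def by blast+
  \<comment> \<open>The smallest relation with the closure properties \<open>cl\<close>, as the
    intersection of all of them; \<open>DE\<close> is then its induction principle.\<close>
  define D where "D = {(v, v'). \<forall>R. cl R \<longrightarrow> R v v'}"
  have DI: "(v, v') \<in> D" if "\<And>R. cl R \<Longrightarrow> R v v'" for v v'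
  proof -
    have "cl R \<longrightarrow> R v v'" for R by (rule impI) (rule that[of R])
    then show ?thesis unfolding D_def mem_Collect_eq prod.case by (rule allI)
  qed
  have DE: "R v v'" if "(v, v') \<in> D" "cl R" for v v' R
  proof -
    have "\<forall>R. cl R \<longrightarrow> R v v'" using that(1) unfolding D_def mem_Collect_eq prod.case .
    then have "cl R \<longrightarrow> R v v'" by (rule spec)
    then show ?thesis using that(2) by (rule mp)
  qed
  have D_base: "(u, u') \<in> D" by (rule DI) (rule cl(1))
  have D_add: "(x + y, x' + y') \<in> D" if "(x, x') \<in> D" "(y, y') \<in> D" for x x' y y'
    by (rule DI, rule cl(2)) (use that in \<open>auto elim: DE\<close>)
  have D_scale: "(b *\<^sub>C x, b *\<^sub>C x') \<in> D" if "(x, x') \<in> D" for b x x'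
    by (rule DI, rule cl(3)) (use that in \<open>auto elim: DE\<close>)
  have D_op: "(\<beta> i m x, \<beta>' i m x') \<in> D" if "(x, x') \<in> D" "i < k" "m \<in> X" for i m x x'
    by (rule DI, rule cl(4)) (use that in \<open>auto elim: DE\<close>)
  have lin_qw: "lin (M.q k \<circ> F.word \<mu> k)" "lin (M'.q k \<circ> F'.word \<mu> k)" if "\<forall>i<k. \<mu> i \<in> X" for \<mu>
  proof -
    have "lin (F.word \<mu> j)" "lin (F'.word \<mu> j)" if "j \<le> k" for j
      using that \<open>\<forall>i<k. \<mu> i \<in> X\<close>
      by (induction j) (simp_all add: lin_id lin_comp F.lin_op F'.lin_op)
    then show "lin (M.q k \<circ> F.word \<mu> k)" "lin (M'.q k \<circ> F'.word \<mu> k)"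
      by (simp_all add: lin_comp M.lin_q M'.lin_q)
  qed
  have DP: "P v v'" if "(v, v') \<in> D" for v v'
  proof -
    have P1: "P u u'"
      unfolding P_def u_def u'_def by (auto simp: M.q_word_q M'.q_word_q)
    have P2: "P (x + y) (x' + y')" if h: "P x x'" "P y y'" for x x' y y'
      unfolding P_def
    proof (intro allI impI)
      fix \<mu> :: "nat \<Rightarrow> 'm" assume \<mu>: "\<forall>i<k. \<mu> i \<in> X"
      obtain c1 where c1: "M.q k (F.word \<mu> k x) = c1 *\<^sub>C u \<and> M'.q k (F'.word \<mu> k x') = c1 *\<^sub>C u'"
        using h(1) \<mu> unfolding P_def by blast
      obtain c2 where c2: "M.q k (F.word \<mu> k y) = c2 *\<^sub>C u \<and> M'.q k (F'.word \<mu> k y') = c2 *\<^sub>C u'"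
        using h(2) \<mu> unfolding P_def by blast
      show "\<exists>c. M.q k (F.word \<mu> k (x + y)) = c *\<^sub>C u \<and> M'.q k (F'.word \<mu> k (x' + y')) = c *\<^sub>C u'"
        using lin_qw[OF \<mu>, THEN lin_add, unfolded comp_apply] c1 c2
        by (intro exI[of _ "c1 + c2"]) (simp add: scale_left_distrib)
    qed
    have P3: "P (b *\<^sub>C x) (b *\<^sub>C x')" if h: "P x x'" for x x' b
      unfolding P_def
    proof (intro allI impI)
      fix \<mu> :: "nat \<Rightarrow> 'm" assume \<mu>: "\<forall>i<k. \<mu> i \<in> X"
      obtain c1 where c1: "M.q k (F.word \<mu> k x) = c1 *\<^sub>C u \<and> M'.q k (F'.word \<mu> k x') = c1 *\<^sub>C u'"
        using h \<mu> unfolding P_def by blast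
      show "\<exists>c. M.q k (F.word \<mu> k (b *\<^sub>C x)) = c *\<^sub>C u \<and> M'.q k (F'.word \<mu> k (b *\<^sub>C x')) = c *\<^sub>C u'"
        using lin_qw[OF \<mu>, THEN lin_scale, unfolded comp_apply] c1
        by (intro exI[of _ "b * c1"]) simp
    qed
    have P4: "P (\<beta> i m x) (\<beta>' i m x')" if h: "P x x'" "i < k" "m \<in> X" for x x' i m
      unfolding P_def
    proof (intro allI impI)
      fix \<mu> :: "nat \<Rightarrow> 'm" assume \<mu>: "\<forall>i<k. \<mu> i \<in> X"
      then have "\<forall>j<k. (\<mu>(i := mlt (\<mu> i) m)) j \<in> X"
        using h(2,3) F.mlt_closed by auto
      then obtain c1 where "M.q k (F.word (\<mu>(i := mlt (\<mu> i) m)) k x) = c1 *\<^sub>C u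
          \<and> M'.q k (F'.word (\<mu>(i := mlt (\<mu> i) m)) k x') = c1 *\<^sub>C u'"
        using h(1) unfolding P_def by blast
      then show "\<exists>c. M.q k (F.word \<mu> k (\<beta> i m x)) = c *\<^sub>C u
          \<and> M'.q k (F'.word \<mu> k (\<beta>' i m x')) = c *\<^sub>C u'"
        using \<mu> h(2,3) F.word_op[of i k \<mu> m x] F'.word_op[of i k \<mu> m x']
        by (intro exI[of _ c1]) simp
    qed
    have "cl P" unfolding cl_def using P1 P2 P3 P4 by blast
    then show ?thesis by (rule DE[OF that])
  qed
  have q_scalar: "\<exists>c. M.q k v = c *\<^sub>C u \<and> M'.q k v' = c *\<^sub>C u'" if "(v, v') \<in> D" for v v'
  proof -
    have w: "F.word (\<lambda>_. e) j x = x" "F'.word (\<lambda>_. e) j x = x" if "j \<le> k" for j x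
      using that by (induction j) (auto simp: F.op_unit F'.op_unit)
    show ?thesis using DP[OF that, unfolded P_def, rule_format, of "\<lambda>_. e"] F.unit_closed
      by (simp add: w)
  qed
  have qz: "M.q k 0 = 0" "M'.q k 0 = 0" using M.lin_q M'.lin_q lin_zero by blast+
  have inj: "v' = 0" if "(0, v') \<in> D" for v'
  proof -
    define N where "N = {v'. (0, v') \<in> D}"
    have "subspace N"
      unfolding subspace_def N_def
      using D_add[of 0 _ 0] D_scale[of 0] D_scale[OF D_base, of 0] by auto
    moreover have "\<beta>' i m x \<in> N" if "i < k" "m \<in> X" "x \<in> N" for i m x
      using D_op[of 0 x i m] that lin_zero[OF F.lin_op[OF that(1,2)]] by (simp add: N_def)
    ultimately have "N = {0} \<or> N = UNIV" by (rule F'.irreducible)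
    \<comment> \<open>If (0, u0') were in D, then 0 and u' would be the same multiple of u and u'.
      That multiple would be 0, and u' would vanish.\<close>
    moreover have "u0' \<notin> N"
      using q_scalar[of 0 u0'] u qz by (auto simp: N_def u'_def)
    ultimately show ?thesis using that by (auto simp: N_def)
  qed
  have inj': "v = 0" if "(v, 0) \<in> D" for v
  proof -
    define N where "N = {v. (v, 0) \<in> D}"
    have "subspace N"
      unfolding subspace_def N_def
      using D_add[of _ 0 _ 0] D_scale[of _ 0] D_scale[OF D_base, of 0] by auto
    moreover have "\<beta> i m x \<in> N" if "i < k" "m \<in> X" "x \<in> N" for i m x
      using D_op[of x 0 i m] that lin_zero[OF F'.lin_op[OF that(1,2)]] by (simp add: N_def)
    ultimately have "N = {0} \<or> N = UNIV" by (rule F.irreducible)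
    moreover have "u0 \<notin> N"
      using q_scalar[of u0 0] u qz by (auto simp: N_def u_def)
    ultimately show ?thesis using that by (auto simp: N_def)
  qed
  have D_diff: "(x - y, x' - y') \<in> D" if "(x, x') \<in> D" "(y, y') \<in> D" for x x' y y'
    using D_add[OF that(1) D_scale[OF that(2), of "- 1"]] by simp
  have surj: "\<exists>v'. (v, v') \<in> D" for v
  proof -
    define N where "N = {v. \<exists>v'. (v, v') \<in> D}"
    have "subspace N"
      unfolding subspace_def N_def
      using D_add D_scale D_scale[OF D_base, of 0] by auto blast+
    moreover have "\<beta> i m x \<in> N" if "i < k" "m \<in> X" "x \<in> N" for i m x
      using D_op that unfolding N_def by blast
    ultimately have "N = {0} \<or> N = UNIV" by (rule F.irreducible)
    moreover have "u \<in> N" using D_base by (auto simp: N_def)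
    ultimately have "N = UNIV" using u by auto
    then show ?thesis unfolding N_def by blast
  qed
  have surj': "\<exists>v. (v, v') \<in> D" for v'
  proof -
    define N where "N = {v'. \<exists>v. (v, v') \<in> D}"
    have "subspace N"
      unfolding subspace_def N_def
      using D_add D_scale D_scale[OF D_base, of 0] by auto blast+
    moreover have "\<beta>' i m x \<in> N" if "i < k" "m \<in> X" "x \<in> N" for i m x
      using D_op that unfolding N_def by blast
    ultimately have "N = {0} \<or> N = UNIV" by (rule F'.irreducible)
    moreover have "u' \<in> N" using D_base by (auto simp: N_def)
    ultimately have "N = UNIV" using u by auto
    then show ?thesis unfolding N_def by blast
  qed
  define K where "K = (\<lambda>v. SOME v'. (v, v') \<in> D)"
  have KD: "(v, K v) \<in> D" for v using someI_ex[OF surj[of v]] by (simp add: K_def)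
  have K_eq: "K v = v'" if "(v, v') \<in> D" for v v'
    using inj[of "K v - v'"] D_diff[OF KD[of v] that] by simp
  have "lin K"
    unfolding lin_iff using K_eq[OF D_add[OF KD KD]] K_eq[OF D_scale[OF KD]] by blast
  moreover have "bij K"
  proof (rule bijI)
    show "inj K"
    proof (rule injI)
      fix x y assume "K x = K y"
      then have "(x - y, 0) \<in> D" using D_diff[OF KD[of x] KD[of y]] by simp
      then show "x = y" using inj' by force
    qed
    show "surj K" using surj' K_eq by (metis surjI)
  qed
  moreover have "K (\<beta> i m x) = \<beta>' i m (K x)" if "i < k" "m \<in> X" for i m x
    by (rule K_eq[OF D_op[OF KD that]])
  ultimately show ?thesis using that by blast
qed

end

section \<open>Finiteness of fixed vectors from square-integrability\<close>

section \<open>Discrete series\<close>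


text \<open>Brings arbitrarily many disjoint sets of one positive measure into conflict with
  integrability.\<close>

lemma ennreal_of_nat_mult_unbounded:
  fixes m C :: ennreal
  assumes "0 < m" "C < \<infinity>"
  shows "\<exists>N. C < of_nat N * m"
proof (rule ccontr)
  assume "\<not> (\<exists>N. C < of_nat N * m)"
  then have "(SUP N. of_nat N * m) \<le> C" by (intro SUP_least) (auto simp: not_less)
  moreover have "(SUP N. of_nat N * m) = (SUP N. of_nat N) * m"
    by (simp add: SUP_mult_right_ennreal)
  ultimately have "(top_class.top :: ennreal) \<le> C"
    using assms(1) by (simp add: ennreal_SUP_of_nat_eq_top ennreal_top_mult split: if_splits)
  then show False using assms(2) by (simp add: top_unique)
qed

lemma vector_space_complex: "vector_space ((*) :: complex \<Rightarrow> complex \<Rightarrow> complex)"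
  by unfold_locales (simp_all add: algebra_simps)

text \<open>The topology enters through the openness of translates: left translates serve to show
  that sets of cosets are open in the quotient by the centre, right translates that the functionals
  under consideration are smooth.\<close>

locale smooth_rep = complex_vector_space scale + group G
  for scale :: "complex \<Rightarrow> 'v::ab_group_add \<Rightarrow> 'v" (infixr "*\<^sub>C" 75)
    and G :: "('g, 'b) monoid_scheme" (structure) +
  fixes T :: "'g topology" and \<pi> :: "'g \<Rightarrow> 'v \<Rightarrow> 'v"
  assumes smooth: "smooth_representation G T scale \<pi>"
    and left_open: "g \<in> carrier G \<Longrightarrow> openin T U \<Longrightarrow> U \<subseteq> carrier G \<Longrightarrow> openin T (g <# U)"
    and right_open: "g \<in> carrier G \<Longrightarrow> openin T U \<Longrightarrow> U \<subseteq> carrier G \<Longrightarrow> openin T (U #> g)"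
begin

lemma rep: "group_rep G scale \<pi>"
  using smooth by (simp add: smooth_representation_def)

lemma rep_lin: "g \<in> carrier G \<Longrightarrow> lin (\<pi> g)"
  using rep by (simp add: group_rep_def)

lemma rep_one: "\<pi> \<one> v = v"
  using rep by (simp add: group_rep_def)

lemma rep_mult: "g \<in> carrier G \<Longrightarrow> h \<in> carrier G \<Longrightarrow> \<pi> (g \<otimes> h) v = \<pi> g (\<pi> h v)"
  using rep by (simp add: group_rep_def)

lemma stabilizer_open: "openin T {g \<in> carrier G. \<pi> g v = v}"
  using smooth by (simp add: smooth_representation_def)

lemma center_normal: "center G \<lhd> G"
proof -
  have "subgroup (center G) G"
  proof (rule subgroupI)
    have "\<one> \<in> center G" by (simp add: center_def)
    then show "center G \<noteq> {}" by blast
    fix a assume a: "a \<in> center G"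
    then have aG: "a \<in> carrier G" and ac: "\<And>g. g \<in> carrier G \<Longrightarrow> a \<otimes> g = g \<otimes> a"
      by (auto simp: center_def)
    have "inv a \<otimes> g = g \<otimes> inv a" if g: "g \<in> carrier G" for g
    proof -
      have "inv a \<otimes> g = inv a \<otimes> (g \<otimes> a) \<otimes> inv a" using aG g by (simp add: m_assoc)
      also have "\<dots> = inv a \<otimes> (a \<otimes> g) \<otimes> inv a" by (simp add: ac[OF g])
      also have "\<dots> = g \<otimes> inv a" using aG g by (simp add: m_assoc[symmetric])
      finally show ?thesis .
    qed
    then show "inv a \<in> center G" using aG by (simp add: center_def)
    fix b assume b: "b \<in> center G"
    then have bG: "b \<in> carrier G" and bc: "\<And>g. g \<in> carrier G \<Longrightarrow> b \<otimes> g = g \<otimes> b"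
      by (auto simp: center_def)
    have "a \<otimes> b \<otimes> g = g \<otimes> (a \<otimes> b)" if g: "g \<in> carrier G" for g
      using aG bG g by (metis ac bc m_assoc)
    then show "a \<otimes> b \<in> center G" using aG bG by (simp add: center_def)
  qed (auto simp: center_def)
  moreover have "g \<otimes> z \<otimes> inv g \<in> center G" if "g \<in> carrier G" "z \<in> center G" for g z
  proof -
    have z: "z \<in> carrier G" "z \<otimes> g = g \<otimes> z" using that by (auto simp: center_def)
    have "g \<otimes> z \<otimes> inv g = z" using z that(1) by (metis inv_closed inv_solve_right m_closed)
    then show ?thesis using that(2) by simp
  qed
  ultimately show ?thesis by (simp add: normal_inv_iff)
qed

lemma irreducibleD:
  assumes "irreducible_representation G scale \<pi>" "subspace N"
    "\<And>g x. g \<in> carrier G \<Longrightarrow> x \<in> N \<Longrightarrow> \<pi> g x \<in> N"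
  shows "N = {0} \<or> N = UNIV"
  using assms unfolding irreducible_representation_def by blast

lemma cyclic:
  assumes "irreducible_representation G scale \<pi>" "v \<noteq> 0"
  shows "span ((\<lambda>g. \<pi> g v) ` carrier G) = UNIV"
proof -
  let ?O = "(\<lambda>g. \<pi> g v) ` carrier G"
  have "\<pi> g x \<in> span ?O" if g: "g \<in> carrier G" and x: "x \<in> span ?O" for g x
  proof -
    have "\<pi> g ` span ?O = span (\<pi> g ` ?O)" by (rule lin_image_span[OF rep_lin[OF g]])
    also have "\<dots> \<subseteq> span ?O"
    proof (rule span_mono)
      show "\<pi> g ` ?O \<subseteq> ?O"
        using g by (auto simp flip: rep_mult intro!: imageI)
    qed
    finally show ?thesis using x by blast
  qed
  then have "span ?O = {0} \<or> span ?O = UNIV"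
    by (intro irreducibleD[OF assms(1)]) auto
  moreover have "v \<in> span ?O" using rep_one by (intro span_base) (metis imageI one_closed)
  ultimately show ?thesis using assms(2) by auto
qed

text \<open>If the range were infinite-dimensional, a functional equal to 1 on an infinite independent set
  of vectors \<open>E (\<pi> g v0)\<close> would give a matrix coefficient of absolute value 1 on infinitely many
  disjoint sets of equal positive measure.\<close>

lemma discrete_series_finite_range:
  assumes ds: "discrete_series G T scale \<pi>" and linE: "lin E"
    and E: "\<And>f. Vector_Spaces.linear scale (*) f \<Longrightarrow>
      openin T {g \<in> carrier G. \<forall>v. f (E (\<pi> g v)) = f (E v)}"
  obtains F where "finite F" "\<And>x. E x \<in> span F"
proof -
  let ?Z = "center G"
  let ?Q = "G Mod ?Z"
  interpret Z: normal ?Z G by (rule center_normal)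
  have irr: "irreducible_representation G scale \<pi>"
    and cen: "\<And>z. z \<in> ?Z \<Longrightarrow> \<exists>c. norm c = 1 \<and> (\<forall>v. \<pi> z v = c *\<^sub>C v)"
    using ds by (auto simp: discrete_series_def)
  obtain \<mu> where haar: "haar_measure ?Q (quotient_topology G T ?Z) \<mu>"
    and int: "\<And>v f. f \<in> smooth_dual G T scale \<pi> \<Longrightarrow> \<exists>F :: 'g set \<Rightarrow> real.
      (\<forall>g \<in> carrier G. F (?Z #> g) = (norm (f (\<pi> g v)))\<^sup>2) \<and> integrable \<mu> F"
    using ds unfolding discrete_series_def by blast
  obtain v0 :: 'v where v0: "v0 \<noteq> 0"
    using irr unfolding irreducible_representation_def by blast
  define X where "X = (\<lambda>g. E (\<pi> g v0)) ` carrier G"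
  have EX: "E x \<in> span X" for x
  proof -
    have "x \<in> span ((\<lambda>g. \<pi> g v0) ` carrier G)" using cyclic[OF irr v0] by simp
    then have "E x \<in> E ` span ((\<lambda>g. \<pi> g v0) ` carrier G)" by blast
    then show ?thesis unfolding lin_image_span[OF linE] X_def image_image .
  qed
  obtain B where B: "B \<subseteq> X" "independent B" "X \<subseteq> span B"
    using maximal_independent_subset[of X] by blast
  have "finite B"
  proof (rule ccontr)
    assume inf: "infinite B"
    interpret P: vector_space_pair scale "(*) :: complex \<Rightarrow> complex \<Rightarrow> complex"
      by (intro vector_space_pair.intro vector_space_axioms vector_space_complex)
    obtain f where f: "Vector_Spaces.linear scale (*) f" "\<And>b. b \<in> B \<Longrightarrow> f b = 1"
      using P.linear_independent_extend[OF B(2), of "\<lambda>_. 1"] by blast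
    have "Vector_Spaces.linear scale (*) (f \<circ> E)"
      using linE f(1) by (rule Vector_Spaces.linear_compose)
    then have "f \<circ> E \<in> smooth_dual G T scale \<pi>"
      using E[OF f(1)] by (simp add: smooth_dual_def)
    then obtain F :: "'g set \<Rightarrow> real" where
      F: "\<And>g. g \<in> carrier G \<Longrightarrow> F (?Z #> g) = (norm (f (E (\<pi> g v0))))\<^sup>2" "integrable \<mu> F"
      using int[of "f \<circ> E" v0] by auto
    define S where "S = {g \<in> carrier G. \<pi> g v0 = v0}"
    have S: "openin T S" "S \<subseteq> carrier G" "\<one> \<in> S"
      using stabilizer_open rep_one by (auto simp: S_def)
    have "\<forall>b\<in>B. \<exists>g. g \<in> carrier G \<and> E (\<pi> g v0) = b" using B(1) by (auto simp: X_def)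
    then obtain \<gamma> where \<gamma>: "\<And>b. b \<in> B \<Longrightarrow> \<gamma> b \<in> carrier G" "\<And>b. b \<in> B \<Longrightarrow> E (\<pi> (\<gamma> b) v0) = b"
      by metis
    \<comment> \<open>The image of x S in the quotient by the centre. As S fixes v0, the squared
      coefficient F is constant on it.\<close>
    define A where "A = (\<lambda>x. (\<lambda>s. ?Z #> (x \<otimes> s)) ` S)"
    have A_open: "openin (quotient_topology G T ?Z) (A x)" if x: "x \<in> carrier G" for x
    proof -
      have "\<Union>(A x) = (\<Union>z\<in>?Z. (z \<otimes> x) <# S)"
      proof -
        have "z \<otimes> (x \<otimes> s) = z \<otimes> x \<otimes> s" if "z \<in> ?Z" "s \<in> S" for z s
          using that x S(2) Z.subset by (intro m_assoc[symmetric]) auto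
        then show ?thesis by (auto simp: A_def r_coset_def l_coset_def)
      qed
      moreover have "openin T ((z \<otimes> x) <# S)" if "z \<in> ?Z" for z
        using that x S Z.subset by (intro left_open) auto
      ultimately have "openin T (\<Union>(A x))" by auto
      moreover have "A x \<subseteq> carrier ?Q"
        using x S(2) by (auto simp: A_def FactGroup_def intro!: rcosetsI[OF Z.subset])
      ultimately show ?thesis
        by (simp add: openin_quotient_topology[OF Z.is_subgroup])
    qed
    have A_sets: "A x \<in> sets \<mu>" if "x \<in> carrier G" for x
      using haar A_open[OF that] by (auto simp: haar_measure_def)
    have A_transl: "emeasure \<mu> (A x) = emeasure \<mu> (A \<one>)" if x: "x \<in> carrier G" for x
    proof -
      have "?Z #> x \<in> carrier ?Q"
        using x by (auto simp: FactGroup_def intro!: rcosetsI[OF Z.subset])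
      then have "emeasure \<mu> ((?Z #> x) <#\<^bsub>?Q\<^esub> A \<one>) = emeasure \<mu> (A \<one>)"
        using haar A_sets[of \<one>] by (auto simp: haar_measure_def)
      moreover have "(?Z #> x) <#\<^bsub>?Q\<^esub> A \<one> = A x"
        using x S(2) Z.rcos_sum[OF x]
        by (auto simp: A_def l_coset_def FactGroup_def image_image subset_iff)
      ultimately show ?thesis by simp
    qed
    have A_pos: "0 < emeasure \<mu> (A \<one>)"
      using haar A_open[of \<one>] S(3) by (auto simp: haar_measure_def A_def)
    have FA: "F a = 1" if "b \<in> B" "a \<in> A (\<gamma> b)" for a b
    proof -
      obtain s where s: "s \<in> S" "a = ?Z #> (\<gamma> b \<otimes> s)" using \<open>a \<in> A (\<gamma> b)\<close> by (auto simp: A_def)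
      have "E (\<pi> (\<gamma> b \<otimes> s) v0) = b"
        using s(1) \<gamma>[OF that(1)] rep_mult[of "\<gamma> b" s v0] by (simp add: S_def)
      then show ?thesis
        using s F(1)[of "\<gamma> b \<otimes> s"] \<gamma>(1)[OF that(1)] S(2) f(2)[OF that(1)] by auto
    qed
    \<comment> \<open>The centre acts by scalars, so an overlap would make b a multiple of b',
      against the independence of B.\<close>
    have A_disj: "A (\<gamma> b) \<inter> A (\<gamma> b') = {}" if b: "b \<in> B" "b' \<in> B" "b \<noteq> b'" for b b'
    proof (rule ccontr)
      assume "A (\<gamma> b) \<inter> A (\<gamma> b') \<noteq> {}"
      then obtain s s' where s: "s \<in> S" "s' \<in> S" "?Z #> (\<gamma> b \<otimes> s) = ?Z #> (\<gamma> b' \<otimes> s')"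
        by (auto simp: A_def)
      let ?x = "\<gamma> b \<otimes> s" and ?y = "\<gamma> b' \<otimes> s'"
      have xy: "?x \<in> carrier G" "?y \<in> carrier G" using s(1,2) S(2) \<gamma>(1) b by auto
      have "?x \<in> ?Z #> ?y" using rcos_self[OF xy(1) Z.is_subgroup] s(3) by simp
      then obtain z where z: "z \<in> ?Z" "?x = z \<otimes> ?y" by (auto simp: r_coset_def)
      obtain c where c: "\<And>v. \<pi> z v = c *\<^sub>C v" using cen[OF z(1)] by blast
      have "b = E (\<pi> ?x v0)"
        using s(1) \<gamma>[OF b(1)] rep_mult[of "\<gamma> b" s v0] by (simp add: S_def)
      also have "\<dots> = c *\<^sub>C E (\<pi> ?y v0)"
        using z xy Z.subset rep_mult[of z ?y v0] by (auto simp: c lin_scale[OF linE])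
      also have "E (\<pi> ?y v0) = b'"
        using s(2) \<gamma>[OF b(2)] rep_mult[of "\<gamma> b'" s' v0] by (simp add: S_def)
      finally have "b \<in> span (B - {b})"
        using b by (metis Diff_iff empty_iff insert_iff span_base span_scale)
      then show False using B(2) b(1) by (auto simp: dependent_def)
    qed
    have bound: "of_nat N * emeasure \<mu> (A \<one>) \<le> (\<integral>\<^sup>+ x. ennreal (norm (F x)) \<partial>\<mu>)" for N
    proof -
      obtain B0 where B0: "B0 \<subseteq> B" "finite B0" "card B0 = N"
        using infinite_arbitrarily_large[OF inf] by metis
      have \<gamma>B0: "\<gamma> b \<in> carrier G" if "b \<in> B0" for b using \<gamma>(1) B0(1) that by blast
      have "of_nat N * emeasure \<mu> (A \<one>) = (\<Sum>b\<in>B0. emeasure \<mu> (A \<one>))"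
        using B0(3) by simp
      also have "\<dots> = (\<Sum>b\<in>B0. emeasure \<mu> (A (\<gamma> b)))"
        by (rule sum.cong[OF refl]) (rule A_transl[OF \<gamma>B0, symmetric])
      also have "\<dots> = emeasure \<mu> (\<Union>b\<in>B0. A (\<gamma> b))"
      proof (rule sum_emeasure)
        show "(\<lambda>b. A (\<gamma> b)) ` B0 \<subseteq> sets \<mu>" using A_sets \<gamma>B0 by blast
        show "disjoint_family_on (\<lambda>b. A (\<gamma> b)) B0"
          unfolding disjoint_family_on_def using B0(1) by (intro ballI impI A_disj) blast+
      qed (rule B0(2))
      also have "\<dots> = (\<integral>\<^sup>+ x. indicator (\<Union>b\<in>B0. A (\<gamma> b)) x \<partial>\<mu>)"
        by (intro nn_integral_indicator[symmetric] sets.finite_UN B0(2) A_sets \<gamma>B0)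
      also have "\<dots> \<le> (\<integral>\<^sup>+ x. ennreal (norm (F x)) \<partial>\<mu>)"
      proof (rule nn_integral_mono)
        fix x
        show "indicator (\<Union>b\<in>B0. A (\<gamma> b)) x \<le> ennreal (norm (F x))"
        proof (cases "x \<in> (\<Union>b\<in>B0. A (\<gamma> b))")
          case True
          then obtain b where "b \<in> B" "x \<in> A (\<gamma> b)" using B0(1) by blast
          then have "F x = 1" by (rule FA)
          then show ?thesis using True by simp
        qed simp
      qed
      finally show ?thesis .
    qed
    have "(\<integral>\<^sup>+ x. ennreal (norm (F x)) \<partial>\<mu>) < \<infinity>"
      using F(2) by (simp add: integrable_iff_bounded)
    from ennreal_of_nat_mult_unbounded[OF A_pos this] bound show False
      by (metis not_le)
  qed
  moreover have "E x \<in> span B" for x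
    using EX[of x] B(3) span_mono[of X "span B"] by (auto simp: span_span)
  ultimately show ?thesis using that by blast
qed

text \<open>G is the commuting product of the images of R and R'. Averaging over small subgroups of
  both factors gives E and E'; their composite is invariant under an open set of translations, so it
  has finite-dimensional range and \<open>exists_minimal_operator\<close> applies to the factor of
  R. The subgroup \<Omega> with finite orbits takes the place of an open compact subgroup.\<close>

lemma exists_minimal_operator_discrete_series:
  assumes ds: "discrete_series G T scale \<pi>"
    and R: "R \<in> hom G G" "R' \<in> hom G G" "continuous_map T T R" "continuous_map T T R'"
      "\<And>g. g \<in> carrier G \<Longrightarrow> R g \<otimes> R' g = g"
      "\<And>g h. g \<in> carrier G \<Longrightarrow> h \<in> carrier G \<Longrightarrow> R g \<otimes> R' h = R' h \<otimes> R g"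
    and topspace: "topspace T = carrier G"
    and \<Omega>: "subgroup \<Omega> G" "openin T \<Omega>" "\<And>v. finite ((\<lambda>g. \<pi> g v) ` \<Omega>)"
  obtains p where "p \<in> bicommutant (\<pi> ` R ` carrier G)" "\<exists>x. p x \<noteq> 0"
    "\<And>g. g \<in> carrier G \<Longrightarrow> \<exists>c. \<forall>x. p (\<pi> (R g) (p x)) = c *\<^sub>C p x"
proof -
  have irr: "irreducible_representation G scale \<pi>" using ds by (simp add: discrete_series_def)
  obtain v0 :: 'v where v0: "v0 \<noteq> 0"
    using irr unfolding irreducible_representation_def by blast
  have Rc: "R g \<in> carrier G" "R' g \<in> carrier G" if "g \<in> carrier G" for g
    using R(1,2) that by (auto simp: hom_def)
  have \<Omega>G: "\<Omega> \<subseteq> carrier G" using \<Omega>(1) by (rule subgroup.subset)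
  \<comment> \<open>S fixes v0, so both averages fix v0 as well, and \<open>E (E' v0)\<close> is not
    0.\<close>
  define S where "S = {g \<in> \<Omega>. \<pi> g v0 = v0}"
  have S: "subgroup S G"
  proof (rule subgroupI)
    show "S \<subseteq> carrier G" using \<Omega>G by (auto simp: S_def)
    show "S \<noteq> {}" using subgroup.one_closed[OF \<Omega>(1)] rep_one by (auto simp: S_def)
    fix a assume a: "a \<in> S"
    then have aG: "a \<in> carrier G" using \<Omega>G by (auto simp: S_def)
    have "\<pi> (inv a) v0 = \<pi> (inv a) (\<pi> a v0)" using a by (simp add: S_def)
    also have "\<dots> = v0" using aG rep_mult[of "inv a" a v0] rep_one by simp
    finally show "inv a \<in> S"
      using a subgroup.m_inv_closed[OF \<Omega>(1)] by (simp add: S_def)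
    fix b assume b: "b \<in> S"
    then have "b \<in> carrier G" using \<Omega>G by (auto simp: S_def)
    then show "a \<otimes> b \<in> S"
      using a b subgroup.m_closed[OF \<Omega>(1)] aG rep_mult[of a b v0] by (simp add: S_def)
  qed
  have "S = \<Omega> \<inter> {g \<in> carrier G. \<pi> g v0 = v0}" using \<Omega>G by (auto simp: S_def)
  then have S_open: "openin T S" using \<Omega>(2) stabilizer_open by (simp add: openin_Int)
  \<comment> \<open>Stated for an arbitrary endomorphism Q, to be used for R and for R'.\<close>
  have proj: "\<exists>E. lin E \<and> (\<forall>k\<in>S \<inter> Q ` carrier G. \<forall>v. E (\<pi> k v) = E v) \<and>
      (\<forall>v. E (E v) = E v) \<and> E v0 = v0 \<and>
      (\<forall>X. lin X \<and> (\<forall>k\<in>S \<inter> Q ` carrier G. \<forall>v. X (\<pi> k v) = \<pi> k (X v)) \<longrightarrow> (\<forall>v. X (E v) = E (X v)))"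
    if Q: "Q \<in> hom G G" for Q
  proof -
    have sub: "subgroup (S \<inter> Q ` carrier G) G"
      using subgroups_Inter_pair[OF S] group_hom.img_is_subgroup[of G G Q] Q
      by (simp add: group_hom_def group_hom_axioms_def)
    have KG: "k \<in> carrier G" if "k \<in> S \<inter> Q ` carrier G" for k
      using subgroup.subset[OF sub] that by blast
    let ?K = "\<pi> ` (S \<inter> Q ` carrier G)"
    obtain E where E: "lin E"
      "\<And>k v. k \<in> ?K \<Longrightarrow> k (E v) = E v" "\<And>k v. k \<in> ?K \<Longrightarrow> E (k v) = E v"
      "\<And>v. (\<And>k. k \<in> ?K \<Longrightarrow> k v = v) \<Longrightarrow> E v = v"
      "\<And>X v. lin X \<Longrightarrow> (\<And>k v. k \<in> ?K \<Longrightarrow> X (k v) = k (X v)) \<Longrightarrow> X (E v) = E (X v)"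
    proof (rule finite_orbit_projection)
      show "lin k" if "k \<in> ?K" for k using that rep_lin KG by auto
      show "k \<circ> l \<in> ?K" if kl: "k \<in> ?K" "l \<in> ?K" for k l
      proof -
        obtain g where g: "g \<in> S \<inter> Q ` carrier G" "k = \<pi> g" using kl(1) by blast
        obtain h where h: "h \<in> S \<inter> Q ` carrier G" "l = \<pi> h" using kl(2) by blast
        have "k \<circ> l = \<pi> (g \<otimes> h)" using rep_mult[OF KG[OF g(1)] KG[OF h(1)]] g h by auto
        then show ?thesis using subgroup.m_closed[OF sub g(1) h(1)] by blast
      qed
      have "\<pi> \<one> = id" using rep_one by auto
      then show "id \<in> ?K" using subgroup.one_closed[OF sub] by (metis imageI)
      show "\<exists>l\<in>?K. l \<circ> k = id" if k: "k \<in> ?K" for k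
      proof -
        obtain g where g: "g \<in> S \<inter> Q ` carrier G" "k = \<pi> g" using k by blast
        have "\<pi> (inv g) \<circ> k = id"
          using rep_mult[of "inv g" g] KG[OF g(1)] g(2) rep_one by auto
        then show ?thesis using subgroup.m_inv_closed[OF sub g(1)] by blast
      qed
      show "finite ((\<lambda>k. k v) ` ?K)" for v
        using \<Omega>(3)[of v] by (rule finite_subset[rotated]) (auto simp: S_def)
    qed blast
    have EE: "E (E v) = E v" for v by (rule E(4)) (rule E(2))
    have "E v0 = v0" by (rule E(4)) (auto simp: S_def)
    moreover have "X (E v) = E (X v)"
      if X: "lin X" "\<forall>k\<in>S \<inter> Q ` carrier G. \<forall>v. X (\<pi> k v) = \<pi> k (X v)" for X v
    proof (rule E(5)[OF X(1)])
      fix a u assume "a \<in> ?K"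
      then obtain k where "k \<in> S \<inter> Q ` carrier G" "a = \<pi> k" by blast
      then show "X (a u) = a (X u)" using X(2) by simp
    qed
    moreover have "E (\<pi> k v) = E v" if "k \<in> S \<inter> Q ` carrier G" for k v
      using E(3) that by simp
    ultimately show ?thesis using E(1) EE by (intro exI[of _ E] conjI ballI allI impI) simp_all
  qed
  obtain E where E: "lin E" "\<And>k v. k \<in> S \<inter> R ` carrier G \<Longrightarrow> E (\<pi> k v) = E v"
    "\<And>v. E (E v) = E v" "E v0 = v0"
    "\<And>X v. lin X \<Longrightarrow> (\<And>k v. k \<in> S \<inter> R ` carrier G \<Longrightarrow> X (\<pi> k v) = \<pi> k (X v)) \<Longrightarrow> X (E v) = E (X v)"
    using proj[OF R(1)] by blast
  obtain E' where E': "lin E'" "\<And>k v. k \<in> S \<inter> R' ` carrier G \<Longrightarrow> E' (\<pi> k v) = E' v"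
    "\<And>v. E' (E' v) = E' v" "E' v0 = v0"
    "\<And>X v. lin X \<Longrightarrow> (\<And>k v. k \<in> S \<inter> R' ` carrier G \<Longrightarrow> X (\<pi> k v) = \<pi> k (X v)) \<Longrightarrow> X (E' v) = E' (X v)"
    using proj[OF R(2)] by blast
  have comm: "\<pi> (R g) (\<pi> (R' h) v) = \<pi> (R' h) (\<pi> (R g) v)" if "g \<in> carrier G" "h \<in> carrier G" for g h v
    using R(6)[OF that] Rc that by (simp flip: rep_mult)
  have E_bi: "E \<in> bicommutant (\<pi> ` R ` carrier G)"
    by (rule bicommutantI[OF E(1)], rule E(5)) auto
  have E'_comm: "E' (\<pi> (R g) v) = \<pi> (R g) (E' v)" if "g \<in> carrier G" for g v
    by (rule E'(5)[symmetric]) (use that Rc rep_lin comm in auto)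
  obtain F where F: "finite F" "\<And>x. (E \<circ> E') x \<in> span F"
  proof (rule discrete_series_finite_range[OF ds lin_comp[OF E(1) E'(1)]])
    fix f :: "'v \<Rightarrow> complex"
    define Y where "Y = {g \<in> carrier G. \<forall>v. f ((E \<circ> E') (\<pi> g v)) = f ((E \<circ> E') v)}"
    \<comment> \<open>Both components of an element of U lie in S, so E and E' absorb them: left
      multiplication of g by U does not change \<open>E (E' (\<pi> g v))\<close>. Hence Y is a union
      of the open translates \<open>U #> g\<close>.\<close>
    define U where "U = {g \<in> topspace T. R g \<in> S} \<inter> {g \<in> topspace T. R' g \<in> S}"
    have U: "openin T U"
      unfolding U_def using openin_continuous_map_preimage[OF _ S_open] R(3,4) by (intro openin_Int)
    have UG: "U \<subseteq> carrier G" by (auto simp: U_def topspace)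
    have "\<one> \<in> U"
      using subgroup.one_closed[OF S] hom_one[OF R(1) is_group is_group]
        hom_one[OF R(2) is_group is_group] by (simp add: U_def topspace)
    have "Y = (\<Union>g\<in>Y. U #> g)"
    proof (intro equalityI subsetI)
      fix g assume "g \<in> Y"
      moreover from this have "g \<in> U #> g"
        using \<open>\<one> \<in> U\<close> unfolding r_coset_def Y_def by (auto intro!: bexI[of _ \<one>])
      ultimately show "g \<in> (\<Union>g\<in>Y. U #> g)" by blast
    next
      fix h assume "h \<in> (\<Union>g\<in>Y. U #> g)"
      then obtain g u where gu: "g \<in> Y" "u \<in> U" "h = u \<otimes> g" by (auto simp: r_coset_def)
      have g: "g \<in> carrier G" and u: "u \<in> carrier G" and fg: "\<And>v. f (E (E' (\<pi> g v))) = f (E (E' v))"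
        using gu UG by (auto simp: Y_def)
      have Ru: "R u \<in> S \<inter> R ` carrier G" "R' u \<in> S \<inter> R' ` carrier G"
        using gu(2) u by (auto simp: U_def)
      have "E (E' (\<pi> h v)) = E (E' (\<pi> g v))" for v
      proof -
        have "\<pi> h v = \<pi> (R u \<otimes> R' u) (\<pi> g v)" using gu(3) u g by (simp add: R(5) rep_mult)
        also have "\<dots> = \<pi> (R u) (\<pi> (R' u) (\<pi> g v))" using Rc[OF u] by (simp add: rep_mult)
        finally show ?thesis using E'_comm[OF u] E(2)[OF Ru(1)] E'(2)[OF Ru(2)] by simp
      qed
      then show "h \<in> Y" using gu(3) u g fg by (simp add: Y_def)
    qed
    moreover have "openin T (U #> g)" if "g \<in> Y" for g
      using that by (intro right_open U UG) (simp add: Y_def)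
    ultimately show "openin T {g \<in> carrier G. \<forall>v. f ((E \<circ> E') (\<pi> g v)) = f ((E \<circ> E') v)}"
      unfolding Y_def[symmetric] by (metis (no_types, lifting) imageE openin_Union)
  qed blast
  show ?thesis
  proof (rule exists_minimal_operator[of "\<pi> ` R ` carrier G" "\<pi> ` R' ` carrier G" E E' F v0])
    show "id \<in> \<pi> ` R' ` carrier G"
    proof -
      have "\<pi> (R' \<one>) = id" using hom_one[OF R(2) is_group is_group] rep_one by auto
      then show ?thesis by (metis imageI one_closed)
    qed
    show "b \<circ> c \<in> \<pi> ` R' ` carrier G" if bc: "b \<in> \<pi> ` R' ` carrier G" "c \<in> \<pi> ` R' ` carrier G" for b c
    proof -
      obtain g h where gh: "g \<in> carrier G" "h \<in> carrier G" "b = \<pi> (R' g)" "c = \<pi> (R' h)"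
        using bc by blast
      have "b \<circ> c = \<pi> (R' (g \<otimes> h))"
        using rep_mult[OF Rc(2)[OF gh(1)] Rc(2)[OF gh(2)]] gh by (auto simp: hom_mult[OF R(2)])
      then show ?thesis using gh by blast
    qed
    fix N assume N: "subspace N" "\<And>a x. a \<in> \<pi> ` R ` carrier G \<Longrightarrow> x \<in> N \<Longrightarrow> a x \<in> N"
      "\<And>b x. b \<in> \<pi> ` R' ` carrier G \<Longrightarrow> x \<in> N \<Longrightarrow> b x \<in> N"
    show "N = {0} \<or> N = UNIV"
    proof (rule irreducibleD[OF irr N(1)])
      fix g x assume g: "g \<in> carrier G" and x: "x \<in> N"
      have "\<pi> (R' g) x \<in> N" using g x by (intro N(3)[of "\<pi> (R' g)"] imageI)
      then have "\<pi> (R g) (\<pi> (R' g) x) \<in> N" using g by (intro N(2)[of "\<pi> (R g)"] imageI)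
      then show "\<pi> g x \<in> N" using rep_mult[OF Rc[OF g], of x] by (simp add: R(5)[OF g])
    qed
  next
    fix p assume "p \<in> bicommutant (\<pi> ` R ` carrier G)" "\<exists>x. p x \<noteq> 0"
      "\<And>a. a \<in> \<pi> ` R ` carrier G \<Longrightarrow> \<exists>c. \<forall>x. p (a (p x)) = c *\<^sub>C p x"
    then show thesis by (rule that) blast
  next
    show "E (E' v0) \<noteq> 0" using E(4) E'(4) v0 by simp
    show "E (E' x) \<in> span F" for x using F(2)[of x] by simp
    show "lin a" if "a \<in> \<pi> ` R ` carrier G" for a using that rep_lin Rc(1) by blast
    show "lin b" if "b \<in> \<pi> ` R' ` carrier G" for b using that rep_lin Rc(2) by blast
    show "a (b x) = b (a x)" if "a \<in> \<pi> ` R ` carrier G" "b \<in> \<pi> ` R' ` carrier G" for a b x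
      using that comm by blast
    show "E' (a x) = a (E' x)" if "a \<in> \<pi> ` R ` carrier G" for a x
      using that E'_comm by blast
  qed (rule E_bi E(3) E'(1) E'(3) F(1))+
qed

end

section \<open>Blockwise choice of the twist in a group that is a commuting product of
  blocks\<close>

section \<open>Twists fixed by the stabiliser\<close>


text \<open>\<open>R A m\<close> is to be read as the part of m in the blocks of A, corrected so as
  to stay in M; then M is the commuting product of the images of the \<open>R {i}\<close>.
  \<open>\<tau> g\<close> is the permutation of the blocks by g. \<open>inner\<close> compares
  different transports to the same block, and \<open>minimal\<close> supplies the operators that
  recover the representation from its restrictions to the blocks.\<close>

locale levi_rep = complex_vector_space scale + group S
  for scale :: "complex \<Rightarrow> 'v::ab_group_add \<Rightarrow> 'v" (infixr "*\<^sub>C" 75)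
    and S :: "('g, 'b) monoid_scheme" (structure) +
  fixes M N :: "'g set" and \<sigma> :: "'g \<Rightarrow> 'v \<Rightarrow> 'v" and X :: "('g \<Rightarrow> complex) set"
    and k :: nat and R :: "nat set \<Rightarrow> 'g \<Rightarrow> 'g" and \<tau> :: "'g \<Rightarrow> nat \<Rightarrow> nat"
  assumes M_sub: "subgroup M S" and N_sub: "subgroup N S"
    and conj_closed: "g \<in> N \<Longrightarrow> m \<in> M \<Longrightarrow> inv g \<otimes> m \<otimes> g \<in> M"
    and rep: "group_rep (S\<lparr>carrier := M\<rparr>) scale \<sigma>"
    and irr: "irreducible_representation (S\<lparr>carrier := M\<rparr>) scale \<sigma>"
    and X_mult: "\<eta> \<in> X \<Longrightarrow> m \<in> M \<Longrightarrow> l \<in> M \<Longrightarrow> \<eta> (m \<otimes> l) = \<eta> m * \<eta> l"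
    and X_nonzero: "\<eta> \<in> X \<Longrightarrow> m \<in> M \<Longrightarrow> \<eta> m \<noteq> 0"
    and X_one: "(\<lambda>_. 1) \<in> X"
    and X_times: "\<eta> \<in> X \<Longrightarrow> \<theta> \<in> X \<Longrightarrow> (\<lambda>m. \<eta> m * \<theta> m) \<in> X"
    and X_inverse: "\<eta> \<in> X \<Longrightarrow> (\<lambda>m. inverse (\<eta> m)) \<in> X"
    and X_conj: "\<eta> \<in> X \<Longrightarrow> g \<in> N \<Longrightarrow> (\<lambda>m. \<eta> (inv g \<otimes> m \<otimes> g)) \<in> X"
    and X_block: "\<eta> \<in> X \<Longrightarrow> i < k \<Longrightarrow> (\<lambda>m. \<eta> (R {i} m)) \<in> X"
    and R_closed: "A \<subseteq> {..<k} \<Longrightarrow> m \<in> M \<Longrightarrow> R A m \<in> M"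
    and R_mult: "A \<subseteq> {..<k} \<Longrightarrow> m \<in> M \<Longrightarrow> l \<in> M \<Longrightarrow> R A (m \<otimes> l) = R A m \<otimes> R A l"
    and R_empty: "m \<in> M \<Longrightarrow> R {} m = \<one>"
    and R_all: "m \<in> M \<Longrightarrow> R {..<k} m = m"
    and R_union: "A \<subseteq> {..<k} \<Longrightarrow> B \<subseteq> {..<k} \<Longrightarrow> A \<inter> B = {} \<Longrightarrow> m \<in> M
      \<Longrightarrow> R (A \<union> B) m = R A m \<otimes> R B m"
    and R_commute: "A \<subseteq> {..<k} \<Longrightarrow> B \<subseteq> {..<k} \<Longrightarrow> A \<inter> B = {} \<Longrightarrow> m \<in> M \<Longrightarrow> l \<in> M
      \<Longrightarrow> R A m \<otimes> R B l = R B l \<otimes> R A m"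
    and \<tau>_bij: "g \<in> N \<Longrightarrow> bij_betw (\<tau> g) {..<k} {..<k}"
    and \<tau>_mult: "g \<in> N \<Longrightarrow> h \<in> N \<Longrightarrow> i < k \<Longrightarrow> \<tau> (g \<otimes> h) i = \<tau> g (\<tau> h i)"
    and R_conj: "g \<in> N \<Longrightarrow> i < k \<Longrightarrow> m \<in> M \<Longrightarrow> R {i} (inv g \<otimes> m \<otimes> g) = inv g \<otimes> R {\<tau> g i} m \<otimes> g"
    and inner: "q \<in> N \<Longrightarrow> i < k \<Longrightarrow> \<tau> q i = i
      \<Longrightarrow> \<exists>q'\<in>M. \<forall>m\<in>M. q \<otimes> R {i} m \<otimes> inv q = q' \<otimes> R {i} m \<otimes> inv q'"
    and minimal: "i < k \<Longrightarrow> \<exists>p \<in> bicommutant (\<sigma> ` R {i} ` M). (\<exists>x. p x \<noteq> 0) \<and>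
      (\<forall>m\<in>M. \<exists>c. \<forall>x. p (\<sigma> (R {i} m) (p x)) = c *\<^sub>C p x)"
begin

lemma M_carrier: "m \<in> M \<Longrightarrow> m \<in> carrier S"
  using subgroup.subset[OF M_sub] by blast

lemma N_carrier: "g \<in> N \<Longrightarrow> g \<in> carrier S"
  using subgroup.subset[OF N_sub] by blast

lemmas M_mult = subgroup.m_closed[OF M_sub]
lemmas N_mult = subgroup.m_closed[OF N_sub]
lemmas N_inv = subgroup.m_inv_closed[OF N_sub]

lemma conj_closed': "g \<in> N \<Longrightarrow> m \<in> M \<Longrightarrow> g \<otimes> m \<otimes> inv g \<in> M"
  using conj_closed[OF N_inv, of g m] N_carrier by simp

lemma conj_mult:
  assumes "g \<in> N" "m \<in> M" "l \<in> M"
  shows "inv g \<otimes> (m \<otimes> l) \<otimes> g = (inv g \<otimes> m \<otimes> g) \<otimes> (inv g \<otimes> l \<otimes> g)"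
proof -
  have "g \<otimes> (inv g \<otimes> z) = z" if "z \<in> carrier S" for z
    using that N_carrier[OF assms(1)] m_assoc[of g "inv g" z] by simp
  then show ?thesis using N_carrier[OF assms(1)] M_carrier assms by (simp add: m_assoc)
qed

lemma \<sigma>_lin: "m \<in> M \<Longrightarrow> lin (\<sigma> m)"
  using rep by (simp add: group_rep_def)

lemma \<sigma>_one: "\<sigma> \<one> v = v"
  using rep by (simp add: group_rep_def)

lemma \<sigma>_mult: "m \<in> M \<Longrightarrow> l \<in> M \<Longrightarrow> \<sigma> (m \<otimes> l) v = \<sigma> m (\<sigma> l v)"
  using rep by (simp add: group_rep_def)

lemma \<sigma>_bij: assumes "m \<in> M" shows "bij (\<sigma> m)"
proof (rule o_bij)
  have "inv m \<in> M" using subgroup.m_inv_closed[OF M_sub assms] .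
  then show "\<sigma> (inv m) \<circ> \<sigma> m = id" "\<sigma> m \<circ> \<sigma> (inv m) = id"
    using \<sigma>_mult[of "inv m" m] \<sigma>_mult[of m "inv m"] assms M_carrier \<sigma>_one by auto
qed

text \<open>The preimage of W_O in N, with the equivalence between the conjugate and the twist
  written out.\<close>

definition stab :: "'g set" where
  "stab = {g \<in> N. \<exists>\<xi>\<in>X. \<exists>L. lin L \<and> bij L \<and>
    (\<forall>m\<in>M. \<forall>v. L (\<sigma> (inv g \<otimes> m \<otimes> g) v) = \<xi> m *\<^sub>C \<sigma> m (L v))}"

lemma stabI:
  "g \<in> N \<Longrightarrow> \<xi> \<in> X \<Longrightarrow> lin L \<Longrightarrow> bij L
    \<Longrightarrow> (\<And>m v. m \<in> M \<Longrightarrow> L (\<sigma> (inv g \<otimes> m \<otimes> g) v) = \<xi> m *\<^sub>C \<sigma> m (L v)) \<Longrightarrow> g \<in> stab"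
  unfolding stab_def by blast

lemma stabE:
  assumes "g \<in> stab"
  obtains \<xi> L where "\<xi> \<in> X" "lin L" "bij L"
    "\<And>m v. m \<in> M \<Longrightarrow> L (\<sigma> (inv g \<otimes> m \<otimes> g) v) = \<xi> m *\<^sub>C \<sigma> m (L v)"
  using assms unfolding stab_def by blast

lemma stab_N: "g \<in> stab \<Longrightarrow> g \<in> N"
  by (simp add: stab_def)

lemma stab_one: "\<one> \<in> stab"
  by (rule stabI[OF subgroup.one_closed[OF N_sub] X_one lin_id(1)]) (use M_carrier in auto)

text \<open>An equivalence of the conjugate of \<sigma> by h with its twist by \<theta>, conjugated
  by g, introduces the conjugate of \<theta> by g; \<open>X_conj\<close> and \<open>X_times\<close>
  keep the resulting twist in X.\<close>

lemma stab_mult: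
  assumes g: "g \<in> stab" and h: "h \<in> stab" shows "g \<otimes> h \<in> stab"
proof -
  obtain \<xi> L where L: "\<xi> \<in> X" "lin L" "bij L"
    "\<And>m v. m \<in> M \<Longrightarrow> L (\<sigma> (inv g \<otimes> m \<otimes> g) v) = \<xi> m *\<^sub>C \<sigma> m (L v)" using stabE[OF g] by blast
  obtain \<theta> K where K: "\<theta> \<in> X" "lin K" "bij K"
    "\<And>m v. m \<in> M \<Longrightarrow> K (\<sigma> (inv h \<otimes> m \<otimes> h) v) = \<theta> m *\<^sub>C \<sigma> m (K v)" using stabE[OF h] by blast
  have gh: "g \<in> N" "h \<in> N" "g \<in> carrier S" "h \<in> carrier S" using g h stab_N N_carrier by auto
  show ?thesis
  proof (rule stabI[OF N_mult[OF gh(1,2)] X_times[OF X_conj[OF K(1) gh(1)] L(1)]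
        lin_comp[OF L(2) K(2)] bij_comp[OF K(3) L(3)]])
    fix m v assume m: "m \<in> M"
    have "inv (g \<otimes> h) \<otimes> m \<otimes> (g \<otimes> h) = inv h \<otimes> (inv g \<otimes> m \<otimes> g) \<otimes> h"
      using gh M_carrier[OF m] by (simp add: inv_mult_group m_assoc)
    then show "(L \<circ> K) (\<sigma> (inv (g \<otimes> h) \<otimes> m \<otimes> (g \<otimes> h)) v)
        = (\<theta> (inv g \<otimes> m \<otimes> g) * \<xi> m) *\<^sub>C \<sigma> m ((L \<circ> K) v)"
      using K(4)[OF conj_closed[OF gh(1) m]] L(4)[OF m] by (simp add: lin_scale[OF L(2)])
  qed
qed

lemma stab_inv:
  assumes g: "g \<in> stab" shows "inv g \<in> stab"
proof -
  obtain \<xi> L where L: "\<xi> \<in> X" "lin L" "bij L"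
    "\<And>m v. m \<in> M \<Longrightarrow> L (\<sigma> (inv g \<otimes> m \<otimes> g) v) = \<xi> m *\<^sub>C \<sigma> m (L v)" using stabE[OF g] by blast
  have gN: "g \<in> N" "g \<in> carrier S" using g stab_N N_carrier by auto
  let ?I = "inv_into UNIV L"
  have I: "lin ?I" "bij ?I" "\<And>x. ?I (L x) = x" "\<And>x. L (?I x) = x"
    using L(2,3) by (auto simp: lin_inv_into bij_imp_bij_inv bij_is_inj bij_is_surj surj_f_inv_f)
  show ?thesis
  proof (rule stabI[OF N_inv[OF gN(1)] X_inverse[OF X_conj[OF L(1) N_inv[OF gN(1)]]] I(1,2)])
    fix m v assume m: "m \<in> M"
    let ?y = "inv (inv g) \<otimes> m \<otimes> inv g"
    have y: "?y \<in> M" by (rule conj_closed[OF N_inv[OF gN(1)] m])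
    have "inv g \<otimes> ?y \<otimes> g = m" using gN M_carrier[OF m] by (simp add: m_assoc inv_solve_left')
    then have "L (\<sigma> m (?I v)) = \<xi> ?y *\<^sub>C \<sigma> ?y v" using L(4)[OF y, of "?I v"] I by simp
    then have "?I (\<xi> ?y *\<^sub>C \<sigma> ?y v) = \<sigma> m (?I v)" using I(3) by metis
    then have "inverse (\<xi> ?y) *\<^sub>C (\<xi> ?y *\<^sub>C ?I (\<sigma> ?y v)) = inverse (\<xi> ?y) *\<^sub>C \<sigma> m (?I v)"
      by (simp add: lin_scale[OF I(1)])
    then show "?I (\<sigma> ?y v) = inverse (\<xi> ?y) *\<^sub>C \<sigma> m (?I v)"
      using X_nonzero[OF L(1) y] by simp
  qed
qed

lemma \<tau>_less: "g \<in> N \<Longrightarrow> i < k \<Longrightarrow> \<tau> g i < k"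
  using \<tau>_bij[of g] by (auto simp: bij_betw_def)

lemma \<tau>_one: assumes "i < k" shows "\<tau> \<one> i = i"
proof -
  have one: "\<one> \<in> N" by (rule subgroup.one_closed[OF N_sub])
  have "\<tau> \<one> (\<tau> \<one> i) = \<tau> \<one> i" using \<tau>_mult[OF one one assms] by simp
  then show ?thesis
    using \<tau>_bij[OF one] \<tau>_less[OF one assms] assms by (auto simp: bij_betw_def inj_on_def)
qed

lemma \<tau>_inv:
  assumes "g \<in> N" "i < k" shows "\<tau> (inv g) (\<tau> g i) = i" "\<tau> g (\<tau> (inv g) i) = i"
  using \<tau>_mult[OF N_inv assms(1), of g i] \<tau>_mult[of g "inv g" i] assms N_carrier[OF assms(1)]
    N_inv[OF assms(1)] \<tau>_one by auto

lemma X_prod: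
  fixes j :: nat
  shows "(\<And>i. i < j \<Longrightarrow> \<xi> i \<in> X) \<Longrightarrow> (\<lambda>m. \<Prod>i<j. \<xi> i m) \<in> X"
  by (induction j) (simp_all add: X_one X_times)

lemma X_unit: "\<eta> \<in> X \<Longrightarrow> \<eta> \<one> = 1"
  using X_mult[of \<eta> \<one> \<one>] X_nonzero[of \<eta> \<one>] subgroup.one_closed[OF M_sub] by simp

lemma R_one: assumes "A \<subseteq> {..<k}" shows "R A \<one> = \<one>"
proof -
  have one: "\<one> \<in> M" by (rule subgroup.one_closed[OF M_sub])
  have "R A \<one> \<otimes> R A \<one> = R A \<one>" using R_mult[OF assms one one] by simp
  then show ?thesis using M_carrier[OF R_closed[OF assms one]] by (metis l_cancel_one')
qed

text \<open>Each m is the product of its \<open>R {i} m\<close>, and the values of the characters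
  are nonzero; so a subspace stable under the twisted blocks is stable under \<sigma>, and joint
  irreducibility is that of \<sigma>. The twists \<open>\<xi> i\<close> may differ from block to
  block.\<close>

lemma block_family:
  assumes \<xi>: "\<And>i. i < k \<Longrightarrow> \<xi> i \<in> X"
  shows "commuting_family scale k M (\<otimes>) \<one> (\<lambda>i m v. \<xi> i (R {i} m) *\<^sub>C \<sigma> (R {i} m) v)"
proof (rule commuting_family.intro[OF complex_vector_space_axioms commuting_family_axioms.intro])
  have R: "R {i} m \<in> M" if "i < k" "m \<in> M" for i m using R_closed[of "{i}" m] that by simp
  show "lin (\<lambda>v. \<xi> i (R {i} m) *\<^sub>C \<sigma> (R {i} m) v)" if "i < k" "m \<in> M" for i m
    by (rule lin_scaled[OF \<sigma>_lin[OF R[OF that]]])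
  show "m \<otimes> l \<in> M" if "m \<in> M" "l \<in> M" for m l by (rule M_mult[OF that])
  show "\<one> \<in> M" by (rule subgroup.one_closed[OF M_sub])
  show "\<xi> i (R {i} (m \<otimes> l)) *\<^sub>C \<sigma> (R {i} (m \<otimes> l)) x =
      \<xi> i (R {i} m) *\<^sub>C \<sigma> (R {i} m) (\<xi> i (R {i} l) *\<^sub>C \<sigma> (R {i} l) x)"
    if "i < k" "m \<in> M" "l \<in> M" for i m l x
    using that R by (simp add: R_mult \<sigma>_mult X_mult \<xi> lin_scale[OF \<sigma>_lin])
  show "\<xi> i (R {i} \<one>) *\<^sub>C \<sigma> (R {i} \<one>) x = x" if "i < k" for i x
    using that by (simp add: R_one X_unit \<xi> \<sigma>_one)
  show "\<xi> i (R {i} m) *\<^sub>C \<sigma> (R {i} m) (\<xi> j (R {j} l) *\<^sub>C \<sigma> (R {j} l) x) =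
      \<xi> j (R {j} l) *\<^sub>C \<sigma> (R {j} l) (\<xi> i (R {i} m) *\<^sub>C \<sigma> (R {i} m) x)"
    if "i < k" "j < k" "i \<noteq> j" "m \<in> M" "l \<in> M" for i j m l x
  proof -
    have "\<sigma> (R {i} m) (\<sigma> (R {j} l) x) = \<sigma> (R {j} l) (\<sigma> (R {i} m) x)"
      using R_commute[of "{i}" "{j}" m l] that R by (simp flip: \<sigma>_mult)
    then show ?thesis using that R by (simp add: lin_scale[OF \<sigma>_lin] mult.commute)
  qed
  fix W assume W: "subspace W"
    "\<And>i m x. i < k \<Longrightarrow> m \<in> M \<Longrightarrow> x \<in> W \<Longrightarrow> \<xi> i (R {i} m) *\<^sub>C \<sigma> (R {i} m) x \<in> W"
  have block: "\<sigma> (R {i} m) x \<in> W" if "i < k" "m \<in> M" "x \<in> W" for i m x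
  proof -
    have "inverse (\<xi> i (R {i} m)) *\<^sub>C (\<xi> i (R {i} m) *\<^sub>C \<sigma> (R {i} m) x) \<in> W"
      by (rule subspace_scale[OF W(1) W(2)[OF that]])
    then show ?thesis using X_nonzero[OF \<xi>[OF that(1)] R[OF that(1,2)]] by simp
  qed
  have "\<sigma> (R {..<j} m) x \<in> W" if "j \<le> k" "m \<in> M" "x \<in> W" for j m x
    using that
  proof (induction j arbitrary: x)
    case (Suc j)
    have "R {..<Suc j} m = R {..<j} m \<otimes> R {j} m"
      using R_union[of "{..<j}" "{j}" m] Suc.prems by (auto simp: lessThan_Suc)
    then have "\<sigma> (R {..<Suc j} m) x = \<sigma> (R {..<j} m) (\<sigma> (R {j} m) x)"
      using Suc.prems R_closed[of "{..<j}" m] R[of j m] by (auto simp: \<sigma>_mult)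
    then show ?case using Suc block by simp
  qed (simp add: R_empty \<sigma>_one)
  then have stable: "\<sigma> m x \<in> W" if "m \<in> M" "x \<in> W" for m x using that R_all by fastforce
  then show "W = {0} \<or> W = UNIV"
    using irr W(1) unfolding irreducible_representation_def by auto
qed

text \<open>By \<open>R_conj\<close>, the block \<open>\<tau> (inv g) i\<close> of
  \<open>inv g \<otimes> m \<otimes> g\<close> is the conjugate of block i of m. The shift of the
  index therefore makes the i-th operator belong to block i of m again, so that it can be compared
  with \<open>\<beta> i m\<close>.\<close>

lemma conj_family:
  assumes g: "g \<in> N" and F: "commuting_family scale k M (\<otimes>) \<one> \<beta>"
  shows "commuting_family scale k M (\<otimes>) \<one> (\<lambda>i m. \<beta> (\<tau> (inv g) i) (inv g \<otimes> m \<otimes> g))"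
proof -
  interpret F: commuting_family scale k M "(\<otimes>)" \<one> \<beta> by (rule F)
  have \<tau>: "\<tau> (inv g) i < k" if "i < k" for i using \<tau>_less[OF N_inv[OF g] that] .
  have gS: "g \<in> carrier S" using g N_carrier by simp
  show ?thesis
  proof (rule commuting_family.intro[OF complex_vector_space_axioms commuting_family_axioms.intro])
    show "\<beta> (\<tau> (inv g) i) (inv g \<otimes> (m \<otimes> l) \<otimes> g) x =
        \<beta> (\<tau> (inv g) i) (inv g \<otimes> m \<otimes> g) (\<beta> (\<tau> (inv g) i) (inv g \<otimes> l \<otimes> g) x)"
      if "i < k" "m \<in> M" "l \<in> M" for i m l x
      using that \<tau> by (simp add: conj_mult g F.op_mlt conj_closed)
    show "\<beta> (\<tau> (inv g) i) (inv g \<otimes> \<one> \<otimes> g) x = x" if "i < k" for i x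
      using gS \<tau>[OF that] by (simp add: F.op_unit)
    show "\<beta> (\<tau> (inv g) i) (inv g \<otimes> m \<otimes> g) (\<beta> (\<tau> (inv g) j) (inv g \<otimes> l \<otimes> g) x) =
        \<beta> (\<tau> (inv g) j) (inv g \<otimes> l \<otimes> g) (\<beta> (\<tau> (inv g) i) (inv g \<otimes> m \<otimes> g) x)"
      if "i < k" "j < k" "i \<noteq> j" "m \<in> M" "l \<in> M" for i j m l x
    proof (rule F.op_commute)
      show "\<tau> (inv g) i \<noteq> \<tau> (inv g) j" using \<tau>_inv(2)[OF g] that by metis
    qed (use that \<tau> conj_closed g in auto)
    fix W assume W: "subspace W"
      "\<And>i m x. i < k \<Longrightarrow> m \<in> M \<Longrightarrow> x \<in> W \<Longrightarrow> \<beta> (\<tau> (inv g) i) (inv g \<otimes> m \<otimes> g) x \<in> W"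
    show "W = {0} \<or> W = UNIV"
    proof (rule F.irreducible[OF W(1)])
      fix i m x assume *: "i < k" "m \<in> M" "x \<in> W"
      have "inv g \<otimes> (g \<otimes> m \<otimes> inv g) \<otimes> g = m"
        using gS M_carrier[OF *(2)] by (simp add: m_assoc inv_solve_left')
      then show "\<beta> i m x \<in> W"
        using W(2)[OF \<tau>_less[OF g *(1)] conj_closed'[OF g *(2)] *(3)] \<tau>_inv(1)[OF g *(1)] by simp
    qed
  qed (use \<tau> g in \<open>auto intro: F.lin_op conj_closed F.mlt_closed F.unit_closed\<close>)
qed

text \<open>Within an orbit of blocks under the stabiliser, the components of the twist are chosen such
  that each block carries the transport of the action on one representative block \<open>c i\<close>.\<close>

lemma exists_fixed_twist:
  "\<exists>\<eta>\<in>X. \<forall>g\<in>stab. \<exists>K. lin K \<and> bij K \<and> (\<forall>m\<in>M. \<forall>v.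
    K (\<eta> m *\<^sub>C \<sigma> m v) = \<eta> (inv g \<otimes> m \<otimes> g) *\<^sub>C \<sigma> (inv g \<otimes> m \<otimes> g) (K v))"
proof -
  have R: "R {i} m \<in> M" if "i < k" "m \<in> M" for i m using R_closed[of "{i}" m] that by simp
  \<comment> \<open>The least block in the orbit of i under the stabiliser; taking the least makes
    the representative depend on the orbit only.\<close>
  define c where "c = (\<lambda>i. LEAST j. j < k \<and> (\<exists>g\<in>stab. \<tau> g j = i))"
  have c: "c i < k \<and> (\<exists>g\<in>stab. \<tau> g (c i) = i)" if "i < k" for i
    unfolding c_def by (rule LeastI[of _ i]) (use that stab_one \<tau>_one in auto)
  have c_eq: "c i = c j" if g: "g \<in> stab" and j: "j < k" and i: "\<tau> g j = i" for g i j
  proof -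
    have "(\<exists>h\<in>stab. \<tau> h l = i) \<longleftrightarrow> (\<exists>h\<in>stab. \<tau> h l = j)" if l: "l < k" for l
    proof
      assume "\<exists>h\<in>stab. \<tau> h l = i"
      then obtain h where h: "h \<in> stab" "\<tau> h l = i" by blast
      have "\<tau> (inv g \<otimes> h) l = j"
        using \<tau>_mult[OF stab_N[OF stab_inv[OF g]] stab_N[OF h(1)] l] h(2) i
          \<tau>_inv(1)[OF stab_N[OF g] j] by simp
      then show "\<exists>h\<in>stab. \<tau> h l = j" using stab_mult[OF stab_inv[OF g] h(1)] by blast
    next
      assume "\<exists>h\<in>stab. \<tau> h l = j"
      then obtain h where h: "h \<in> stab" "\<tau> h l = j" by blast
      have "\<tau> (g \<otimes> h) l = i" using \<tau>_mult[OF stab_N[OF g] stab_N[OF h(1)] l] h(2) i by simp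
      then show "\<exists>h\<in>stab. \<tau> h l = i" using stab_mult[OF g h(1)] by blast
    qed
    then show ?thesis unfolding c_def by (metis (no_types, lifting))
  qed
  have "\<forall>i\<in>{..<k}. \<exists>h \<xi> L. h \<in> stab \<and> \<tau> h (c i) = i \<and> \<xi> \<in> X \<and> lin L \<and> bij L \<and>
    (\<forall>m\<in>M. \<forall>v. L (\<sigma> (inv h \<otimes> m \<otimes> h) v) = \<xi> m *\<^sub>C \<sigma> m (L v))"
    using c unfolding stab_def by fast
  then obtain h \<xi> \<Lambda> where hh: "\<forall>i\<in>{..<k}. h i \<in> stab \<and> \<tau> (h i) (c i) = i \<and> \<xi> i \<in> X \<and>
    lin (\<Lambda> i) \<and> bij (\<Lambda> i) \<and>
    (\<forall>m\<in>M. \<forall>v. \<Lambda> i (\<sigma> (inv (h i) \<otimes> m \<otimes> h i) v) = \<xi> i m *\<^sub>C \<sigma> m (\<Lambda> i v))"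
    by metis
  have h: "h i \<in> stab" "h i \<in> N" "h i \<in> carrier S" "\<tau> (h i) (c i) = i" if "i < k" for i
    using hh stab_N N_carrier that by auto
  have \<xi>: "\<xi> i \<in> X" if "i < k" for i using hh that by auto
  have \<Lambda>: "lin (\<Lambda> i)" "bij (\<Lambda> i)" if "i < k" for i using hh that by auto
  have \<Lambda>_eq: "\<Lambda> i (\<sigma> (inv (h i) \<otimes> m \<otimes> h i) v) = \<xi> i m *\<^sub>C \<sigma> m (\<Lambda> i v)"
    if "i < k" "m \<in> M" for i m v using hh that by auto
  \<comment> \<open>Through \<open>\<Lambda> i\<close>, this is the action of
    \<open>inv (h i) \<otimes> R {i} m \<otimes> h i\<close>, which lies in block
    \<open>c i\<close>.\<close>
  define \<beta> where "\<beta> = (\<lambda>i m v. \<xi> i (R {i} m) *\<^sub>C \<sigma> (R {i} m) v)"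
  \<comment> \<open>Each \<open>\<xi> i\<close> is evaluated on block i alone. No single
    \<open>\<xi> i\<close> would do, since each is adapted to the transport to one block.\<close>
  define \<eta> where "\<eta> = (\<lambda>m. \<Prod>i<k. \<xi> i (R {i} m))"
  have \<eta>: "\<eta> \<in> X" unfolding \<eta>_def by (rule X_prod) (use X_block \<xi> in auto)
  have F: "commuting_family scale k M (\<otimes>) \<one> \<beta>" unfolding \<beta>_def by (rule block_family[OF \<xi>])
  obtain v0 :: 'v where v0: "v0 \<noteq> 0" using irr unfolding irreducible_representation_def by blast
  have "\<forall>i\<in>{..<k}. \<exists>p. p \<in> bicommutant (\<sigma> ` R {i} ` M) \<and> (\<exists>x. p x \<noteq> 0) \<and>
      (\<forall>m\<in>M. \<exists>c. \<forall>x. p (\<sigma> (R {i} m) (p x)) = c *\<^sub>C p x)"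
    using minimal by blast
  then obtain p where pp: "\<forall>i\<in>{..<k}. p i \<in> bicommutant (\<sigma> ` R {i} ` M) \<and> (\<exists>x. p i x \<noteq> 0) \<and>
      (\<forall>m\<in>M. \<exists>c. \<forall>x. p i (\<sigma> (R {i} m) (p i x)) = c *\<^sub>C p i x)"
    by metis
  have p: "p i \<in> bicommutant (\<sigma> ` R {i} ` M)" "\<exists>x. p i x \<noteq> 0"
    "m \<in> M \<Longrightarrow> \<exists>c. \<forall>x. p i (\<sigma> (R {i} m) (p i x)) = c *\<^sub>C p i x" if "i < k" for i m
    using pp that by auto
  have p_\<beta>: "p i \<in> bicommutant (\<beta> i ` M)" if i: "i < k" for i
  proof (rule bicommutantI[OF bicommutant_lin[OF p(1)[OF i]]])
    fix T x assume T: "lin T" "\<And>a x. a \<in> \<beta> i ` M \<Longrightarrow> T (a x) = a (T x)"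
    show "T (p i x) = p i (T x)"
    proof (rule bicommutant_commute[OF p(1)[OF i] T(1)])
      fix a x assume "a \<in> \<sigma> ` R {i} ` M"
      then obtain m where m: "m \<in> M" "a = \<sigma> (R {i} m)" by blast
      have "T (\<beta> i m x) = \<beta> i m (T x)" using T(2) m(1) by blast
      then show "T (a x) = a (T x)"
        using X_nonzero[OF \<xi>[OF i] R[OF i m(1)]] by (simp add: \<beta>_def m(2) lin_scale[OF T(1)])
    qed
  qed
  have p_min: "\<exists>c. \<forall>x. p i (\<beta> i m (p i x)) = c *\<^sub>C p i x" if i: "i < k" and m: "m \<in> M" for i m
  proof -
    obtain b where "\<forall>x. p i (\<sigma> (R {i} m) (p i x)) = b *\<^sub>C p i x" using p(3)[OF i m] by blast
    then show ?thesis
      by (intro exI[of _ "\<xi> i (R {i} m) * b"])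
        (simp add: \<beta>_def lin_scale[OF bicommutant_lin[OF p(1)[OF i]]])
  qed
  have "\<exists>K. lin K \<and> bij K \<and> (\<forall>m\<in>M. \<forall>v.
      K (\<eta> m *\<^sub>C \<sigma> m v) = \<eta> (inv g \<otimes> m \<otimes> g) *\<^sub>C \<sigma> (inv g \<otimes> m \<otimes> g) (K v))"
    if g: "g \<in> stab" for g
  proof -
    have gN: "g \<in> N" "g \<in> carrier S" using g stab_N N_carrier by auto
    let ?\<phi> = "\<lambda>m. inv g \<otimes> m \<otimes> g" and ?t = "\<tau> (inv g)"
    have t: "?t i < k" if "i < k" for i using \<tau>_less[OF N_inv[OF gN(1)] that] .
    define \<beta>' where "\<beta>' = (\<lambda>i m. \<beta> (?t i) (?\<phi> m))"
    have F': "commuting_family scale k M (\<otimes>) \<one> \<beta>'"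
      unfolding \<beta>'_def by (rule conj_family[OF gN(1) F])
    have R_t: "R {?t i} (?\<phi> m) = ?\<phi> (R {i} m)" if "i < k" "m \<in> M" for i m
      using R_conj[OF gN(1) t[OF that(1)] that(2)] \<tau>_inv(2)[OF gN(1) that(1)] by simp
    have "\<exists>L. lin L \<and> bij L \<and> (\<forall>m\<in>M. \<forall>x. L (\<beta> i m x) = \<beta>' i m (L x))" if i: "i < k" for i
    proof -
      define j where "j = ?t i"
      have j: "j < k" using t[OF i] by (simp add: j_def)
      have ci: "c i = c j" using c_eq[OF g j, of i] \<tau>_inv(2)[OF gN(1) i] by (simp add: j_def)
      have ck: "c i < k" using c[OF i] by blast
      \<comment> \<open>Block i is reached from block \<open>c i\<close> by \<open>h i\<close> and
        also by \<open>g \<otimes> h j\<close>. The element q compares the two ways: it fixes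
        \<open>c i\<close>, so on that block it acts by conjugation with some q' in M.\<close>
      define q where "q = inv (h j) \<otimes> inv g \<otimes> h i"
      have q: "q \<in> N" unfolding q_def by (intro N_mult N_inv h i j gN)
      have qS: "q \<in> carrier S" using q by (rule N_carrier)
      have "\<tau> q (c i) = \<tau> (inv (h j)) (?t (\<tau> (h i) (c i)))"
        unfolding q_def using ck h(2) i j gN
        by (simp add: \<tau>_mult N_mult N_inv \<tau>_less)
      also have "\<dots> = c i" using h(4)[OF i] \<tau>_inv(1)[OF h(2)[OF j], of "c j"] h(4)[OF j] ck ci
        by (simp add: j_def[symmetric])
      finally obtain q' where q': "q' \<in> M"
        "\<And>m. m \<in> M \<Longrightarrow> q \<otimes> R {c i} m \<otimes> inv q = q' \<otimes> R {c i} m \<otimes> inv q'"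
        using inner[OF q ck] by blast
      define I where "I = inv_into UNIV (\<Lambda> i)"
      have I: "lin I" "bij I" "\<And>x. I (\<Lambda> i x) = x" "\<And>x. \<Lambda> i (I x) = x"
        using \<Lambda>[OF i] unfolding I_def
        by (auto simp: lin_inv_into bij_imp_bij_inv bij_is_inj bij_is_surj surj_f_inv_f)
      \<comment> \<open>Back from block i to the representative block by I, across by q', and out to
        block j by \<open>\<Lambda> j\<close>.\<close>
      define L where "L = \<Lambda> j \<circ> \<sigma> q' \<circ> I"
      have "lin L" unfolding L_def by (intro lin_comp \<Lambda> j \<sigma>_lin q'(1) I)
      moreover have "bij L" unfolding L_def by (intro bij_comp \<Lambda> j \<sigma>_bij q'(1) I)
      moreover have "L (\<beta> i m x) = \<beta>' i m (L x)" if m: "m \<in> M" for m x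
      proof -
        define y where "y = inv (h i) \<otimes> R {i} m \<otimes> h i"
        define z where "z = inv (h j) \<otimes> R {j} (?\<phi> m) \<otimes> h j"
        have \<phi>m: "?\<phi> m \<in> M" by (rule conj_closed[OF gN(1) m])
        have yM: "y \<in> M" unfolding y_def by (rule conj_closed[OF h(2)[OF i] R[OF i m]])
        have zM: "z \<in> M" unfolding z_def by (rule conj_closed[OF h(2)[OF j] R[OF j \<phi>m]])
        have "y = R {c i} (inv (h i) \<otimes> m \<otimes> h i)"
          using R_conj[OF h(2)[OF i] ck m] h(4)[OF i] by (simp add: y_def)
        then have qy: "q \<otimes> y \<otimes> inv q = q' \<otimes> y \<otimes> inv q'"
          using q'(2)[OF conj_closed[OF h(2)[OF i] m]] by simp
        have "q \<otimes> y \<otimes> inv q = z"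
        proof -
          have [simp]: "R {i} m \<in> carrier S" using M_carrier[OF R[OF i m]] .
          have "h i \<otimes> (inv (h i) \<otimes> w) = w" if "w \<in> carrier S" for w
            using that h(3)[OF i] m_assoc[of "h i" "inv (h i)" w] by simp
          moreover have "R {j} (?\<phi> m) = ?\<phi> (R {i} m)" using R_t[OF i m] by (simp add: j_def)
          ultimately show ?thesis
            unfolding q_def y_def z_def using h(3)[OF i] h(3)[OF j] gN(2)
            by (simp add: inv_mult_group m_assoc)
        qed
        then have "q' \<otimes> y \<otimes> inv q' = z" using qy by simp
        then have "z \<otimes> q' = q' \<otimes> y"
          using M_carrier[OF q'(1)] M_carrier[OF yM] by (auto simp: m_assoc)
        then have zq: "\<sigma> q' (\<sigma> y v) = \<sigma> z (\<sigma> q' v)" for v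
          using q'(1) yM zM by (simp flip: \<sigma>_mult)
        have "I (\<beta> i m x) = \<sigma> y (I x)"
          using \<Lambda>_eq[OF i R[OF i m], of "I x"] I(3,4) unfolding \<beta>_def y_def by metis
        then have "L (\<beta> i m x) = \<Lambda> j (\<sigma> z (\<sigma> q' (I x)))" by (simp add: L_def zq)
        also have "\<dots> = \<beta>' i m (L x)"
          using \<Lambda>_eq[OF j R[OF j \<phi>m]] by (simp add: z_def \<beta>'_def \<beta>_def L_def j_def)
        finally show ?thesis .
      qed
      ultimately show ?thesis by blast
    qed
    then have "\<forall>i\<in>{..<k}. \<exists>L. lin L \<and> bij L \<and> (\<forall>m\<in>M. \<forall>x. L (\<beta> i m x) = \<beta>' i m (L x))" by blast
    then obtain L where L: "\<forall>i\<in>{..<k}. lin (L i) \<and> bij (L i) \<and> (\<forall>m\<in>M. \<forall>x. L i (\<beta> i m x) = \<beta>' i m (L i x))"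
      by metis
    obtain K where K: "lin K" "bij K" "\<And>i m x. i < k \<Longrightarrow> m \<in> M \<Longrightarrow> K (\<beta> i m x) = \<beta>' i m (K x)"
      by (rule joint_equivalence[OF F F' v0, of p L]) (use p_\<beta> p(2) p_min L in auto)
    \<comment> \<open>K is known to intertwine single blocks only, so m is built up from its blocks
      one at a time by \<open>R_union\<close>.\<close>
    have step: "K ((\<Prod>i<j. \<xi> i (R {i} m)) *\<^sub>C \<sigma> (R {..<j} m) v) =
        (\<Prod>i<j. \<xi> (?t i) (R {?t i} (?\<phi> m))) *\<^sub>C \<sigma> (?\<phi> (R {..<j} m)) (K v)"
      if "j \<le> k" "m \<in> M" for j m v
      using that
    proof (induction j arbitrary: v)
      case 0
      then show ?case using gN(2) by (simp add: R_empty \<sigma>_one)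
    next
      case (Suc j)
      then have j: "j < k" by simp
      have Rj: "R {..<j} m \<in> M" using R_closed[of "{..<j}" m] Suc.prems by auto
      have RS: "R {..<Suc j} m = R {..<j} m \<otimes> R {j} m"
        using R_union[of "{..<j}" "{j}" m] Suc.prems by (auto simp: lessThan_Suc)
      have "(\<Prod>i<Suc j. \<xi> i (R {i} m)) *\<^sub>C \<sigma> (R {..<Suc j} m) v =
          (\<Prod>i<j. \<xi> i (R {i} m)) *\<^sub>C \<sigma> (R {..<j} m) (\<beta> j m v)"
        using Rj R[OF j Suc.prems(2)] by (simp add: RS \<sigma>_mult \<beta>_def lin_scale[OF \<sigma>_lin])
      then have "K ((\<Prod>i<Suc j. \<xi> i (R {i} m)) *\<^sub>C \<sigma> (R {..<Suc j} m) v) =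
          (\<Prod>i<j. \<xi> (?t i) (R {?t i} (?\<phi> m))) *\<^sub>C \<sigma> (?\<phi> (R {..<j} m)) (\<beta>' j m (K v))"
        using Suc K(3)[OF j Suc.prems(2)] by simp
      also have "\<dots> = (\<Prod>i<Suc j. \<xi> (?t i) (R {?t i} (?\<phi> m))) *\<^sub>C
          \<sigma> (?\<phi> (R {..<j} m)) (\<sigma> (?\<phi> (R {j} m)) (K v))"
        using conj_closed[OF gN(1) Rj]
        by (simp add: \<beta>'_def \<beta>_def lin_scale[OF \<sigma>_lin] R_t[OF j Suc.prems(2)])
      also have "\<sigma> (?\<phi> (R {..<j} m)) (\<sigma> (?\<phi> (R {j} m)) (K v)) = \<sigma> (?\<phi> (R {..<Suc j} m)) (K v)"
        using Rj R[OF j Suc.prems(2)] gN(1) by (simp add: RS conj_mult \<sigma>_mult conj_closed)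
      finally show ?case .
    qed
    have "K (\<eta> m *\<^sub>C \<sigma> m v) = \<eta> (?\<phi> m) *\<^sub>C \<sigma> (?\<phi> m) (K v)" if m: "m \<in> M" for m v
    proof -
      have "(\<Prod>i<k. \<xi> (?t i) (R {?t i} (?\<phi> m))) = \<eta> (?\<phi> m)"
        unfolding \<eta>_def by (rule prod.reindex_bij_betw[OF \<tau>_bij[OF N_inv[OF gN(1)]]])
      then show ?thesis using step[OF le_refl m, of v] m by (simp add: \<eta>_def R_all)
    qed
    then show ?thesis using K by blast
  qed
  then show ?thesis using \<eta> by blast
qed

end

section \<open>Matrices cut along sets of indices, and the block-diagonal subgroup\<close>

section \<open>Block matrices\<close>


definition dmat :: "nat \<Rightarrow> (nat \<Rightarrow> 'f) \<Rightarrow> 'f::field mat" where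
  "dmat n f = mat n n (\<lambda>(x, y). if x = y then f x else 0)"

text \<open>The identity is kept outside C so that cutting is multiplicative on matrices split along
  C, and such a matrix is the product of its cuts along C and along the complement.\<close>

definition cut_mat :: "nat \<Rightarrow> nat set \<Rightarrow> 'f::field mat \<Rightarrow> 'f mat" where
  "cut_mat n C A = mat n n (\<lambda>(x, y). if x \<in> C \<and> y \<in> C then A $$ (x, y) else if x = y then 1 else 0)"

definition split_along :: "nat \<Rightarrow> nat set \<Rightarrow> 'f::field mat \<Rightarrow> bool" where
  "split_along n C A \<longleftrightarrow> (\<forall>x<n. \<forall>y<n. (x \<in> C) \<noteq> (y \<in> C) \<longrightarrow> A $$ (x, y) = 0)"

lemma mat_mult_index:
  assumes "A \<in> carrier_mat n n" "B \<in> carrier_mat n n" "x < n" "y < n"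
  shows "(A * B) $$ (x, y) = (\<Sum>z<n. A $$ (x, z) * B $$ (z, y))"
  using assms by (auto simp: scalar_prod_def atLeast0LessThan intro!: sum.cong)

text \<open>Entries of products are expanded through \<open>mat_mult_index\<close>, as sums over z <
  n, instead of scalar products of rows and columns.\<close>

declare index_mult_mat(1) [simp del]

lemma mult_carrier_square [simp]:
  "A \<in> carrier_mat n n \<Longrightarrow> B \<in> carrier_mat n n \<Longrightarrow> A * B \<in> carrier_mat n n"
  by (rule mult_carrier_mat)

lemma mat_eqI:
  assumes "A \<in> carrier_mat n n" "B \<in> carrier_mat n n"
    "\<And>x y. x < n \<Longrightarrow> y < n \<Longrightarrow> A $$ (x, y) = B $$ (x, y)"
  shows "A = B"
  using assms by (intro eq_matI) auto

lemma mat_mult_index_zero: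
  assumes "A \<in> carrier_mat n n" "B \<in> carrier_mat n n" "x < n" "y < n"
    "\<And>z. z < n \<Longrightarrow> A $$ (x, z) * B $$ (z, y) = 0"
  shows "(A * B) $$ (x, y) = 0"
  unfolding mat_mult_index[OF assms(1-4)] by (rule sum.neutral) (use assms(5) in auto)

lemma dmat_carrier [simp]: "dmat n f \<in> carrier_mat n n"
  and dmat_index [simp]: "x < n \<Longrightarrow> y < n \<Longrightarrow> dmat n f $$ (x, y) = (if x = y then f x else 0)"
  and dmat_dim [simp]: "dim_row (dmat n f) = n" "dim_col (dmat n f) = n"
  by (simp_all add: dmat_def)

lemma cut_carrier [simp]: "cut_mat n C A \<in> carrier_mat n n"
  and cut_index [simp]: "x < n \<Longrightarrow> y < n \<Longrightarrow>
    cut_mat n C A $$ (x, y) = (if x \<in> C \<and> y \<in> C then A $$ (x, y) else if x = y then 1 else 0)"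
  and cut_dim [simp]: "dim_row (cut_mat n C A) = n" "dim_col (cut_mat n C A) = n"
  by (simp_all add: cut_mat_def)

lemma dmat_mult_index:
  assumes "A \<in> carrier_mat n n" "x < n" "y < n"
  shows "(dmat n f * A) $$ (x, y) = f x * A $$ (x, y)" "(A * dmat n f) $$ (x, y) = A $$ (x, y) * f y"
  using assms by (simp_all add: mat_mult_index[where n = n] if_distrib if_distribR cong: if_cong)

lemma dmat_mult: "dmat n f * dmat n g = dmat n (\<lambda>x. f x * g x)"
  by (rule mat_eqI[of _ n]) (auto simp: dmat_mult_index)

lemma dmat_one: "dmat n (\<lambda>_. 1) = 1\<^sub>m n"
  by (rule mat_eqI[of _ n]) auto

lemma det_dmat: "det (dmat n f) = (\<Prod>x<n. f x)"
proof -
  have "det (dmat n f) = prod_list (diag_mat (dmat n f))"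
    by (rule det_upper_triangular[of _ n]) (auto simp: upper_triangular_def)
  also have "diag_mat (dmat n f) = map f [0..<n]"
    by (auto simp: diag_mat_def dmat_def)
  finally show ?thesis
    by (simp add: prod.distinct_set_conv_list[symmetric] atLeast0LessThan)
qed

lemma cut_mult:
  assumes A: "A \<in> carrier_mat n n" "split_along n C A" and B: "B \<in> carrier_mat n n" "split_along n C B"
  shows "cut_mat n C (A * B) = cut_mat n C A * cut_mat n C B"
proof (rule mat_eqI[of _ n])
  fix x y assume xy: "x < n" "y < n"
  have "(cut_mat n C A * cut_mat n C B) $$ (x, y) = (\<Sum>z<n. cut_mat n C A $$ (x, z) * cut_mat n C B $$ (z, y))"
    by (rule mat_mult_index) (use xy in auto)
  also have "\<dots> = cut_mat n C (A * B) $$ (x, y)"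
  proof (cases "x \<in> C")
    case True
    show ?thesis
    proof (cases "y \<in> C")
      case y: True
      have "(\<Sum>z<n. cut_mat n C A $$ (x, z) * cut_mat n C B $$ (z, y)) = (\<Sum>z<n. A $$ (x, z) * B $$ (z, y))"
        by (rule sum.cong) (use A(2) True y xy in \<open>auto simp: split_along_def\<close>)
      then show ?thesis using True y xy A(1) B(1) by (simp add: mat_mult_index[where n = n])
    next
      case y: False
      have "(\<Sum>z<n. cut_mat n C A $$ (x, z) * cut_mat n C B $$ (z, y)) = 0"
        by (rule sum.neutral) (use True y xy in auto)
      then show ?thesis using True y xy by auto
    qed
  next
    case False
    have "(\<Sum>z<n. cut_mat n C A $$ (x, z) * cut_mat n C B $$ (z, y)) = (\<Sum>z<n. if z = x then cut_mat n C B $$ (x, y) else 0)"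
      by (rule sum.cong) (use False xy in auto)
    then show ?thesis using False xy by simp
  qed
  finally show "cut_mat n C (A * B) $$ (x, y) = (cut_mat n C A * cut_mat n C B) $$ (x, y)" by simp
qed (use A B in auto)

text \<open>For disjoint C and D the entries do not depend on the order of the factors, so both the
  commutation of the cuts and the formula for a union can be read off.\<close>

lemma cut_disjoint_index:
  assumes "C \<inter> D = {}" "x < n" "y < n"
  shows "(cut_mat n C A * cut_mat n D B) $$ (x, y) = (if x \<in> C \<and> y \<in> C then A $$ (x, y)
    else if x \<in> D \<and> y \<in> D then B $$ (x, y) else if x = y then 1 else 0)"
proof -
  have "(cut_mat n C A * cut_mat n D B) $$ (x, y) = (\<Sum>z<n. cut_mat n C A $$ (x, z) * cut_mat n D B $$ (z, y))"
    by (rule mat_mult_index) (use assms in auto)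
  also have "\<dots> = (if x \<in> C \<and> y \<in> C then A $$ (x, y)
    else if x \<in> D \<and> y \<in> D then B $$ (x, y) else if x = y then 1 else 0)"
  proof (cases "x \<in> C")
    case True
    have "(\<Sum>z<n. cut_mat n C A $$ (x, z) * cut_mat n D B $$ (z, y))
        = (\<Sum>z<n. if z = y then cut_mat n C A $$ (x, y) else 0)"
      by (rule sum.cong) (use True assms in auto)
    then show ?thesis using True assms by auto
  next
    case False
    have "(\<Sum>z<n. cut_mat n C A $$ (x, z) * cut_mat n D B $$ (z, y))
        = (\<Sum>z<n. if z = x then cut_mat n D B $$ (x, y) else 0)"
      by (rule sum.cong) (use False assms in auto)
    then show ?thesis using False assms by auto
  qed
  finally show ?thesis .
qed

lemma cut_disjoint_commute:
  assumes "C \<inter> D = {}" shows "cut_mat n C A * cut_mat n D B = cut_mat n D B * cut_mat n C A"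
  by (rule mat_eqI[of _ n])
    (use assms in \<open>auto simp: cut_disjoint_index Int_commute\<close>)

lemma cut_union:
  assumes "C \<inter> D = {}" "split_along n C A" "split_along n D A"
  shows "cut_mat n (C \<union> D) A = cut_mat n C A * cut_mat n D A"
  by (rule mat_eqI[of _ n])
    (use assms in \<open>auto simp: cut_disjoint_index split_along_def\<close>)

lemma cut_empty: "cut_mat n {} A = 1\<^sub>m n"
  by (rule mat_eqI[of _ n]) auto

lemma cut_all: "A \<in> carrier_mat n n \<Longrightarrow> {..<n} \<subseteq> C \<Longrightarrow> cut_mat n C A = A"
  by (rule mat_eqI[of _ n]) auto

lemma SL_simps: "carrier (SL n) = {A \<in> carrier_mat n n. det A = 1}"
  "A \<otimes>\<^bsub>SL n\<^esub> B = A * B" "\<one>\<^bsub>SL n\<^esub> = 1\<^sub>m n"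
  by (simp_all add: SL_def)

lemma SL_inv:
  assumes "g \<in> carrier (SL n)"
  shows "inv\<^bsub>SL n\<^esub> g \<in> carrier_mat n n" "det (inv\<^bsub>SL n\<^esub> g) = 1"
    "inv\<^bsub>SL n\<^esub> g * g = 1\<^sub>m n" "g * inv\<^bsub>SL n\<^esub> g = 1\<^sub>m n"
  using group.inv_closed[OF group_SL assms] group.l_inv[OF group_SL assms]
    group.r_inv[OF group_SL assms] by (simp_all add: SL_simps)

text \<open>A block is a fibre of \<open>blk\<close> on the indices below n, so that conditions on
  the support of a matrix become comparisons of labels; surjectivity excludes empty blocks.\<close>

locale block_structure =
  fixes n k :: nat and blk :: "nat \<Rightarrow> nat" and ty :: "'f::field_char_0 itself"
  assumes blk_less: "x < n \<Longrightarrow> blk x < k"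
    and blk_surj: "i < k \<Longrightarrow> \<exists>x<n. blk x = i"
begin

definition bd :: "'f mat \<Rightarrow> bool" where
  "bd A \<longleftrightarrow> (\<forall>x<n. \<forall>y<n. blk x \<noteq> blk y \<longrightarrow> A $$ (x, y) = 0)"

definition M :: "'f mat set" where
  "M = {A \<in> carrier (SL n). bd A}"

abbreviation part :: "nat set \<Rightarrow> nat set" where "part S \<equiv> {x. blk x \<in> S}"

lemma M_carrier: "A \<in> M \<Longrightarrow> A \<in> carrier_mat n n" "A \<in> M \<Longrightarrow> det A = 1" "A \<in> M \<Longrightarrow> bd A"
    "A \<in> M \<Longrightarrow> A \<in> carrier (SL n)"
  by (auto simp: M_def SL_simps)

lemma MI: "A \<in> carrier_mat n n \<Longrightarrow> det A = 1 \<Longrightarrow> bd A \<Longrightarrow> A \<in> M"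
  by (auto simp: M_def SL_simps)

lemma bd_split: "bd A \<Longrightarrow> split_along n (part S) A"
  unfolding bd_def split_along_def by (metis mem_Collect_eq)

lemma bd_cut: "bd A \<Longrightarrow> bd (cut_mat n C A)"
  by (auto simp: bd_def)

lemma bd_mult:
  assumes "A \<in> carrier_mat n n" "B \<in> carrier_mat n n" "bd A" "bd B" shows "bd (A * B)"
  unfolding bd_def
proof (intro allI impI)
  fix x y assume *: "x < n" "y < n" "blk x \<noteq> blk y"
  have "A $$ (x, z) * B $$ (z, y) = 0" if "z < n" for z
    using assms(3,4) * that unfolding bd_def by (cases "blk z = blk x") auto
  then show "(A * B) $$ (x, y) = 0"
    using assms(1,2) * by (intro mat_mult_index_zero[of _ n])
qed

lemma dmat_block_commute:
  assumes "A \<in> carrier_mat n n" "bd A"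
  shows "A * dmat n (\<lambda>x. f (blk x)) = dmat n (\<lambda>x. f (blk x)) * A"
proof (rule mat_eqI[of _ n])
  fix x y assume "x < n" "y < n"
  then show "(A * dmat n (\<lambda>x. f (blk x))) $$ (x, y) = (dmat n (\<lambda>x. f (blk x)) * A) $$ (x, y)"
    using assms by (cases "blk x = blk y") (auto simp: dmat_mult_index bd_def)
qed (use assms in auto)

text \<open>Describing the block-diagonal matrices as a centraliser makes closure under inverses immediate.\<close>

lemma bd_iff_commute:
  fixes f :: "nat \<Rightarrow> 'f"
  assumes "A \<in> carrier_mat n n" "inj_on f {..<k}"
  shows "bd A \<longleftrightarrow> A * dmat n (\<lambda>x. f (blk x)) = dmat n (\<lambda>x. f (blk x)) * A"
proof
  assume "bd A"
  then show "A * dmat n (\<lambda>x. f (blk x)) = dmat n (\<lambda>x. f (blk x)) * A"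
    by (rule dmat_block_commute[OF assms(1)])
next
  assume eq: "A * dmat n (\<lambda>x. f (blk x)) = dmat n (\<lambda>x. f (blk x)) * A"
  show "bd A" unfolding bd_def
  proof (intro allI impI)
    fix x y assume *: "x < n" "y < n" "blk x \<noteq> blk y"
    have "f (blk x) \<noteq> f (blk y)" using assms(2) blk_less * by (auto simp: inj_on_def)
    moreover have "A $$ (x, y) * f (blk y) = f (blk x) * A $$ (x, y)"
      using arg_cong[OF eq, of "\<lambda>B. B $$ (x, y)"] assms(1) *
      by (simp add: dmat_mult_index)
    ultimately show "A $$ (x, y) = 0" by (simp add: mult.commute)
  qed
qed

lemma M_subgroup: "subgroup M (SL n)"
proof (rule group.subgroupI[OF group_SL])
  show "M \<subseteq> carrier (SL n)" by (auto simp: M_def)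
  have "1\<^sub>m n \<in> M" by (rule MI) (auto simp: bd_def)
  then show "M \<noteq> {}" by blast
  fix A assume A: "A \<in> M"
  note A' = M_carrier[OF A] and I = SL_inv[OF M_carrier(4)[OF A]]
  define D where "D = dmat n (\<lambda>x. of_nat (blk x) :: 'f)"
  have inj: "inj_on (of_nat :: nat \<Rightarrow> 'f) {..<k}" by (simp add: inj_on_def)
  have D: "D \<in> carrier_mat n n" by (simp add: D_def)
  have AD: "A * D = D * A" using bd_iff_commute[OF A'(1) inj] A'(3) by (simp add: D_def)
  let ?B = "inv\<^bsub>SL n\<^esub> A"
  have "?B * D = ?B * D * (A * ?B)" using I D by simp
  also have "\<dots> = ?B * (D * A) * ?B" using I(1) D A'(1) by (simp add: assoc_mult_mat[where ?n\<^sub>2.0 = n and ?n\<^sub>3.0 = n and ?n\<^sub>4.0 = n])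
  also have "\<dots> = (?B * A) * D * ?B" unfolding AD[symmetric] using I(1) D A'(1) by (simp add: assoc_mult_mat[where ?n\<^sub>2.0 = n and ?n\<^sub>3.0 = n and ?n\<^sub>4.0 = n])
  also have "\<dots> = D * ?B" using I D by simp
  finally show "?B \<in> M"
    using bd_iff_commute[OF I(1) inj] I(1,2) by (intro MI) (simp_all add: D_def)
  fix B assume B: "B \<in> M"
  show "A \<otimes>\<^bsub>SL n\<^esub> B \<in> M"
    using A' M_carrier[OF B] by (intro MI) (simp_all add: SL_simps det_mult[of _ n] bd_mult)
qed

text \<open>Powers of 2 are distinct in characteristic zero and so can tell the blocks apart.
  Subtracting c, the sum of the labels of all indices, from n times the label makes the exponents
  sum to 0 and the determinant 1.\<close>

lemma exists_separating:
  obtains f :: "nat \<Rightarrow> 'f" where "inj_on f {..<k}" "dmat n (\<lambda>x. f (blk x)) \<in> M"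
proof -
  define c where "c = (\<Sum>x<n. int (blk x))"
  define f where "f = (\<lambda>i. (2 :: 'f) powi (int n * int i - c))"
  have two: "(2 :: 'f) powi a = 2 powi b \<longleftrightarrow> a = b" for a b
  proof
    have *: "a = b" if eq: "(2 :: 'f) powi a = 2 powi b" and "a \<le> b" for a b :: int
    proof -
      have "(2 :: 'f) powi (b - a) = 1" using eq by (simp add: power_int_diff)
      moreover have "b - a = int (nat (b - a))" using \<open>a \<le> b\<close> by simp
      ultimately have "(2 :: 'f) ^ nat (b - a) = 1" by (metis power_int_of_nat)
      then have "(of_nat (2 ^ nat (b - a)) :: 'f) = of_nat 1" by simp
      then have "(2 :: nat) ^ nat (b - a) = 1" by (simp only: of_nat_eq_iff)
      then have "nat (b - a) = 0" by simp
      then show ?thesis using \<open>a \<le> b\<close> by simp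
    qed
    assume "(2 :: 'f) powi a = 2 powi b"
    then show "a = b" using *[of a b] *[of b a] by (metis linear)
  qed simp
  have "inj_on f {..<k}"
  proof (rule inj_onI)
    fix i j assume "i \<in> {..<k}" "j \<in> {..<k}" and eq: "f i = f j"
    then obtain x where "x < n" using blk_surj by blast
    then show "i = j" using eq by (simp add: f_def two)
  qed
  moreover have "dmat n (\<lambda>x. f (blk x)) \<in> M"
  proof (rule MI)
    have prod_powi: "(\<Prod>x\<in>A. (2 :: 'f) powi g x) = 2 powi (\<Sum>x\<in>A. g x)" if "finite A" for A and g :: "nat \<Rightarrow> int"
      using that by (induction A) (simp_all add: power_int_add)
    have "(\<Sum>x<n. int n * int (blk x) - c) = 0"
      by (simp add: sum_subtractf sum_distrib_left[symmetric] c_def)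
    then show "det (dmat n (\<lambda>x. f (blk x))) = 1" by (simp add: det_dmat f_def prod_powi)
  qed (auto simp: bd_def)
  ultimately show ?thesis using that by blast
qed

lemma transvection_mem:
  assumes "x < n" "y < n" "x \<noteq> y" "blk x = blk y"
  shows "mat n n (\<lambda>(p, q). if p = q then 1 else if p = x \<and> q = y then 1 else 0) \<in> M" (is "?E \<in> M")
proof (rule MI)
  have "?E = addrow_mat n 1 x y"
    using assms by (intro eq_matI) (auto simp: addrow_mat_def)
  then show "det ?E = 1" using det_addrow_mat[OF assms(3)] by metis
qed (use assms in \<open>auto simp: bd_def\<close>)

text \<open>Commutation with a separating diagonal matrix makes X block-diagonal; commutation with
  the transvections inside a block makes it scalar there.\<close>

lemma M_commutant:
  assumes X: "X \<in> carrier_mat n n" and comm: "\<And>m. m \<in> M \<Longrightarrow> X * m = m * X"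
  obtains f where "X = dmat n (\<lambda>x. f (blk x))"
proof -
  obtain f0 :: "nat \<Rightarrow> 'f" where f0: "inj_on f0 {..<k}" "dmat n (\<lambda>x. f0 (blk x)) \<in> M"
    by (rule exists_separating)
  have bdX: "bd X" using bd_iff_commute[OF X f0(1)] comm[OF f0(2)] by simp
  have *: "X $$ (x, x) = X $$ (y, y) \<and> (\<forall>p<n. p \<noteq> x \<longrightarrow> X $$ (p, x) = 0)"
    if xy: "x < n" "y < n" "x \<noteq> y" "blk x = blk y" for x y
  proof -
    define E :: "'f mat" where "E = mat n n (\<lambda>(p, q). if p = q then 1 else if p = x \<and> q = y then 1 else 0)"
    have E: "E \<in> carrier_mat n n" "X * E = E * X"
      using comm[OF transvection_mem[OF xy]] by (simp_all add: E_def)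
    have L: "(X * E) $$ (p, y) = X $$ (p, y) + X $$ (p, x)" if "p < n" for p
    proof -
      have "(X * E) $$ (p, y) = (\<Sum>z<n. X $$ (p, z) * E $$ (z, y))"
        using X E(1) that xy by (intro mat_mult_index) auto
      also have "\<dots> = (\<Sum>z<n. (if z = y then X $$ (p, y) else 0) + (if z = x then X $$ (p, x) else 0))"
        by (rule sum.cong) (use xy that in \<open>auto simp: E_def\<close>)
      finally show ?thesis using xy by (simp add: sum.distrib)
    qed
    have R: "(E * X) $$ (p, y) = X $$ (p, y) + (if p = x then X $$ (y, y) else 0)" if "p < n" for p
    proof -
      have "(E * X) $$ (p, y) = (\<Sum>z<n. E $$ (p, z) * X $$ (z, y))"
        using X E(1) that xy by (intro mat_mult_index) auto
      also have "\<dots> = (\<Sum>z<n. (if z = p then X $$ (p, y) else 0) + (if z = y then if p = x then X $$ (y, y) else 0 else 0))"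
        by (rule sum.cong) (use xy that in \<open>auto simp: E_def\<close>)
      finally show ?thesis using xy that by (simp add: sum.distrib)
    qed
    have "X $$ (p, x) = (if p = x then X $$ (y, y) else 0)" if "p < n" for p
      using L[OF that] R[OF that] E(2) by simp
    then show ?thesis using xy by auto
  qed
  define f where "f = (\<lambda>i. X $$ (SOME x. x < n \<and> blk x = i, SOME x. x < n \<and> blk x = i))"
  have "X = dmat n (\<lambda>x. f (blk x))"
  proof (rule mat_eqI[OF X dmat_carrier])
    fix x y assume xy: "x < n" "y < n"
    show "X $$ (x, y) = dmat n (\<lambda>x. f (blk x)) $$ (x, y)"
    proof (cases "x = y")
      case True
      define z where "z = (SOME z. z < n \<and> blk z = blk x)"
      have "z < n \<and> blk z = blk x" unfolding z_def by (rule someI[of _ x]) (use xy in auto)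
      then have "X $$ (z, z) = X $$ (x, x)" using *[of z x] xy by (cases "z = x") auto
      then show ?thesis using True xy by (simp add: f_def z_def)
    next
      case False
      have "X $$ (x, y) = 0"
      proof (cases "blk x = blk y")
        case True
        then show ?thesis using *[of y x] xy False by auto
      next
        case False
        then show ?thesis using bdX xy by (auto simp: bd_def)
      qed
      then show ?thesis using False xy by simp
    qed
  qed
  then show ?thesis by (rule that)
qed

end

lemma (in group) normalizerD:
  assumes "subgroup H G" "g \<in> normalizer G H"
  shows "g \<in> carrier G" "h \<in> H \<Longrightarrow> inv g \<otimes> h \<otimes> g \<in> H"
proof -
  have gG: "g \<in> carrier G" and gH: "g <# H #> inv g = H"
    using assms(2) subgroup.subset[OF assms(1)] by (auto simp: normalizer_def stabilizer_def)
  show "g \<in> carrier G" by (rule gG)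
  show "inv g \<otimes> h \<otimes> g \<in> H" if h: "h \<in> H"
  proof -
    from h gH obtain y where y: "y \<in> H" "h = g \<otimes> y \<otimes> inv g"
      by (auto simp: l_coset_def r_coset_def)
    then have "inv g \<otimes> h \<otimes> g = y"
      using gG subgroup.subset[OF assms(1)] by (auto simp: m_assoc inv_solve_left')
    with y show ?thesis by simp
  qed
qed

lemma assoc_square:
  assumes "A \<in> carrier_mat n n" "B \<in> carrier_mat n n" "C \<in> carrier_mat n n"
  shows "A * B * C = A * (B * C)"
  using assms by (rule assoc_mult_mat)

lemma det_mult_square:
  "A \<in> carrier_mat n n \<Longrightarrow> B \<in> carrier_mat n n \<Longrightarrow> det (A * B) = det A * det (B :: 'a::field mat)"
  by (rule det_mult)

lemma mat_mult_index_nonzero: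
  assumes "A \<in> carrier_mat n n" "B \<in> carrier_mat n n" "x < n" "y < n" "(A * B) $$ (x, y) \<noteq> 0"
  obtains z where "z < n" "A $$ (x, z) \<noteq> 0" "B $$ (z, y) \<noteq> 0"
  using mat_mult_index_zero[OF assms(1-4)] assms(5) by fastforce

section \<open>The permutation of the blocks by the normaliser\<close>

context block_structure begin

lemma normalizer_mem:
  assumes "g \<in> normalizer (SL n) M"
  shows "g \<in> carrier (SL n)" "g \<in> carrier_mat n n" "det g = 1"
    "m \<in> M \<Longrightarrow> inv\<^bsub>SL n\<^esub> g * m * g \<in> M"
  using group.normalizerD[OF group_SL M_subgroup assms] by (simp_all add: SL_simps)

lemma SL_row_nonzero:
  fixes g :: "'f mat"
  assumes "g \<in> carrier (SL n)" "x < n"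
  obtains y where "y < n" "g $$ (x, y) \<noteq> 0"
proof -
  have "(g * inv\<^bsub>SL n\<^esub> g) $$ (x, x) \<noteq> 0" using SL_inv(4)[OF assms(1)] assms(2) by simp
  then show ?thesis
    using mat_mult_index_nonzero[of g n "inv\<^bsub>SL n\<^esub> g" x x] SL_inv(1)[OF assms(1)] assms that
    by (auto simp: SL_simps)
qed

lemma SL_col_nonzero:
  fixes g :: "'f mat"
  assumes "g \<in> carrier (SL n)" "y < n"
  obtains x where "x < n" "g $$ (x, y) \<noteq> 0"
proof -
  have "(inv\<^bsub>SL n\<^esub> g * g) $$ (y, y) \<noteq> 0" using SL_inv(3)[OF assms(1)] assms(2) by simp
  then show ?thesis
    using mat_mult_index_nonzero[of "inv\<^bsub>SL n\<^esub> g" n g y y] SL_inv(1)[OF assms(1)] assms that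
    by (auto simp: SL_simps)
qed

text \<open>An element of the normaliser acts on the commutant of \<open>M\<close>, the block-scalar matrices; applied
  to the projections onto single blocks this shows that it permutes the blocks.\<close>

lemma normalizer_permutes_blocks:
  assumes g: "g \<in> normalizer (SL n) M"
  shows "\<exists>t. bij_betw t {..<k} {..<k} \<and>
    (\<forall>x<n. \<forall>y<n. g $$ (x, y) \<noteq> 0 \<longrightarrow> blk x = t (blk y))"
proof -
  note gg = normalizer_mem[OF g] and gi = SL_inv[OF normalizer_mem(1)[OF g]]
  define h where "h = inv\<^bsub>SL n\<^esub> g"
  have h: "h \<in> carrier_mat n n" "h * g = 1\<^sub>m n" "g * h = 1\<^sub>m n" using gi by (simp_all add: h_def)
  have f_ex: "\<exists>f. \<forall>x<n. \<forall>y<n. g $$ (x, y) \<noteq> 0 \<longrightarrow> f (blk x) = (if blk y = j then 1 else (0::'f))" for j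
  proof -
    define P where "P = dmat n (\<lambda>x. if blk x = j then 1 else (0::'f))"
    have P: "P \<in> carrier_mat n n" by (simp add: P_def)
    \<comment> \<open>P is block-scalar, so it commutes with h * m * g, which is again in M;
      conjugating back by g gives the claim.\<close>
    have "(g * P * h) * m = m * (g * P * h)" if m: "m \<in> M" for m
    proof -
      note mm = M_carrier[OF m]
      have hmg: "h * m * g \<in> M" using gg(4)[OF m] by (simp add: h_def)
      have "P * (h * m * g) = (h * m * g) * P"
        unfolding P_def
        using dmat_block_commute[OF M_carrier(1,3)[OF hmg], of "\<lambda>i. if i = j then 1 else 0"] by simp
      then have eq: "g * (P * (h * m * g)) * h = g * ((h * m * g) * P) * h" by simp
      have "(g * P * h) * m * (g * h) = g * (P * (h * m * g)) * h"
        using gg(2) P h(1) mm(1) by (simp add: assoc_square[of _ n])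
      moreover have "g * ((h * m * g) * P) * h = (g * h) * (m * (g * P * h))"
        using gg(2) P h(1) mm(1) by (simp add: assoc_square[of _ n])
      ultimately show ?thesis using eq gg(2) P h mm(1) by simp
    qed
    then obtain f where f: "g * P * h = dmat n (\<lambda>x. f (blk x))"
      using M_commutant[of "g * P * h"] gg(2) P h(1) by auto
    have "dmat n (\<lambda>x. f (blk x)) * g = g * P * (h * g)"
      unfolding f[symmetric] using gg(2) P h(1) by (simp add: assoc_square[of _ n])
    then have gP: "dmat n (\<lambda>x. f (blk x)) * g = g * P" using gg(2) P h(2) by simp
    show ?thesis
    proof (intro exI[of _ f] allI impI)
      fix x y assume xy: "x < n" "y < n" "g $$ (x, y) \<noteq> 0"
      have "f (blk x) * g $$ (x, y) = g $$ (x, y) * (if blk y = j then 1 else 0)"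
        using arg_cong[OF gP, of "\<lambda>A. A $$ (x, y)"] gg(2) xy(1,2)
        by (simp add: dmat_mult_index P_def)
      then show "f (blk x) = (if blk y = j then 1 else 0)" using xy(3) by (simp split: if_splits)
    qed
  qed
  have uniq: "blk y = blk y'"
    if "x < n" "y < n" "g $$ (x, y) \<noteq> 0" "x' < n" "y' < n" "g $$ (x', y') \<noteq> 0" "blk x = blk x'"
    for x y x' y'
  proof -
    obtain f where f: "\<forall>x<n. \<forall>z<n. g $$ (x, z) \<noteq> 0 \<longrightarrow> f (blk x) = (if blk z = blk y then 1 else (0::'f))"
      using f_ex[of "blk y"] by blast
    have "f (blk x) = 1" using f[rule_format, OF that(1-3)] by simp
    then show ?thesis using f[rule_format, OF that(4-6)] that(7) by (simp split: if_splits)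
  qed
  \<comment> \<open>s takes the block of a row to the block of the columns in which g is nonzero
    there; it is well defined by \<open>uniq\<close>, and onto because g has no zero column. The
    required permutation is its inverse.\<close>
  define s where "s = (\<lambda>i. SOME j. \<exists>x<n. \<exists>y<n. g $$ (x, y) \<noteq> 0 \<and> blk x = i \<and> blk y = j)"
  have s: "s (blk x) = blk y" if "x < n" "y < n" "g $$ (x, y) \<noteq> 0" for x y
  proof -
    have "\<exists>x'<n. \<exists>y'<n. g $$ (x', y') \<noteq> 0 \<and> blk x' = blk x \<and> blk y' = s (blk x)"
      unfolding s_def by (rule someI[of _ "blk y"]) (use that in blast)
    then obtain x' y' where "x' < n" "y' < n" "g $$ (x', y') \<noteq> 0" "blk x' = blk x" "blk y' = s (blk x)"
      by blast
    then show ?thesis using uniq[OF \<open>x' < n\<close> \<open>y' < n\<close> _ that] by simp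
  qed
  have "{..<k} \<subseteq> s ` {..<k}"
  proof
    fix j assume "j \<in> {..<k}"
    then obtain y where y: "y < n" "blk y = j" using blk_surj by blast
    obtain x where "x < n" "g $$ (x, y) \<noteq> 0" using SL_col_nonzero[OF gg(1) y(1)] .
    then show "j \<in> s ` {..<k}" using s[of x y] y blk_less by force
  qed
  moreover have "s ` {..<k} \<subseteq> {..<k}"
  proof
    fix j assume "j \<in> s ` {..<k}"
    then obtain x where x: "x < n" "j = s (blk x)" using blk_surj by blast
    obtain y where "y < n" "g $$ (x, y) \<noteq> 0" using SL_row_nonzero[OF gg(1) x(1)] .
    then show "j \<in> {..<k}" using s[of x y] x blk_less by force
  qed
  ultimately have "s ` {..<k} = {..<k}" by blast
  then have bij: "bij_betw s {..<k} {..<k}"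
    by (simp add: bij_betw_def finite_surj_inj)
  show ?thesis
  proof (intro exI[of _ "inv_into {..<k} s"] conjI allI impI)
    show "bij_betw (inv_into {..<k} s) {..<k} {..<k}" by (rule bij_betw_inv_into[OF bij])
    fix x y assume "x < n" "y < n" "g $$ (x, y) \<noteq> 0"
    then show "blk x = inv_into {..<k} s (blk y)"
      using s bij blk_less by (metis bij_betw_def inv_into_f_f lessThan_iff)
  qed
qed

definition perm :: "'f mat \<Rightarrow> nat \<Rightarrow> nat" where
  "perm g = (SOME t. bij_betw t {..<k} {..<k} \<and>
     (\<forall>x<n. \<forall>y<n. g $$ (x, y) \<noteq> 0 \<longrightarrow> blk x = t (blk y)))"

lemma perm:
  assumes "g \<in> normalizer (SL n) M"
  shows "bij_betw (perm g) {..<k} {..<k}"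
    "x < n \<Longrightarrow> y < n \<Longrightarrow> g $$ (x, y) \<noteq> 0 \<Longrightarrow> blk x = perm g (blk y)"
proof -
  have *: "bij_betw (perm g) {..<k} {..<k} \<and>
     (\<forall>x<n. \<forall>y<n. g $$ (x, y) \<noteq> 0 \<longrightarrow> blk x = perm g (blk y))"
    using someI_ex[OF normalizer_permutes_blocks[OF assms]] unfolding perm_def .
  show "bij_betw (perm g) {..<k} {..<k}" using * by (rule conjunct1)
  show "x < n \<Longrightarrow> y < n \<Longrightarrow> g $$ (x, y) \<noteq> 0 \<Longrightarrow> blk x = perm g (blk y)"
    using * by blast
qed

lemma normalizer_subgroup: "subgroup (normalizer (SL n) M) (SL n)"
  using group.normalizer_imp_subgroup[OF group_SL] M_subgroup subgroup.subset by blast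

text \<open>A nonzero entry of g * h passes through an index z at which both factors are nonzero,
  and the labels can be followed along it.\<close>

lemma perm_mult:
  assumes g: "g \<in> normalizer (SL n) M" and h: "h \<in> normalizer (SL n) M" and i: "i < k"
  shows "perm (g * h) i = perm g (perm h i)"
proof -
  have gh: "g * h \<in> normalizer (SL n) M"
    using subgroup.m_closed[OF normalizer_subgroup g h] by (simp add: SL_simps)
  obtain y where y: "y < n" "blk y = i" using blk_surj[OF i] by blast
  obtain x where x: "x < n" "(g * h) $$ (x, y) \<noteq> 0"
    using SL_col_nonzero[OF normalizer_mem(1)[OF gh] y(1)] .
  obtain z where z: "z < n" "g $$ (x, z) \<noteq> 0" "h $$ (z, y) \<noteq> 0"
    using mat_mult_index_nonzero[OF normalizer_mem(2)[OF g] normalizer_mem(2)[OF h] x(1) y(1) x(2)] .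
  show ?thesis using perm(2)[OF gh x(1) y(1) x(2)] perm(2)[OF g x(1) z(1,2)] perm(2)[OF h z(1) y(1) z(3)] y(2)
    by simp
qed

text \<open>The trace of h * g over block i and that of g * h over block \<open>perm g i\<close>
  involve the same products of entries, because g vanishes elsewhere in these columns and rows. Both
  matrices are the identity, and in characteristic zero the equality of traces is one of
  cardinalities.\<close>

lemma perm_block_size:
  assumes g: "g \<in> normalizer (SL n) M" and i: "i < k"
  shows "card {x. x < n \<and> blk x = perm g i} = card {x. x < n \<and> blk x = i}"
proof -
  define h where "h = inv\<^bsub>SL n\<^esub> g"
  note gi = SL_inv[OF normalizer_mem(1)[OF g], folded h_def] and gc = normalizer_mem(2)[OF g]
  let ?I = "{x. x < n \<and> blk x = i}" and ?J = "{x. x < n \<and> blk x = perm g i}"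
  have fin: "finite ?I" "finite ?J" by auto
  have inj: "perm g j = perm g i \<Longrightarrow> j < k \<Longrightarrow> j = i" for j
    using perm(1)[OF g] i by (auto simp: bij_betw_def inj_on_def)
  have "(of_nat (card ?I) :: 'f) = (\<Sum>y\<in>?I. (h * g) $$ (y, y))"
    using gi(3) by simp
  also have "\<dots> = (\<Sum>y\<in>?I. \<Sum>x<n. h $$ (y, x) * g $$ (x, y))"
    by (rule sum.cong[OF refl], rule mat_mult_index) (use gi(1) gc in simp_all)
  also have "\<dots> = (\<Sum>y\<in>?I. \<Sum>x\<in>?J. h $$ (y, x) * g $$ (x, y))"
  proof (rule sum.cong[OF refl])
    fix y assume y: "y \<in> ?I"
    have "g $$ (x, y) = 0" if "x < n" "blk x \<noteq> perm g i" for x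
      using perm(2)[OF g that(1), of y] y that(2) by fastforce
    then show "(\<Sum>x<n. h $$ (y, x) * g $$ (x, y)) = (\<Sum>x\<in>?J. h $$ (y, x) * g $$ (x, y))"
      by (intro sum.mono_neutral_right) auto
  qed
  also have "\<dots> = (\<Sum>x\<in>?J. \<Sum>y\<in>?I. h $$ (y, x) * g $$ (x, y))" by (rule sum.swap)
  also have "\<dots> = (\<Sum>x\<in>?J. \<Sum>y<n. g $$ (x, y) * h $$ (y, x))"
  proof (rule sum.cong[OF refl])
    fix x assume x: "x \<in> ?J"
    have "(\<Sum>y<n. g $$ (x, y) * h $$ (y, x)) = (\<Sum>y\<in>?I. g $$ (x, y) * h $$ (y, x))"
    proof (rule sum.mono_neutral_right)
      have "g $$ (x, y) = 0" if "y < n" "blk y \<noteq> i" for y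
      proof (rule ccontr)
        assume "g $$ (x, y) \<noteq> 0"
        then have "perm g (blk y) = perm g i" using perm(2)[OF g _ that(1), of x] x by simp
        then show False using inj blk_less that by blast
      qed
      then show "\<forall>y\<in>{..<n} - ?I. g $$ (x, y) * h $$ (y, x) = 0" by auto
    qed auto
    then show "(\<Sum>y\<in>?I. h $$ (y, x) * g $$ (x, y)) = (\<Sum>y<n. g $$ (x, y) * h $$ (y, x))"
      by (simp add: mult.commute)
  qed
  also have "\<dots> = (\<Sum>x\<in>?J. (g * h) $$ (x, x))"
    by (rule sum.cong[OF refl], rule mat_mult_index[symmetric]) (use gi(1) gc in simp_all)
  also have "\<dots> = of_nat (card ?J)" using gi(4) by simp
  finally show ?thesis by simp
qed

lemma perm_dmat_commute:
  assumes g: "g \<in> normalizer (SL n) M" and f: "\<And>i. i < k \<Longrightarrow> f (perm g i) = f' i"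
  shows "dmat n (\<lambda>x. f (blk x)) * g = g * dmat n (\<lambda>x. f' (blk x))"
proof (rule mat_eqI[of _ n])
  fix x y assume "x < n" "y < n"
  then show "(dmat n (\<lambda>x. f (blk x)) * g) $$ (x, y) = (g * dmat n (\<lambda>x. f' (blk x))) $$ (x, y)"
    using normalizer_mem(2)[OF g] perm(2)[OF g, of x y] f[of "blk y"] blk_less[of y]
    by (cases "g $$ (x, y) = 0") (auto simp: dmat_mult_index)
qed (use normalizer_mem(2)[OF g] in auto)

text \<open>Columns in block i are compared through g * m' = m * g, where m' is the conjugate of m;
  in every other column both cuts act as the identity on the support of g.\<close>

lemma cut_conj:
  assumes g: "g \<in> normalizer (SL n) M" and i: "i < k" and m: "m \<in> M"
  shows "g * cut_mat n (part {i}) (inv\<^bsub>SL n\<^esub> g * m * g) = cut_mat n (part {perm g i}) m * g"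
proof (rule mat_eqI[of _ n])
  define h where "h = inv\<^bsub>SL n\<^esub> g"
  note gi = SL_inv[OF normalizer_mem(1)[OF g], folded h_def] and gc = normalizer_mem(2)[OF g]
  note mm = M_carrier[OF m]
  define m' where "m' = h * m * g"
  have m'M: "m' \<in> M" using normalizer_mem(4)[OF g m] by (simp add: m'_def h_def)
  note mm' = M_carrier[OF m'M]
  have gm': "g * m' = m * g"
  proof -
    have "g * m' = (g * h) * (m * g)" unfolding m'_def using gc gi(1) mm(1) by (simp add: assoc_square[of _ n])
    then show ?thesis using gi(4) mm(1) gc by simp
  qed
  have inj: "perm g j = perm g i \<longleftrightarrow> j = i" if "j < k" for j
    using perm(1)[OF g] i that by (auto simp: bij_betw_def inj_on_def)
  fix x y assume xy: "x < n" "y < n"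
  have L: "(g * cut_mat n (part {i}) m') $$ (x, y) = (\<Sum>z<n. g $$ (x, z) * cut_mat n (part {i}) m' $$ (z, y))"
    by (rule mat_mult_index) (use gc xy in auto)
  have R: "(cut_mat n (part {perm g i}) m * g) $$ (x, y)
      = (\<Sum>z<n. cut_mat n (part {perm g i}) m $$ (x, z) * g $$ (z, y))"
    by (rule mat_mult_index) (use gc xy in auto)
  have "(g * cut_mat n (part {i}) m') $$ (x, y) = (cut_mat n (part {perm g i}) m * g) $$ (x, y)"
  proof (cases "blk y = i")
    case True
    have "(\<Sum>z<n. g $$ (x, z) * cut_mat n (part {i}) m' $$ (z, y)) = (\<Sum>z<n. g $$ (x, z) * m' $$ (z, y))"
      by (rule sum.cong) (use True xy mm'(3) in \<open>auto simp: bd_def\<close>)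
    also have "\<dots> = (m * g) $$ (x, y)"
      unfolding gm'[symmetric] by (rule mat_mult_index[symmetric]) (use gc mm'(1) xy in auto)
    also have "\<dots> = (\<Sum>z<n. m $$ (x, z) * g $$ (z, y))"
      by (rule mat_mult_index) (use gc mm(1) xy in auto)
    also have "\<dots> = (\<Sum>z<n. cut_mat n (part {perm g i}) m $$ (x, z) * g $$ (z, y))"
    proof (rule sum.cong)
      fix z assume z: "z \<in> {..<n}"
      show "m $$ (x, z) * g $$ (z, y) = cut_mat n (part {perm g i}) m $$ (x, z) * g $$ (z, y)"
      proof (cases "g $$ (z, y) = 0")
        case False
        then have "blk z = perm g i" using perm(2)[OF g _ xy(2)] z True by auto
        then show ?thesis using xy z mm(3) by (auto simp: bd_def)
      qed simp
    qed simp
    finally show ?thesis unfolding L R .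
  next
    case False
    have "(\<Sum>z<n. g $$ (x, z) * cut_mat n (part {i}) m' $$ (z, y)) = (\<Sum>z<n. if z = y then g $$ (x, y) else 0)"
      by (rule sum.cong) (use False xy in auto)
    also have "\<dots> = (\<Sum>z<n. if z = x then g $$ (x, y) else 0)" using xy by simp
    also have "\<dots> = (\<Sum>z<n. cut_mat n (part {perm g i}) m $$ (x, z) * g $$ (z, y))"
    proof (rule sum.cong)
      fix z assume z: "z \<in> {..<n}"
      show "(if z = x then g $$ (x, y) else 0) = cut_mat n (part {perm g i}) m $$ (x, z) * g $$ (z, y)"
      proof (cases "g $$ (z, y) = 0")
        case False': False
        then have "blk z = perm g (blk y)" using perm(2)[OF g _ xy(2)] z by auto
        then have "blk z \<noteq> perm g i" using inj[of "blk y"] blk_less[OF xy(2)] False by auto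
        then show ?thesis using xy z by auto
      qed (use xy in auto)
    qed simp
    finally show ?thesis unfolding L R .
  qed
  then show "(g * cut_mat n (part {i}) (inv\<^bsub>SL n\<^esub> g * m * g)) $$ (x, y)
      = (cut_mat n (part {perm g i}) m * g) $$ (x, y)"
    by (simp add: m'_def h_def)
qed (use normalizer_mem(2)[OF g] in auto)

end

text \<open>The weights are the exponents of the cocharacter \<open>split_det\<close>:
  \<open>e_sum\<close> normalises its determinant to t, and \<open>e_size\<close> makes it invariant
  under the normaliser, which moves blocks only to blocks of equal size.\<close>

locale weighted_blocks = block_structure n k blk ty
  for n k :: nat and blk :: "nat \<Rightarrow> nat" and ty :: "'f::field_char_0 itself" +
  fixes e :: "nat \<Rightarrow> int"
  assumes e_sum: "(\<Sum>x<n. e (blk x)) = 1"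
    and e_size: "i < k \<Longrightarrow> j < k \<Longrightarrow> card {x. x < n \<and> blk x = i} = card {x. x < n \<and> blk x = j}
      \<Longrightarrow> e i = e j"
begin

text \<open>A cocharacter of the centre of the block-diagonal subgroup of \<open>GL\<close> which splits the determinant
  and is fixed by the normaliser.\<close>

definition split_det :: "'f \<Rightarrow> 'f mat" where
  "split_det t = dmat n (\<lambda>x. t powi e (blk x))"

lemma split_det_carrier [simp]: "split_det t \<in> carrier_mat n n"
  by (simp add: split_det_def)

lemma det_split_det: assumes "t \<noteq> 0" shows "det (split_det t) = t"
proof -
  have "(\<Prod>x\<in>A. t powi e (blk x)) = t powi (\<Sum>x\<in>A. e (blk x))" if "finite A" for A
    using that by (induction A) (simp_all add: power_int_add assms)
  then show ?thesis by (simp add: split_det_def det_dmat e_sum)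
qed

lemma split_det_mult: "split_det t * split_det u = split_det (t * u)"
  by (simp add: split_det_def dmat_mult power_int_mult_distrib)

lemma split_det_one: "split_det 1 = 1\<^sub>m n"
  by (simp add: split_det_def dmat_one)

lemma bd_split_det: "bd (split_det t)"
  by (simp add: split_det_def bd_def)

lemma split_det_commute: "A \<in> carrier_mat n n \<Longrightarrow> bd A \<Longrightarrow> A * split_det t = split_det t * A"
  unfolding split_det_def by (rule dmat_block_commute)

lemma e_perm: "g \<in> normalizer (SL n) M \<Longrightarrow> i < k \<Longrightarrow> e (perm g i) = e i"
  using perm_block_size perm(1)[of g] by (intro e_size) (auto simp: bij_betw_def)

lemma split_det_commute_normalizer:
  "g \<in> normalizer (SL n) M \<Longrightarrow> split_det t * g = g * split_det t"
  unfolding split_det_def by (rule perm_dmat_commute) (simp_all add: e_perm)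

text \<open>The cut to the blocks of S lies in the Levi subgroup of GL_n; the second factor projects
  it to M along the image of \<open>split_det\<close>. This image is central in that Levi subgroup,
  so R stays multiplicative.\<close>

definition R :: "nat set \<Rightarrow> 'f mat \<Rightarrow> 'f mat" where
  "R S A = cut_mat n (part S) A * split_det (inverse (det (cut_mat n (part S) A)))"

lemma R_carrier [simp]: "R S A \<in> carrier_mat n n"
  by (simp add: R_def)

lemma part_simps: "part (A \<union> B) = part A \<union> part B" "A \<inter> B = {} \<Longrightarrow> part A \<inter> part B = {}"
  by auto

lemma cut_complement:
  assumes "A \<in> M" shows "cut_mat n (part S) A * cut_mat n (part (- S)) A = A"
proof -
  have "cut_mat n (part S \<union> part (- S)) A = cut_mat n (part S) A * cut_mat n (part (- S)) A"
    by (rule cut_union[OF _ bd_split bd_split]) (use M_carrier[OF assms] in auto)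
  moreover have "cut_mat n (part S \<union> part (- S)) A = A"
    by (rule cut_all) (use M_carrier[OF assms] in auto)
  ultimately show ?thesis by simp
qed

lemma det_cut_complement:
  assumes "A \<in> M" shows "det (cut_mat n (part S) A) * det (cut_mat n (part (- S)) A) = 1"
proof -
  have "det A = det (cut_mat n (part S) A) * det (cut_mat n (part (- S)) A)"
    using det_mult_square[OF cut_carrier cut_carrier, of n "part S" A "part (- S)" A]
    unfolding cut_complement[OF assms] .
  then show ?thesis using M_carrier(2)[OF assms] by simp
qed

lemma det_cut_nonzero:
  assumes "A \<in> M" shows "det (cut_mat n (part S) A) \<noteq> 0"
proof
  assume "det (cut_mat n (part S) A) = 0"
  then show False using det_cut_complement[OF assms, of S] by simp
qed

lemma R_closed: assumes "A \<in> M" shows "R S A \<in> M"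
proof (rule MI)
  show "det (R S A) = 1"
    using det_cut_nonzero[OF assms] by (simp add: R_def det_mult_square[of _ n] det_split_det)
  show "bd (R S A)"
    unfolding R_def by (intro bd_mult bd_cut bd_split_det M_carrier(3)[OF assms]) simp_all
qed simp

lemma mult_rearrange:
  assumes "A \<in> carrier_mat n n" "B \<in> carrier_mat n n" "bd B"
  shows "A * split_det t * (B * split_det u) = A * B * split_det (t * u)"
proof -
  have "A * split_det t * (B * split_det u) = A * (split_det t * B) * split_det u"
    using assms by (simp add: assoc_square[of _ n])
  also have "split_det t * B = B * split_det t" using split_det_commute assms by simp
  also have "A * (B * split_det t) * split_det u = A * B * (split_det t * split_det u)"
    using assms by (simp add: assoc_square[of _ n])
  finally show ?thesis by (simp add: split_det_mult)
qed

lemma R_mult: assumes A: "A \<in> M" and B: "B \<in> M" shows "R S (A * B) = R S A * R S B"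
proof -
  have "cut_mat n (part S) (A * B) = cut_mat n (part S) A * cut_mat n (part S) B"
    using M_carrier[OF A] M_carrier[OF B] by (intro cut_mult bd_split) auto
  then show ?thesis
    using M_carrier[OF B] by (simp add: R_def det_mult_square[of _ n] mult_rearrange bd_cut)
qed

lemma R_union:
  assumes "S \<inter> S' = {}" "A \<in> M" shows "R (S \<union> S') A = R S A * R S' A"
proof -
  have "cut_mat n (part (S \<union> S')) A = cut_mat n (part S) A * cut_mat n (part S') A"
    unfolding part_simps(1) using part_simps(2)[OF assms(1)] M_carrier[OF assms(2)]
    by (intro cut_union bd_split)
  then show ?thesis
    using M_carrier[OF assms(2)] by (simp add: R_def det_mult_square[of _ n] mult_rearrange bd_cut)
qed

lemma R_commute:
  assumes "S \<inter> S' = {}" "A \<in> M" "B \<in> M" shows "R S A * R S' B = R S' B * R S A"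
proof -
  let ?A = "cut_mat n (part S) A" and ?B = "cut_mat n (part S') B"
  have "R S A * R S' B = ?A * ?B * split_det (inverse (det ?A) * inverse (det ?B))"
    unfolding R_def by (rule mult_rearrange) (simp_all add: bd_cut M_carrier(3)[OF assms(3)])
  moreover have "R S' B * R S A = ?B * ?A * split_det (inverse (det ?B) * inverse (det ?A))"
    unfolding R_def by (rule mult_rearrange) (simp_all add: bd_cut M_carrier(3)[OF assms(2)])
  ultimately show ?thesis
    by (simp only: cut_disjoint_commute[OF part_simps(2)[OF assms(1)]] mult.commute[of "inverse (det ?A)"])
qed

lemma R_empty: "R {} A = 1\<^sub>m n"
  by (simp add: R_def cut_empty split_det_one)

lemma R_all: assumes "A \<in> M" shows "R {..<k} A = A"
proof -
  have "cut_mat n (part {..<k}) A = A"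
    using M_carrier[OF assms] blk_less by (intro cut_all) auto
  then show ?thesis using M_carrier[OF assms] by (simp add: R_def split_det_one)
qed

text \<open>The cut is moved by \<open>cut_conj\<close>, which preserves its determinant, and
  \<open>split_det\<close> commutes with g.\<close>

lemma R_conj:
  assumes g: "g \<in> normalizer (SL n) M" and i: "i < k" and m: "m \<in> M"
  shows "R {i} (inv\<^bsub>SL n\<^esub> g * m * g) = inv\<^bsub>SL n\<^esub> g * R {perm g i} m * g"
proof -
  define h where "h = inv\<^bsub>SL n\<^esub> g"
  note gi = SL_inv[OF normalizer_mem(1)[OF g], folded h_def] and gc = normalizer_mem(2,3)[OF g]
  define c where "c = cut_mat n (part {i}) (h * m * g)"
  define c' where "c' = cut_mat n (part {perm g i}) m"
  have c: "c \<in> carrier_mat n n" "c' \<in> carrier_mat n n" by (simp_all add: c_def c'_def)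
  have eq: "g * c = c' * g" using cut_conj[OF g i m] by (simp add: c_def c'_def h_def)
  then have "det (g * c) = det (c' * g)" by simp
  then have d: "det c = det c'" using gc c by (simp add: det_mult_square[of _ n])
  have "h * (c' * split_det (inverse (det c'))) * g = h * (c' * (split_det (inverse (det c')) * g))"
    using gc gi(1) c by (simp add: assoc_square[of _ n])
  also have "\<dots> = h * (c' * g) * split_det (inverse (det c'))"
    unfolding split_det_commute_normalizer[OF g] using gc gi(1) c by (simp add: assoc_square[of _ n])
  also have "\<dots> = (h * g) * c * split_det (inverse (det c'))"
    unfolding eq[symmetric] using gc gi(1) c by (simp add: assoc_square[of _ n])
  also have "\<dots> = c * split_det (inverse (det c))" using gi(3) c d by simp
  finally show ?thesis by (simp add: R_def c_def c'_def h_def)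
qed

text \<open>q splits as c * c' into its part on block i and the rest. The rest commutes with
  everything supported on block i and with \<open>split_det\<close>, so q acts on
  \<open>R {i} m\<close> as c does, and also as c corrected by a central factor to have determinant
  1.\<close>

lemma inner:
  assumes q: "q \<in> normalizer (SL n) M" and i: "i < k" and fixed: "perm q i = i"
  obtains q' where "q' \<in> M"
    "\<And>m. m \<in> M \<Longrightarrow> q * R {i} m * inv\<^bsub>SL n\<^esub> q = q' * R {i} m * inv\<^bsub>SL n\<^esub> q'"
proof -
  note qi = SL_inv[OF normalizer_mem(1)[OF q]] and qc = normalizer_mem(2,3)[OF q]
  let ?h = "inv\<^bsub>SL n\<^esub> q"
  define c where "c = cut_mat n (part {i}) q"
  define c' where "c' = cut_mat n (part (- {i})) q"
  have cc: "c \<in> carrier_mat n n" "c' \<in> carrier_mat n n" by (simp_all add: c_def c'_def)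
  have stable: "blk x = i \<longleftrightarrow> blk y = i" if "x < n" "y < n" "q $$ (x, y) \<noteq> 0" for x y
    using perm(2)[OF q that] perm(1)[OF q] blk_less[OF that(2)] i fixed
    by (auto simp: bij_betw_def inj_on_def)
  have "split_along n (part {i}) q" "split_along n (part (- {i})) q"
    unfolding split_along_def using stable by auto
  then have "cut_mat n (part {i} \<union> part (- {i})) q = c * c'"
    unfolding c_def c'_def by (intro cut_union) auto
  moreover have "cut_mat n (part {i} \<union> part (- {i})) q = q" using qc by (intro cut_all) auto
  ultimately have q_eq: "q = c * c'" by simp
  then have "det c * det c' = 1" using qc cc det_mult_square[of c n c'] by simp
  then have dc: "det c \<noteq> 0" by auto
  have bdc: "bd c" by (auto simp: c_def bd_def)
  define q' where "q' = c * split_det (inverse (det c))"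
  have q'M: "q' \<in> M"
    unfolding q'_def
    by (intro MI bd_mult bdc bd_split_det) (simp_all add: cc det_mult_square[of _ n] det_split_det dc)
  note q'c = M_carrier[OF q'M]
  note q'i = SL_inv[OF q'c(4)]
  \<comment> \<open>The remaining factor in q = q' * r; it commutes with every
    \<open>R {i} m\<close> and cancels from the conjugation.\<close>
  define r where "r = split_det (det c) * c'"
  have r: "r \<in> carrier_mat n n" using cc by (simp add: r_def)
  have "q' * r = c * (split_det (inverse (det c)) * split_det (det c)) * c'"
    unfolding q'_def r_def using cc by (simp add: assoc_square[of _ n])
  then have q'r: "q' * r = q" using cc dc by (simp add: split_det_mult split_det_one q_eq)
  \<comment> \<open>c' may permute the other blocks and need not be block-diagonal; but blocks
    linked by a nonzero entry of q have equal weights.\<close>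
  have c'_comm: "c' * split_det t = split_det t * c'" for t
  proof (rule mat_eqI[of _ n])
    fix x y assume xy: "x < n" "y < n"
    have "e (blk x) = e (blk y)" if "q $$ (x, y) \<noteq> 0"
      using perm(2)[OF q xy that] e_perm[OF q blk_less[OF xy(2)]] by simp
    then show "(c' * split_det t) $$ (x, y) = (split_det t * c') $$ (x, y)"
      using xy cc unfolding split_det_def
      by (cases "q $$ (x, y) = 0") (auto simp: dmat_mult_index c'_def)
  qed (use cc in auto)
  have "q * R {i} m * ?h = q' * R {i} m * inv\<^bsub>SL n\<^esub> q'" if m: "m \<in> M" for m
  proof -
    let ?c = "cut_mat n (part {i}) m" and ?u = "inverse (det (cut_mat n (part {i}) m))"
    have disj: "c' * ?c = ?c * c'" unfolding c'_def by (rule cut_disjoint_commute) auto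
    have "c' * R {i} m = (c' * ?c) * split_det ?u"
      using cc by (simp add: R_def assoc_square[of _ n])
    also have "\<dots> = ?c * (c' * split_det ?u)" unfolding disj using cc by (simp add: assoc_square[of _ n])
    also have "\<dots> = R {i} m * c'" unfolding c'_comm using cc by (simp add: R_def assoc_square[of _ n])
    finally have c'R: "c' * R {i} m = R {i} m * c'" .
    have "r * R {i} m = split_det (det c) * (c' * R {i} m)"
      using cc by (simp add: r_def assoc_square[of _ n])
    also have "\<dots> = (split_det (det c) * R {i} m) * c'"
      unfolding c'R using cc by (simp add: assoc_square[of _ n])
    also have "split_det (det c) * R {i} m = R {i} m * split_det (det c)"
      using split_det_commute[OF R_carrier M_carrier(3)[OF R_closed[OF m]]] by simp
    also have "R {i} m * split_det (det c) * c' = R {i} m * r"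
      using cc by (simp add: r_def assoc_square[of _ n])
    finally have rR: "r * R {i} m = R {i} m * r" .
    have "r * ?h = (inv\<^bsub>SL n\<^esub> q' * q') * r * ?h" using q'i r by simp
    also have "\<dots> = inv\<^bsub>SL n\<^esub> q' * (q' * r) * ?h"
      using q'i(1) q'c(1) r qi(1) by (simp add: assoc_square[of _ n])
    also have "\<dots> = inv\<^bsub>SL n\<^esub> q' * (q * ?h)"
      unfolding q'r using q'i(1) qc qi(1) by (simp add: assoc_square[of _ n])
    also have "\<dots> = inv\<^bsub>SL n\<^esub> q'" using qi(4) q'i(1) by simp
    finally have rh: "r * ?h = inv\<^bsub>SL n\<^esub> q'" .
    have "q * R {i} m * ?h = q' * (r * R {i} m) * ?h"
      unfolding q'r[symmetric] using q'c(1) r qi(1) by (simp add: assoc_square[of _ n])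
    also have "\<dots> = q' * R {i} m * (r * ?h)"
      unfolding rR using q'c(1) r qi(1) by (simp add: assoc_square[of _ n])
    finally show ?thesis unfolding rh .
  qed
  then show ?thesis using that q'M by blast
qed

end

section \<open>Polynomial functions of matrix entries, ultrametric estimates and entrywise
  topology\<close>

section \<open>Polynomial maps, valuations and topology\<close>


lemma poly_funs_sum:
  "(\<And>i. i \<in> A \<Longrightarrow> f i \<in> poly_funs n) \<Longrightarrow> (\<lambda>m. \<Sum>i\<in>A. f i m) \<in> poly_funs n"
  by (induction A rule: infinite_finite_induct) (simp_all add: poly_funs.const poly_funs.add)

lemma poly_funs_prod:
  "(\<And>i. i \<in> A \<Longrightarrow> f i \<in> poly_funs n) \<Longrightarrow> (\<lambda>m. \<Prod>i\<in>A. f i m) \<in> poly_funs n"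
  by (induction A rule: infinite_finite_induct) (simp_all add: poly_funs.const poly_funs.mult)

lemma poly_funs_power: "p \<in> poly_funs n \<Longrightarrow> (\<lambda>m. p m ^ j) \<in> poly_funs n"
  by (induction j) (simp_all add: poly_funs.const poly_funs.mult)

lemma poly_funs_det:
  assumes "\<And>m. F m \<in> carrier_mat n n"
    "\<And>i j. i < n \<Longrightarrow> j < n \<Longrightarrow> (\<lambda>m. F m $$ (i, j)) \<in> poly_funs n"
  shows "(\<lambda>m. det (F m)) \<in> poly_funs n"
proof -
  have "(\<lambda>m. \<Sum>p | p permutes {0..<n}. signof p * (\<Prod>i = 0..<n. F m $$ (i, p i))) \<in> poly_funs n"
    by (intro poly_funs_sum poly_funs.mult poly_funs.const poly_funs_prod assms(2))
      (auto simp: permutes_in_image)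
  then show ?thesis by (simp add: det_def'[OF assms(1)])
qed

lemma poly_funs_cut_det: "(\<lambda>m. det (cut_mat n C m)) \<in> poly_funs n"
proof (rule poly_funs_det)
  fix i j assume ij: "i < n" "j < n"
  have "(\<lambda>m. if i \<in> C \<and> j \<in> C then m $$ (i, j) else if i = j then 1 else 0) \<in> poly_funs n"
    using ij by (cases "i \<in> C \<and> j \<in> C"; cases "i = j") (auto intro: poly_funs.intros)
  then show "(\<lambda>m. cut_mat n C m $$ (i, j)) \<in> poly_funs n" using ij by simp
qed simp

context nonarch_local_field begin

lemma av_zero: "av 0 = 0" by (simp add: av_eq_0)

lemma av_minus: "av (- x) = av x"
  using av_mult[of "- 1" x] av_minus_one by simp

lemma av_pos: "x \<noteq> 0 \<Longrightarrow> 0 < av x"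
  using av_nonneg[of x] av_eq_0[of x] by linarith

lemma av_inverse: "x \<noteq> 0 \<Longrightarrow> av (inverse x) = inverse (av x)"
  using av_mult[of x "inverse x"] av_one av_pos[of x] by (simp add: field_simps)

lemma av_power: "av (x ^ j) = av x ^ j"
  by (induction j) (simp_all add: av_one av_mult)

lemma av_diff: "av (x - y) \<le> max (av x) (av y)"
  using av_ultra[of x "- y"] by (simp add: av_minus)

lemma av_sum_le: "0 \<le> b \<Longrightarrow> (\<And>i. i \<in> A \<Longrightarrow> av (f i) \<le> b) \<Longrightarrow> av (sum f A) \<le> b"
proof (induction A rule: infinite_finite_induct)
  case (insert x A)
  have "av (sum f (insert x A)) \<le> max (av (f x)) (av (sum f A))"
    using insert.hyps by (simp add: av_ultra)
  also have "\<dots> \<le> b" using insert.IH insert.prems by auto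
  finally show ?case .
qed (simp_all add: av_zero)

lemma av_sum_less: "0 < b \<Longrightarrow> (\<And>i. i \<in> A \<Longrightarrow> av (f i) < b) \<Longrightarrow> av (sum f A) < b"
proof (induction A rule: infinite_finite_induct)
  case (insert x A)
  have "av (sum f (insert x A)) \<le> max (av (f x)) (av (sum f A))"
    using insert.hyps by (simp add: av_ultra)
  also have "\<dots> < b" using insert.IH insert.prems by auto
  finally show ?case .
qed (simp_all add: av_zero)

lemma av_prod: "av (prod f A) = (\<Prod>i\<in>A. av (f i))"
  by (induction A rule: infinite_finite_induct) (simp_all add: av_one av_mult)

lemma av_det_le:
  assumes A: "A \<in> carrier_mat n n" "\<And>i j. i < n \<Longrightarrow> j < n \<Longrightarrow> av (A $$ (i, j)) \<le> 1"
  shows "av (det A) \<le> 1"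
  unfolding det_def'[OF A(1)]
proof (rule av_sum_le)
  fix p assume p: "p \<in> {p. p permutes {0..<n}}"
  have "(\<Prod>i = 0..<n. av (A $$ (i, p i))) \<le> 1"
    using p A(2) by (intro prod_le_1) (auto simp: av_nonneg permutes_in_image)
  moreover have "av (signof p) = 1" by (simp add: sign_def av_one av_minus_one)
  ultimately show "av (signof p * (\<Prod>i = 0..<n. A $$ (i, p i))) \<le> 1"
    by (simp add: av_mult av_prod)
qed simp

lemma exists_av_less_one: "\<exists>x. x \<noteq> 0 \<and> av x < 1"
proof -
  obtain x where x: "x \<noteq> 0" "av x \<noteq> 1" using av_nontrivial by blast
  show ?thesis
  proof (cases "av x < 1")
    case False
    then have "av (inverse x) < 1" using x av_inverse[OF x(1)] by (simp add: inverse_less_1_iff)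
    then show ?thesis using x by (intro exI[of _ "inverse x"]) simp
  qed (use x in blast)
qed

definition near :: "nat \<Rightarrow> real \<Rightarrow> 'f mat \<Rightarrow> 'f mat \<Rightarrow> bool" where
  "near n \<epsilon> A B \<longleftrightarrow> (\<forall>x<n. \<forall>y<n. av (B $$ (x, y) - A $$ (x, y)) < \<epsilon>)"

lemma near_mono: "near n \<epsilon> A B \<Longrightarrow> \<epsilon> \<le> \<delta> \<Longrightarrow> near n \<delta> A B"
  unfolding near_def by fastforce

lemma poly_funs_continuous:
  assumes "p \<in> poly_funs n" "0 < \<epsilon>"
  shows "\<exists>\<delta>>0. \<forall>B. near n \<delta> A B \<longrightarrow> av (p B - p A) < \<epsilon>"
  using assms
proof (induction arbitrary: \<epsilon>)
  case (const c)
  then show ?case by (intro exI[of _ 1]) (simp add: av_zero)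
next
  case (entry i j)
  then show ?case by (intro exI[of _ \<epsilon>]) (auto simp: near_def)
next
  case (add p q)
  obtain \<delta>1 where 1: "\<delta>1 > 0" "\<And>B. near n \<delta>1 A B \<Longrightarrow> av (p B - p A) < \<epsilon>" using add by blast
  obtain \<delta>2 where 2: "\<delta>2 > 0" "\<And>B. near n \<delta>2 A B \<Longrightarrow> av (q B - q A) < \<epsilon>" using add by blast
  show ?case
  proof (intro exI[of _ "min \<delta>1 \<delta>2"] conjI allI impI)
    fix B assume "near n (min \<delta>1 \<delta>2) A B"
    then have "av (p B - p A) < \<epsilon>" "av (q B - q A) < \<epsilon>"
      using 1(2) 2(2) near_mono min.cobounded1 min.cobounded2 by blast+
    moreover have "av ((p B - p A) + (q B - q A)) \<le> max (av (p B - p A)) (av (q B - q A))"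
      by (rule av_ultra)
    ultimately show "av (p B + q B - (p A + q A)) < \<epsilon>" by (simp add: algebra_simps)
  qed (use 1 2 in auto)
next
  case (mult p q)
  \<comment> \<open>A bound for \<open>av (q B)\<close> as soon as q B is within 1 of q A, which is
    why \<delta>2 below is chosen for \<open>min 1 (\<epsilon> / a)\<close>. Adding 1 also keeps the
    denominators positive.\<close>
  define b where "b = 1 + av (q A)"
  define a where "a = 1 + av (p A)"
  have ab: "a > 0" "b > 0" using av_nonneg[of "q A"] av_nonneg[of "p A"] by (simp_all add: a_def b_def)
  obtain \<delta>1 where 1: "\<delta>1 > 0" "\<And>B. near n \<delta>1 A B \<Longrightarrow> av (p B - p A) < \<epsilon> / b"
    using mult.IH(1)[of "\<epsilon> / b"] mult.prems ab by auto
  obtain \<delta>2 where 2: "\<delta>2 > 0" "\<And>B. near n \<delta>2 A B \<Longrightarrow> av (q B - q A) < min 1 (\<epsilon> / a)"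
    using mult.IH(2)[of "min 1 (\<epsilon> / a)"] mult.prems ab by auto
  show ?case
  proof (intro exI[of _ "min \<delta>1 \<delta>2"] conjI allI impI)
    fix B assume "near n (min \<delta>1 \<delta>2) A B"
    then have n: "near n \<delta>1 A B" "near n \<delta>2 A B"
      using near_mono min.cobounded1 min.cobounded2 by blast+
    have qB: "av (q B) \<le> b"
      using av_ultra[of "q B - q A" "q A"] 2(2)[OF n(2)] av_nonneg[of "q A"]
      by (auto simp: b_def max_def split: if_splits)
    have "av ((p B - p A) * q B) \<le> av (p B - p A) * b"
      using qB av_nonneg by (simp add: av_mult mult_left_mono)
    also have "\<dots> < \<epsilon>" using 1(2)[OF n(1)] ab by (simp add: field_simps)
    finally have l: "av ((p B - p A) * q B) < \<epsilon>" .
    have "av (p A * (q B - q A)) \<le> a * av (q B - q A)"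
      using av_nonneg by (simp add: av_mult mult_right_mono a_def)
    also have "\<dots> < \<epsilon>" using 2(2)[OF n(2)] ab by (simp add: field_simps)
    finally have r: "av (p A * (q B - q A)) < \<epsilon>" .
    have "p B * q B - p A * q A = (p B - p A) * q B + p A * (q B - q A)" by (simp add: algebra_simps)
    then show "av (p B * q B - p A * q A) < \<epsilon>"
      using av_ultra[of "(p B - p A) * q B" "p A * (q B - q A)"] l r by simp
  qed (use 1 2 in auto)
qed

lemma openin_val_topology:
  "openin (val_topology av) U \<longleftrightarrow> (\<forall>x\<in>U. \<exists>r>0. \<forall>y. av (y - x) < r \<longrightarrow> y \<in> U)"
proof -
  interpret Metric_space UNIV "\<lambda>x y. av (x - y)" by (rule Metric_space_av)
  have "y \<in> mball x r \<longleftrightarrow> av (y - x) < r" for x y r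
    using commute[of x y] by (simp add: in_mball)
  then show ?thesis
    unfolding val_topology_def openin_mtopology by (auto simp: subset_iff)
qed

text \<open>There are finitely many entries, so an open box around A contains one of uniform radius;
  the pullback of the product topology is thereby replaced by entrywise estimates.\<close>

lemma openin_SL_levi_topology:
  assumes sub: "SL_levi n ds \<subseteq> (carrier_mat n n :: 'f mat set)"
  shows "openin (SL_levi_topology av n ds) U \<longleftrightarrow>
    U \<subseteq> SL_levi n ds \<and> (\<forall>A\<in>U. \<exists>\<epsilon>>0. \<forall>B\<in>SL_levi n ds. near n \<epsilon> A B \<longrightarrow> B \<in> U)"
    (is "?L \<longleftrightarrow> ?R")
proof
  let ?I = "{..<n} \<times> {..<n}" and ?P = "product_topology (\<lambda>_. val_topology av) ({..<n} \<times> {..<n})"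
  define f :: "'f mat \<Rightarrow> nat \<times> nat \<Rightarrow> 'f" where "f = (\<lambda>A. \<lambda>p \<in> ?I. A $$ p)"
  have f: "f A p = A $$ p" if "p \<in> ?I" for A p unfolding f_def using that by (rule restrict_apply')
  have open_pullback: "openin (mat_topology av n) V \<longleftrightarrow> (\<exists>W. openin ?P W \<and> V = f -` W \<inter> carrier_mat n n)" for V
    unfolding mat_topology_def openin_pullback_topology f_def by auto
  {
    assume ?L
    then obtain V where V: "openin (mat_topology av n) V" "U = V \<inter> SL_levi n ds"
      by (auto simp: SL_levi_topology_def openin_subtopology)
    then obtain W where W: "openin ?P W" "V = f -` W \<inter> carrier_mat n n" using open_pullback by blast
    have "\<exists>\<epsilon>>0. \<forall>B\<in>SL_levi n ds. near n \<epsilon> A B \<longrightarrow> B \<in> U" if A: "A \<in> U" for A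
    proof -
      have "f A \<in> W" using A unfolding V(2) W(2) by blast
      with W(1) have "\<exists>Q. finite {p \<in> ?I. Q p \<noteq> topspace (val_topology av)} \<and>
          (\<forall>p\<in>?I. openin (val_topology av) (Q p)) \<and> f A \<in> Pi\<^sub>E ?I Q \<and> Pi\<^sub>E ?I Q \<subseteq> W"
        unfolding openin_product_topology_alt by (rule bspec)
      then obtain Q where "\<forall>p\<in>?I. openin (val_topology av) (Q p)"
        and Q: "f A \<in> Pi\<^sub>E ?I Q" "Pi\<^sub>E ?I Q \<subseteq> W"
        by (elim exE conjE)
      then have Q_open: "openin (val_topology av) (Q p)" if "p \<in> ?I" for p using that by blast
      have "\<forall>p\<in>?I. \<exists>r>0. \<forall>y. av (y - A $$ p) < r \<longrightarrow> y \<in> Q p"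
      proof
        fix p assume p: "p \<in> ?I"
        have "A $$ p \<in> Q p" using PiE_mem[OF Q(1) p] unfolding f[OF p] .
        then show "\<exists>r>0. \<forall>y. av (y - A $$ p) < r \<longrightarrow> y \<in> Q p"
          using Q_open[OF p] unfolding openin_val_topology by (rule bspec[rotated])
      qed
      then obtain r where r: "\<And>p. p \<in> ?I \<Longrightarrow> r p > 0"
        "\<And>p y. p \<in> ?I \<Longrightarrow> av (y - A $$ p) < r p \<Longrightarrow> y \<in> Q p" by metis
      define \<epsilon> where "\<epsilon> = Min (insert 1 (r ` ?I))"
      have \<epsilon>: "\<epsilon> > 0" "\<And>p. p \<in> ?I \<Longrightarrow> \<epsilon> \<le> r p" using r(1) by (auto simp: \<epsilon>_def)
      have "B \<in> U" if B: "B \<in> SL_levi n ds" "near n \<epsilon> A B" for B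
      proof -
        have "f B \<in> Pi\<^sub>E ?I Q"
        proof (rule PiE_I)
          fix p assume p: "p \<in> ?I"
          then have "av (B $$ p - A $$ p) < \<epsilon>" using B(2) by (auto simp: near_def)
          then have "B $$ p \<in> Q p" using r(2)[OF p] \<epsilon>(2)[OF p] by simp
          then show "f B p \<in> Q p" unfolding f[OF p] .
        qed (simp add: f_def)
        then have "f B \<in> W" using Q(2) by blast
        then have "B \<in> V" unfolding W(2) using B(1) sub by (intro IntI vimageI2) blast+
        then show ?thesis unfolding V(2) using B(1) by blast
      qed
      then show ?thesis using \<epsilon>(1) by blast
    qed
    moreover have "U \<subseteq> SL_levi n ds" unfolding V(2) by blast
    ultimately show ?R by blast
  }
  {
    assume R: ?R
    define W :: "'f mat \<Rightarrow> real \<Rightarrow> (nat \<times> nat \<Rightarrow> 'f) set" where "W = (\<lambda>A \<epsilon>. Pi\<^sub>E ?I (\<lambda>p. {y. av (y - A $$ p) < \<epsilon>}))"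
    have W: "openin ?P (W A \<epsilon>)" for A \<epsilon>
    proof -
      have "openin (val_topology av) {y. av (y - x) < \<epsilon>}" for x
        unfolding openin_val_topology
      proof
        fix y assume y: "y \<in> {y. av (y - x) < \<epsilon>}"
        have "av (z - x) < \<epsilon>" if "av (z - y) < \<epsilon>" for z
          using av_ultra[of "z - y" "y - x"] that y by simp
        moreover have "\<epsilon> > 0" using y av_nonneg[of "y - x"] by simp
        ultimately show "\<exists>r>0. \<forall>z. av (z - y) < r \<longrightarrow> z \<in> {y. av (y - x) < \<epsilon>}" by auto
      qed
      then show ?thesis unfolding W_def by (intro iffD2[OF openin_PiE]) auto
    qed
    have "\<exists>\<epsilon>. \<forall>A\<in>U. \<epsilon> A > 0 \<and> (\<forall>B\<in>SL_levi n ds. near n (\<epsilon> A) A B \<longrightarrow> B \<in> U)"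
      using R by (intro bchoice) blast
    then obtain \<epsilon> where \<epsilon>: "\<And>A. A \<in> U \<Longrightarrow> \<epsilon> A > 0"
      "\<And>A B. A \<in> U \<Longrightarrow> B \<in> SL_levi n ds \<Longrightarrow> near n (\<epsilon> A) A B \<Longrightarrow> B \<in> U"
      by blast
    have memW: "f B \<in> W A \<delta> \<longleftrightarrow> near n \<delta> A B" for A B \<delta>
      unfolding W_def near_def f_def by (auto simp: PiE_iff)
    have "openin ?P (\<Union>A\<in>U. W A (\<epsilon> A))" using W by blast
    then have "openin (mat_topology av n) (f -` (\<Union>A\<in>U. W A (\<epsilon> A)) \<inter> carrier_mat n n)"
      using open_pullback by blast
    moreover have "U = (f -` (\<Union>A\<in>U. W A (\<epsilon> A)) \<inter> carrier_mat n n) \<inter> SL_levi n ds"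
    proof (intro equalityI subsetI)
      fix A assume A: "A \<in> U"
      have "near n (\<epsilon> A) A A" using \<epsilon>(1)[OF A] by (simp add: near_def av_zero)
      then have "f A \<in> W A (\<epsilon> A)" using memW by blast
      then show "A \<in> (f -` (\<Union>A\<in>U. W A (\<epsilon> A)) \<inter> carrier_mat n n) \<inter> SL_levi n ds"
        using A R sub by blast
    next
      fix B assume B: "B \<in> (f -` (\<Union>A\<in>U. W A (\<epsilon> A)) \<inter> carrier_mat n n) \<inter> SL_levi n ds"
      then obtain A where A: "A \<in> U" "f B \<in> W A (\<epsilon> A)" by blast
      then have "near n (\<epsilon> A) A B" using memW by blast
      then show "B \<in> U" using \<epsilon>(2) A B by blast
    qed
    ultimately show ?L unfolding SL_levi_topology_def openin_subtopology by blast
  }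
qed

text \<open>Local compactness enters only through total boundedness of the ring of integers.\<close>

lemma integers_totally_bounded:
  assumes "0 < \<epsilon>"
  shows "\<exists>C. finite C \<and> (\<forall>x. av x \<le> 1 \<longrightarrow> (\<exists>c\<in>C. av (x - c) < \<epsilon>))"
proof -
  interpret Metric_space UNIV "\<lambda>x y. av (x - y)" by (rule Metric_space_av)
  have "\<exists>U K. openin mtopology U \<and> compactin mtopology K \<and> 0 \<in> U \<and> U \<subseteq> K"
    using av_locally_compact unfolding val_topology_def locally_compact_space_def by simp
  then obtain U K where UK: "openin mtopology U" "compactin mtopology K" "0 \<in> U" "U \<subseteq> K" by blast
  obtain r where r: "r > 0" "\<And>y. av y < r \<Longrightarrow> y \<in> U"
    using UK(1,3) openin_val_topology[of U] unfolding val_topology_def by force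
  obtain x1 where x1: "x1 \<noteq> 0" "av x1 < 1" using exists_av_less_one by blast
  obtain N where "av x1 ^ N < r" using real_arch_pow_inv[OF r(1) x1(2)] by blast
  \<comment> \<open>Multiplication by c shrinks the integers into the neighbourhood U of 0, inside
    the compact set K; a cover of K by balls of radius \<open>\<epsilon> * av c\<close> is then
    scaled back by 1 / c.\<close>
  define c where "c = x1 ^ N"
  have c: "c \<noteq> 0" "av c < r" using x1 \<open>av x1 ^ N < r\<close> by (simp_all add: c_def av_power)
  have "mtotally_bounded K" using UK(2) by (rule compactin_imp_mtotally_bounded)
  moreover have "0 < \<epsilon> * av c" using assms av_pos[OF c(1)] by simp
  ultimately obtain D where D: "finite D" "K \<subseteq> (\<Union>x\<in>D. mball x (\<epsilon> * av c))"
    unfolding mtotally_bounded_def by blast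
  show ?thesis
  proof (intro exI[of _ "(\<lambda>d. d / c) ` D"] conjI allI impI)
    fix x assume "av x \<le> 1"
    then have "av (c * x) < r"
      using c av_nonneg[of c] mult_left_mono[of "av x" 1 "av c"] by (simp add: av_mult)
    then obtain d where d: "d \<in> D" "av (d - c * x) < \<epsilon> * av c"
      using r(2) UK(4) D(2) by (force simp: in_mball)
    have "x - d / c = - ((d - c * x) / c)" using c(1) by (simp add: field_simps)
    then have "av (x - d / c) = av (d - c * x) * inverse (av c)"
      using av_inverse[OF c(1)] by (simp only: av_minus divide_inverse av_mult)
    also have "\<dots> < \<epsilon>" using d(2) av_pos[OF c(1)] by (simp add: field_simps)
    finally show "\<exists>c\<in>(\<lambda>d. d / c) ` D. av (x - c) < \<epsilon>" using d(1) by blast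
  qed (use D in simp)
qed

end

section \<open>Polynomial maps, unramified characters and integral points of the Levi
  subgroup\<close>

locale levi_block = block_structure n k blk "TYPE('f)" + nonarch_local_field av
  for n k :: nat and blk :: "nat \<Rightarrow> nat" and av :: "'f::field_char_0 \<Rightarrow> real" +
  fixes ds :: "nat list"
  assumes M_eq: "SL_levi n ds = (M :: 'f mat set)"
begin

abbreviation MG :: "'f mat monoid" where "MG \<equiv> SL_levi_group n ds"
abbreviation MT :: "'f mat topology" where "MT \<equiv> SL_levi_topology av n ds"
abbreviation X :: "('f mat \<Rightarrow> complex) set" where "X \<equiv> unitary_unramified_characters av n ds"

lemma MG_simps: "carrier MG = M" "A \<otimes>\<^bsub>MG\<^esub> B = A * B" "\<one>\<^bsub>MG\<^esub> = 1\<^sub>m n"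
  by (simp_all add: SL_levi_group_def M_eq SL_def)

lemma MG_eq: "MG = (SL n)\<lparr>carrier := M\<rparr>"
  by (simp add: SL_levi_group_def M_eq)

lemma group_MG: "group MG"
  unfolding MG_eq by (rule subgroup.subgroup_is_group[OF M_subgroup group_SL])

lemma MG_inv: "A \<in> M \<Longrightarrow> inv\<^bsub>MG\<^esub> A = inv\<^bsub>SL n\<^esub> A"
  unfolding MG_eq by (rule group.m_inv_consistent[OF group_SL M_subgroup])

lemma M_mult: "A \<in> M \<Longrightarrow> B \<in> M \<Longrightarrow> A * B \<in> M"
  using subgroup.m_closed[OF M_subgroup] by (simp add: SL_simps)

lemma M_inv: "A \<in> M \<Longrightarrow> inv\<^bsub>SL n\<^esub> A \<in> M"
  using subgroup.m_inv_closed[OF M_subgroup] by simp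

lemma M_one: "1\<^sub>m n \<in> M"
  using subgroup.one_closed[OF M_subgroup] by (simp add: SL_simps)

text \<open>Agreement with polynomials is asked on M only: there the inverse of the determinant of a
  cut can be rewritten as a polynomial. Polynomiality gives continuity and, for homomorphisms,
  stability of the subgroup M^1.\<close>

definition poly_map :: "('f mat \<Rightarrow> 'f mat) \<Rightarrow> bool" where
  "poly_map \<Phi> \<longleftrightarrow> (\<forall>m\<in>M. \<Phi> m \<in> M) \<and>
    (\<forall>i<n. \<forall>j<n. \<exists>q\<in>poly_funs n. \<forall>m\<in>M. \<Phi> m $$ (i, j) = q m)"

lemma poly_map_comp:
  assumes "p \<in> poly_funs n" "poly_map \<Phi>"
  shows "\<exists>q\<in>poly_funs n. \<forall>m\<in>M. p (\<Phi> m) = q m"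
  using assms(1)
proof induction
  case (const c)
  then show ?case by (intro bexI[of _ "\<lambda>_. c"] poly_funs.const) simp
next
  case (entry i j)
  then show ?case using assms(2) by (simp add: poly_map_def)
next
  case (add p q)
  then obtain p' q' where "p' \<in> poly_funs n" "\<forall>m\<in>M. p (\<Phi> m) = p' m"
    "q' \<in> poly_funs n" "\<forall>m\<in>M. q (\<Phi> m) = q' m" by blast
  then show ?case by (intro bexI[of _ "\<lambda>m. p' m + q' m"] poly_funs.add) auto
next
  case (mult p q)
  then obtain p' q' where "p' \<in> poly_funs n" "\<forall>m\<in>M. p (\<Phi> m) = p' m"
    "q' \<in> poly_funs n" "\<forall>m\<in>M. q (\<Phi> m) = q' m" by blast
  then show ?case by (intro bexI[of _ "\<lambda>m. p' m * q' m"] poly_funs.mult) auto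
qed

lemma poly_map_sandwich:
  assumes "A \<in> carrier_mat n n" "B \<in> carrier_mat n n" "\<And>m. m \<in> M \<Longrightarrow> A * m * B \<in> M"
  shows "poly_map (\<lambda>m. A * m * B)"
  unfolding poly_map_def
proof (intro conjI ballI allI impI)
  fix i j assume ij: "i < n" "j < n"
  define q where "q = (\<lambda>m. \<Sum>z<n. (\<Sum>w<n. A $$ (i, w) * m $$ (w, z)) * B $$ (z, j))"
  have "(A * m * B) $$ (i, j) = q m" if m: "m \<in> M" for m
  proof -
    have "(A * m * B) $$ (i, j) = (\<Sum>z<n. (A * m) $$ (i, z) * B $$ (z, j))"
      using assms M_carrier[OF m] ij by (intro mat_mult_index) auto
    also have "\<dots> = (\<Sum>z<n. (\<Sum>w<n. A $$ (i, w) * m $$ (w, z)) * B $$ (z, j))"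
      using assms M_carrier[OF m] ij by (intro sum.cong refl) (simp add: mat_mult_index[where n = n])
    finally show ?thesis unfolding q_def .
  qed
  moreover have "q \<in> poly_funs n"
    unfolding q_def
    by (intro poly_funs_sum poly_funs.mult poly_funs.const poly_funs.entry) (use ij in auto)
  ultimately show "\<exists>q\<in>poly_funs n. \<forall>m\<in>M. (A * m * B) $$ (i, j) = q m" by blast
qed (rule assms(3))

lemma poly_map_left: assumes "g \<in> M" shows "poly_map (\<lambda>m. g * m * 1\<^sub>m n)"
proof (rule poly_map_sandwich)
  fix m assume "m \<in> M"
  then have "g * m \<in> M" by (rule M_mult[OF assms])
  then show "g * m * 1\<^sub>m n \<in> M" using right_mult_one_mat[OF M_carrier(1)] by simp
qed (use M_carrier(1)[OF assms] in simp_all)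

lemma poly_map_right: assumes "g \<in> M" shows "poly_map (\<lambda>m. 1\<^sub>m n * m * g)"
proof (rule poly_map_sandwich)
  fix m assume m: "m \<in> M"
  then have "m * g \<in> M" by (rule M_mult[OF _ assms])
  then show "1\<^sub>m n * m * g \<in> M" using left_mult_one_mat[OF M_carrier(1)[OF m]] by simp
qed (use M_carrier(1)[OF assms] in simp_all)

lemma poly_map_conj:
  assumes "g \<in> normalizer (SL n) M" shows "poly_map (\<lambda>m. inv\<^bsub>SL n\<^esub> g * m * g)"
  by (rule poly_map_sandwich[OF SL_inv(1)[OF normalizer_mem(1)[OF assms]] normalizer_mem(2,4)[OF assms]])

text \<open>Composition with a polynomial endomorphism turns rational characters into rational
  characters.\<close>

lemma SL_levi_1_stable:
  assumes \<Phi>: "poly_map \<Phi>" "\<And>m l. m \<in> M \<Longrightarrow> l \<in> M \<Longrightarrow> \<Phi> (m * l) = \<Phi> m * \<Phi> l"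
    and m: "m \<in> SL_levi_1 av n ds"
  shows "\<Phi> m \<in> SL_levi_1 av n ds"
proof -
  have \<Phi>M: "\<Phi> l \<in> M" if "l \<in> M" for l using \<Phi>(1) that by (simp add: poly_map_def)
  have mM: "m \<in> M" using m by (simp add: SL_levi_1_def M_eq)
  have "av (\<psi> (\<Phi> m)) = 1" if \<psi>: "\<psi> \<in> rational_characters n ds" for \<psi>
  proof -
    obtain p where p: "p \<in> poly_funs n" "\<forall>m\<in>M. \<psi> m = p m" and hom: "\<psi> \<in> hom MG units_group"
      using \<psi> by (auto simp: rational_characters_def M_eq)
    obtain q where q: "q \<in> poly_funs n" "\<forall>m\<in>M. p (\<Phi> m) = q m"
      using poly_map_comp[OF p(1) \<Phi>(1)] by blast
    have "(\<lambda>m. \<psi> (\<Phi> m)) \<in> hom MG units_group"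
      using hom \<Phi>M \<Phi>(2) by (auto simp: hom_def MG_simps Pi_def)
    moreover have "\<forall>m\<in>M. \<psi> (\<Phi> m) = q m" using p q \<Phi>M by simp
    ultimately have "(\<lambda>m. \<psi> (\<Phi> m)) \<in> rational_characters n ds"
      using q(1) by (auto simp: rational_characters_def M_eq)
    then show ?thesis using m by (auto simp: SL_levi_1_def)
  qed
  then show ?thesis using \<Phi>M[OF mM] by (simp add: SL_levi_1_def M_eq)
qed

lemma X_iff: "\<eta> \<in> X \<longleftrightarrow> (\<forall>m\<in>M. \<forall>l\<in>M. \<eta> (m * l) = \<eta> m * \<eta> l) \<and>
    (\<forall>m\<in>SL_levi_1 av n ds. \<eta> m = 1) \<and> (\<forall>m\<in>M. norm (\<eta> m) = 1)"
  by (auto simp: unitary_unramified_characters_def hom_def MG_simps M_eq units_group_def)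

lemma X_mult: "\<eta> \<in> X \<Longrightarrow> m \<in> M \<Longrightarrow> l \<in> M \<Longrightarrow> \<eta> (m * l) = \<eta> m * \<eta> l"
  by (simp add: X_iff)

lemma X_norm: "\<eta> \<in> X \<Longrightarrow> m \<in> M \<Longrightarrow> norm (\<eta> m) = 1"
  by (simp add: X_iff)

lemma X_nonzero: "\<eta> \<in> X \<Longrightarrow> m \<in> M \<Longrightarrow> \<eta> m \<noteq> 0"
  using X_norm[of \<eta> m] by auto

lemma X_one: "(\<lambda>_. 1) \<in> X"
  by (simp add: X_iff)

lemma X_times: "\<eta> \<in> X \<Longrightarrow> \<theta> \<in> X \<Longrightarrow> (\<lambda>m. \<eta> m * \<theta> m) \<in> X"
  by (simp add: X_iff norm_mult)

lemma X_inverse: "\<eta> \<in> X \<Longrightarrow> (\<lambda>m. inverse (\<eta> m)) \<in> X"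
  by (simp add: X_iff norm_inverse)

lemma X_comp:
  assumes "\<eta> \<in> X" "poly_map \<Phi>" "\<And>m l. m \<in> M \<Longrightarrow> l \<in> M \<Longrightarrow> \<Phi> (m * l) = \<Phi> m * \<Phi> l"
  shows "(\<lambda>m. \<eta> (\<Phi> m)) \<in> X"
  using assms SL_levi_1_stable[OF assms(2,3)] by (simp add: X_iff poly_map_def)

lemma openin_MT: "openin MT U \<longleftrightarrow> U \<subseteq> M \<and> (\<forall>A\<in>U. \<exists>\<epsilon>>0. \<forall>B\<in>M. near n \<epsilon> A B \<longrightarrow> B \<in> U)"
proof -
  have "SL_levi n ds \<subseteq> (carrier_mat n n :: 'f mat set)" using M_carrier(1) M_eq by blast
  from openin_SL_levi_topology[OF this] show ?thesis unfolding M_eq .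
qed

lemma topspace_MT: "topspace MT = M"
proof
  have "openin MT M" unfolding openin_MT by (auto intro: exI[of _ 1])
  then show "M \<subseteq> topspace MT" by (rule openin_subset)
  have "openin MT (topspace MT)" by simp
  then show "topspace MT \<subseteq> M" unfolding openin_MT by blast
qed

lemma poly_map_continuous:
  assumes "poly_map \<Phi>" shows "continuous_map MT MT \<Phi>"
  unfolding continuous_map_def topspace_MT
proof (intro conjI allI impI)
  show "\<Phi> \<in> M \<rightarrow> M" using assms by (simp add: poly_map_def)
  fix U assume U: "openin MT U"
  show "openin MT {A \<in> M. \<Phi> A \<in> U}" unfolding openin_MT
  proof (intro conjI ballI)
    fix A assume A: "A \<in> {A \<in> M. \<Phi> A \<in> U}"
    then obtain \<epsilon> where \<epsilon>: "\<epsilon> > 0" "\<And>B. B \<in> M \<Longrightarrow> near n \<epsilon> (\<Phi> A) B \<Longrightarrow> B \<in> U"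
      using U unfolding openin_MT by blast
    have "\<exists>\<delta>>0. \<forall>B\<in>M. near n \<delta> A B \<longrightarrow> av (\<Phi> B $$ (i, j) - \<Phi> A $$ (i, j)) < \<epsilon>"
      if ij: "i < n" "j < n" for i j
    proof -
      obtain q where q: "q \<in> poly_funs n" "\<forall>m\<in>M. \<Phi> m $$ (i, j) = q m"
        using assms ij unfolding poly_map_def by blast
      obtain \<delta> where "\<delta> > 0" "\<forall>B. near n \<delta> A B \<longrightarrow> av (q B - q A) < \<epsilon>"
        using poly_funs_continuous[OF q(1) \<epsilon>(1)] by blast
      then show ?thesis using q(2) A by (intro exI[of _ \<delta>]) auto
    qed
    then have "\<forall>p\<in>{..<n} \<times> {..<n}. \<exists>\<delta>>0. \<forall>B\<in>M. near n \<delta> A B \<longrightarrow> av (\<Phi> B $$ p - \<Phi> A $$ p) < \<epsilon>"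
      by auto
    from bchoice[OF this] obtain \<delta> where "\<forall>p\<in>{..<n} \<times> {..<n}. \<delta> p > 0 \<and>
      (\<forall>B\<in>M. near n (\<delta> p) A B \<longrightarrow> av (\<Phi> B $$ p - \<Phi> A $$ p) < \<epsilon>)"
      by (elim exE)
    then have \<delta>: "\<delta> p > 0" "B \<in> M \<Longrightarrow> near n (\<delta> p) A B \<Longrightarrow> av (\<Phi> B $$ p - \<Phi> A $$ p) < \<epsilon>"
      if "p \<in> {..<n} \<times> {..<n}" for p B
      using that by (simp_all only: Ball_def)
    define d where "d = Min (insert 1 (\<delta> ` ({..<n} \<times> {..<n})))"
    have fin: "finite (insert 1 (\<delta> ` ({..<n} \<times> {..<n})))" by simp
    have "\<forall>x\<in>insert 1 (\<delta> ` ({..<n} \<times> {..<n})). 0 < x"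
    proof
      fix x assume "x \<in> insert 1 (\<delta> ` ({..<n} \<times> {..<n}))"
      then consider "x = 1" | p where "p \<in> {..<n} \<times> {..<n}" "x = \<delta> p" by (elim insertE imageE)
      then show "0 < x" by cases (simp_all only: \<delta>(1) zero_less_one)
    qed
    then have d1: "d > 0" unfolding d_def by (rule Min_gr_iff[OF fin insert_not_empty, THEN iffD2])
    have d2: "d \<le> \<delta> p" if "p \<in> {..<n} \<times> {..<n}" for p
      unfolding d_def by (rule Min_le[OF fin]) (intro insertI2 imageI that)
    have "\<Phi> B \<in> U" if B: "B \<in> M" "near n d A B" for B
    proof (rule \<epsilon>(2))
      show "\<Phi> B \<in> M" using assms B(1) by (simp add: poly_map_def)
      show "near n \<epsilon> (\<Phi> A) (\<Phi> B)"
        unfolding near_def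
      proof (intro allI impI)
        fix x y assume "x < n" "y < n"
        then have p: "(x, y) \<in> {..<n} \<times> {..<n}" by simp
        show "av (\<Phi> B $$ (x, y) - \<Phi> A $$ (x, y)) < \<epsilon>"
          by (rule \<delta>(2)[OF p B(1) near_mono[OF B(2) d2[OF p]]])
      qed
    qed
    then show "\<exists>\<epsilon>>0. \<forall>B\<in>M. near n \<epsilon> A B \<longrightarrow> B \<in> {A \<in> M. \<Phi> A \<in> U}" using d1 by blast
  qed blast
qed

lemma left_translate_open:
  assumes g: "g \<in> M" and U: "openin MT U" shows "openin MT (g <#\<^bsub>MG\<^esub> U)"
proof -
  let ?h = "inv\<^bsub>SL n\<^esub> g"
  note gi = SL_inv[OF M_carrier(4)[OF g]] and gc = M_carrier(1)[OF g]
  have UM: "U \<subseteq> M" using U by (simp add: openin_MT)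
  have "openin MT {A \<in> topspace MT. ?h * A * 1\<^sub>m n \<in> U}"
    by (rule openin_continuous_map_preimage[OF poly_map_continuous[OF poly_map_left[OF M_inv[OF g]]] U])
  also have "{A \<in> topspace MT. ?h * A * 1\<^sub>m n \<in> U} = g <#\<^bsub>MG\<^esub> U"
  proof (intro equalityI subsetI)
    fix A assume "A \<in> {A \<in> topspace MT. ?h * A * 1\<^sub>m n \<in> U}"
    then have A: "A \<in> M" "?h * A \<in> U" using gi(1) M_carrier(1)[of A] by (auto simp: topspace_MT)
    have "A = g * (?h * A)"
      using gi(1,4) gc M_carrier(1)[OF A(1)] by (simp add: assoc_square[of _ n, symmetric])
    then show "A \<in> g <#\<^bsub>MG\<^esub> U" using A(2) by (auto simp: l_coset_def MG_simps)
  next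
    fix A assume "A \<in> g <#\<^bsub>MG\<^esub> U"
    then obtain B where B: "B \<in> U" "A = g * B" by (auto simp: l_coset_def MG_simps)
    have BM: "B \<in> M" using B(1) UM by blast
    have "?h * A * 1\<^sub>m n = B"
      using gi(1,3) gc M_carrier(1)[OF BM] B(2) by (simp add: assoc_square[of _ n, symmetric])
    then show "A \<in> {A \<in> topspace MT. ?h * A * 1\<^sub>m n \<in> U}"
      using B M_mult[OF g BM] by (simp add: topspace_MT)
  qed
  finally show ?thesis .
qed

lemma right_translate_open:
  assumes g: "g \<in> M" and U: "openin MT U" shows "openin MT (U #>\<^bsub>MG\<^esub> g)"
proof -
  let ?h = "inv\<^bsub>SL n\<^esub> g"
  note gi = SL_inv[OF M_carrier(4)[OF g]] and gc = M_carrier(1)[OF g]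
  have UM: "U \<subseteq> M" using U by (simp add: openin_MT)
  have "openin MT {A \<in> topspace MT. 1\<^sub>m n * A * ?h \<in> U}"
    by (rule openin_continuous_map_preimage[OF poly_map_continuous[OF poly_map_right[OF M_inv[OF g]]] U])
  also have "{A \<in> topspace MT. 1\<^sub>m n * A * ?h \<in> U} = U #>\<^bsub>MG\<^esub> g"
  proof (intro equalityI subsetI)
    fix A assume "A \<in> {A \<in> topspace MT. 1\<^sub>m n * A * ?h \<in> U}"
    then have A: "A \<in> M" "A * ?h \<in> U" using gi(1) M_carrier(1)[of A] by (auto simp: topspace_MT)
    have "A = (A * ?h) * g"
      using gi(1,3) gc M_carrier(1)[OF A(1)] by (simp add: assoc_square[of _ n])
    then show "A \<in> U #>\<^bsub>MG\<^esub> g" using A(2) by (auto simp: r_coset_def MG_simps)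
  next
    fix A assume "A \<in> U #>\<^bsub>MG\<^esub> g"
    then obtain B where B: "B \<in> U" "A = B * g" by (auto simp: r_coset_def MG_simps)
    have BM: "B \<in> M" using B(1) UM by blast
    have "1\<^sub>m n * A * ?h = B"
      using gi(1,4) gc M_carrier(1)[OF BM] B(2) by (simp add: assoc_square[of _ n])
    then show "A \<in> {A \<in> topspace MT. 1\<^sub>m n * A * ?h \<in> U}"
      using B M_mult[OF BM g] by (simp add: topspace_MT)
  qed
  finally show ?thesis .
qed

text \<open>The integral points of M, in the role of an open compact subgroup; compactness appears
  in the form that orbits in a smooth representation are finite.\<close>

definition integral :: "'f mat set" where
  "integral = {A \<in> M. \<forall>x<n. \<forall>y<n. av (A $$ (x, y)) \<le> 1}"

text \<open>With determinant 1 the inverse is the adjugate, whose entries are minors up to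
  sign.\<close>

lemma integral_inv:
  assumes "A \<in> integral" shows "inv\<^bsub>SL n\<^esub> A \<in> integral"
proof -
  have A: "A \<in> M" "\<And>x y. x < n \<Longrightarrow> y < n \<Longrightarrow> av (A $$ (x, y)) \<le> 1" using assms by (auto simp: integral_def)
  note Ac = M_carrier[OF A(1)] and Ai = SL_inv[OF M_carrier(4)[OF A(1)]]
  have "adj_mat A = inv\<^bsub>SL n\<^esub> A * A * adj_mat A" using Ai(3) adj_mat(1)[OF Ac(1)] by simp
  also have "\<dots> = inv\<^bsub>SL n\<^esub> A * (A * adj_mat A)"
    using Ai(1) Ac(1) adj_mat(1)[OF Ac(1)] by (simp add: assoc_square[of _ n])
  also have "A * adj_mat A = 1\<^sub>m n" unfolding adj_mat(2)[OF Ac(1)] Ac(2) by (rule eq_matI) auto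
  also have "inv\<^bsub>SL n\<^esub> A * 1\<^sub>m n = inv\<^bsub>SL n\<^esub> A" using Ai(1) by simp
  finally have eq: "inv\<^bsub>SL n\<^esub> A = adj_mat A" by simp
  have "av (adj_mat A $$ (x, y)) \<le> 1" if xy: "x < n" "y < n" for x y
  proof -
    have "av (det (mat_delete A y x)) \<le> 1"
    proof (rule av_det_le)
      show "mat_delete A y x \<in> carrier_mat (n - 1) (n - 1)" using Ac(1) by (simp add: mat_delete_def)
      fix i j assume "i < n - 1" "j < n - 1"
      then show "av (mat_delete A y x $$ (i, j)) \<le> 1" using Ac(1) A(2) by (simp add: mat_delete_def)
    qed
    then show ?thesis
      using Ac(1) xy by (simp add: adj_mat_def cofactor_def av_mult av_power av_minus_one)
  qed
  then show ?thesis using M_inv[OF A(1)] by (simp add: integral_def eq)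
qed

lemma integral_subgroup: "subgroup integral MG"
proof (rule group.subgroupI[OF group_MG])
  show "integral \<subseteq> carrier MG" by (auto simp: integral_def MG_simps)
  have "1\<^sub>m n \<in> integral" using M_one by (simp add: integral_def av_one av_zero)
  then show "integral \<noteq> {}" by blast
  fix A assume A: "A \<in> integral"
  then show "inv\<^bsub>MG\<^esub> A \<in> integral" using integral_inv by (simp add: MG_inv integral_def)
  fix B assume B: "B \<in> integral"
  have "av ((A * B) $$ (x, y)) \<le> 1" if xy: "x < n" "y < n" for x y
  proof -
    have "(A * B) $$ (x, y) = (\<Sum>z<n. A $$ (x, z) * B $$ (z, y))"
      using A B xy by (intro mat_mult_index) (auto simp: integral_def M_carrier)
    also have "av \<dots> \<le> 1"
    proof (rule av_sum_le)
      fix z assume "z \<in> {..<n}"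
      then show "av (A $$ (x, z) * B $$ (z, y)) \<le> 1"
        using A B xy av_nonneg by (auto simp: integral_def av_mult intro!: mult_le_one)
    qed simp
    finally show ?thesis .
  qed
  then show "A \<otimes>\<^bsub>MG\<^esub> B \<in> integral" using A B by (auto simp: integral_def MG_simps M_mult)
qed

lemma integral_open: "openin MT integral"
  unfolding openin_MT
proof (intro conjI ballI)
  fix A assume A: "A \<in> integral"
  have "B \<in> integral" if B: "B \<in> M" "near n 1 A B" for B
  proof -
    have "av (B $$ (x, y)) \<le> 1" if "x < n" "y < n" for x y
    proof -
      have "av (B $$ (x, y) - A $$ (x, y)) < 1" "av (A $$ (x, y)) \<le> 1"
        using B(2) A that by (auto simp: near_def integral_def)
      then show ?thesis using av_ultra[of "B $$ (x, y) - A $$ (x, y)" "A $$ (x, y)"] by simp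
    qed
    then show ?thesis using B(1) by (simp add: integral_def)
  qed
  then show "\<exists>\<epsilon>>0. \<forall>B\<in>M. near n \<epsilon> A B \<longrightarrow> B \<in> integral" by (intro exI[of _ 1]) simp
qed (auto simp: integral_def)

text \<open>Total boundedness sorts the integral matrices into finitely many classes, in each of
  which the entries differ by less than \<epsilon>. For A and B in one class, the inverse of A times
  B is within \<epsilon> of the identity because the inverse of A is integral; so this product fixes
  v, and A and B act alike on v.\<close>

lemma integral_finite_orbits:
  assumes sm: "smooth_representation MG MT sc \<pi>"
  shows "finite ((\<lambda>g. \<pi> g v) ` integral)"
proof -
  have rep: "group_rep MG sc \<pi>" using sm by (simp add: smooth_representation_def)
  have one: "\<pi> (1\<^sub>m n) v = v" using rep by (simp add: group_rep_def MG_simps)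
  have mult: "\<pi> (A * B) v = \<pi> A (\<pi> B v)" if "A \<in> M" "B \<in> M" for A B
    using rep that by (simp add: group_rep_def MG_simps)
  have "openin MT {g \<in> M. \<pi> g v = v}" using sm by (simp add: smooth_representation_def MG_simps)
  then obtain \<epsilon> where \<epsilon>: "\<epsilon> > 0" "\<And>B. B \<in> M \<Longrightarrow> near n \<epsilon> (1\<^sub>m n) B \<Longrightarrow> \<pi> B v = v"
    using one M_one unfolding openin_MT by blast
  obtain C where C: "finite C" "\<And>x. av x \<le> 1 \<Longrightarrow> \<exists>c\<in>C. av (x - c) < \<epsilon>"
    using integers_totally_bounded[OF \<epsilon>(1)] by blast
  define cl where "cl = (\<lambda>x. SOME c. c \<in> C \<and> av (x - c) < \<epsilon>)"
  have cl: "cl x \<in> C" "av (x - cl x) < \<epsilon>" if "av x \<le> 1" for x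
  proof -
    have "cl x \<in> C \<and> av (x - cl x) < \<epsilon>" unfolding cl_def
      by (rule someI_ex[of "\<lambda>c. c \<in> C \<and> av (x - c) < \<epsilon>"]) (use C(2)[OF that] in blast)
    then show "cl x \<in> C" "av (x - cl x) < \<epsilon>" by auto
  qed
  define F where "F = (\<lambda>A. \<lambda>p\<in>{..<n} \<times> {..<n}. cl (A $$ p))"
  have "F ` integral \<subseteq> ({..<n} \<times> {..<n}) \<rightarrow>\<^sub>E C"
  proof (intro image_subsetI)
    fix A assume A: "A \<in> integral"
    have "cl (A $$ p) \<in> C" if "p \<in> {..<n} \<times> {..<n}" for p
      by (rule cl(1)) (use A that in \<open>auto simp: integral_def\<close>)
    then show "F A \<in> ({..<n} \<times> {..<n}) \<rightarrow>\<^sub>E C"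
      unfolding F_def restrict_PiE_iff by (rule ballI)
  qed
  then have finF: "finite (F ` integral)"
    by (rule finite_subset) (intro finite_PiE finite_cartesian_product finite_lessThan C(1))
  have same: "\<pi> A v = \<pi> B v" if A: "A \<in> integral" and B: "B \<in> integral" and eq: "F A = F B" for A B
  proof -
    have AM: "A \<in> M" and BM: "B \<in> M" using A B by (auto simp: integral_def)
    let ?h = "inv\<^bsub>SL n\<^esub> A"
    note Ai = SL_inv[OF M_carrier(4)[OF AM]]
    have h: "?h \<in> integral" by (rule integral_inv[OF A])
    have diff: "av (B $$ (x, y) - A $$ (x, y)) < \<epsilon>" if xy: "x < n" "y < n" for x y
    proof -
      have "cl (A $$ (x, y)) = cl (B $$ (x, y))"
        using fun_cong[OF eq, of "(x, y)"] xy by (simp add: F_def)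
      moreover have "av (A $$ (x, y)) \<le> 1" "av (B $$ (x, y)) \<le> 1" using A B xy by (auto simp: integral_def)
      ultimately have "av (B $$ (x, y) - cl (A $$ (x, y))) < \<epsilon>" "av (A $$ (x, y) - cl (A $$ (x, y))) < \<epsilon>"
        using cl(2)[of "A $$ (x, y)"] cl(2)[of "B $$ (x, y)"] by auto
      then show ?thesis
        using av_diff[of "B $$ (x, y) - cl (A $$ (x, y))" "A $$ (x, y) - cl (A $$ (x, y))"] by simp
    qed
    have "near n \<epsilon> (1\<^sub>m n) (?h * B)" unfolding near_def
    proof (intro allI impI)
      fix x y assume xy: "x < n" "y < n"
      have "(?h * B) $$ (x, y) = (\<Sum>z<n. ?h $$ (x, z) * B $$ (z, y))"
        using Ai(1) M_carrier(1)[OF BM] xy by (rule mat_mult_index)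
      moreover have "1\<^sub>m n $$ (x, y) = (\<Sum>z<n. ?h $$ (x, z) * A $$ (z, y))"
        unfolding Ai(3)[symmetric] using Ai(1) M_carrier(1)[OF AM] xy by (rule mat_mult_index)
      ultimately have "(?h * B) $$ (x, y) - 1\<^sub>m n $$ (x, y) = (\<Sum>z<n. ?h $$ (x, z) * (B $$ (z, y) - A $$ (z, y)))"
        by (simp only: sum_subtractf[symmetric] right_diff_distrib)
      also have "av \<dots> < \<epsilon>"
      proof (rule av_sum_less[OF \<epsilon>(1)])
        fix z assume z: "z \<in> {..<n}"
        have "av (?h $$ (x, z)) \<le> 1" using h xy z by (auto simp: integral_def)
        then have "av (?h $$ (x, z) * (B $$ (z, y) - A $$ (z, y))) \<le> av (B $$ (z, y) - A $$ (z, y))"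
          using av_nonneg by (simp add: av_mult mult_left_le_one_le)
        also have "\<dots> < \<epsilon>" using diff z xy by simp
        finally show "av (?h $$ (x, z) * (B $$ (z, y) - A $$ (z, y))) < \<epsilon>" .
      qed
      finally show "av ((?h * B) $$ (x, y) - 1\<^sub>m n $$ (x, y)) < \<epsilon>" .
    qed
    then have "\<pi> (?h * B) v = v" using \<epsilon>(2) M_mult[OF M_inv[OF AM] BM] by blast
    then have "\<pi> A v = \<pi> A (\<pi> (?h * B) v)" by simp
    also have "\<dots> = \<pi> (A * (?h * B)) v" using mult[OF AM M_mult[OF M_inv[OF AM] BM]] by simp
    also have "A * (?h * B) = B"
      using Ai M_carrier(1)[OF AM] M_carrier(1)[OF BM] by (simp add: assoc_square[of _ n, symmetric])
    finally show ?thesis .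
  qed
  define G where "G = (\<lambda>f. \<pi> (SOME A. A \<in> integral \<and> F A = f) v)"
  have GF: "\<pi> A v = G (F A)" if "A \<in> integral" for A
  proof -
    have *: "(SOME B. B \<in> integral \<and> F B = F A) \<in> integral \<and> F (SOME B. B \<in> integral \<and> F B = F A) = F A"
      by (rule someI[of _ A]) (use that in simp)
    show ?thesis unfolding G_def
      by (rule same[OF that]) (use * in simp_all)
  qed
  have "(\<lambda>g. \<pi> g v) ` integral \<subseteq> G ` F ` integral"
  proof (intro image_subsetI)
    fix A assume A: "A \<in> integral"
    show "\<pi> A v \<in> G ` F ` integral" unfolding GF[OF A] using A by (intro imageI)
  qed
  then show ?thesis by (rule finite_subset) (intro finite_imageI[of "F ` integral"] finF)
qed

lemma smooth_rep_MG:
  assumes "smooth_representation MG MT sc \<pi>"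
  shows "smooth_rep sc MG MT \<pi>"
proof -
  have "vector_space sc" using assms by (simp add: smooth_representation_def group_rep_def)
  then show ?thesis
    using assms left_translate_open right_translate_open
    by (intro smooth_rep.intro complex_vector_space.intro group_MG smooth_rep_axioms.intro)
      (simp_all add: MG_simps)
qed

end

lemma rep_equivI:
  "Vector_Spaces.linear sc sc' L \<Longrightarrow> bij L \<Longrightarrow> (\<And>g v. g \<in> carrier G \<Longrightarrow> L (\<pi> g v) = \<pi>' g (L v))
    \<Longrightarrow> rep_equiv G sc \<pi> sc' \<pi>'"
  unfolding rep_equiv_def by blast

lemma rep_equivE:
  assumes "rep_equiv G sc \<pi> sc' \<pi>'"
  obtains L where "Vector_Spaces.linear sc sc' L" "bij L"
    "\<And>g v. g \<in> carrier G \<Longrightarrow> L (\<pi> g v) = \<pi>' g (L v)"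
  using assms unfolding rep_equiv_def by blast

lemma rep_equiv_trans:
  assumes "rep_equiv G sc1 \<pi>1 sc2 \<pi>2" "rep_equiv G sc2 \<pi>2 sc3 \<pi>3"
  shows "rep_equiv G sc1 \<pi>1 sc3 \<pi>3"
proof -
  obtain L where L: "Vector_Spaces.linear sc1 sc2 L" "bij L"
    "\<And>g v. g \<in> carrier G \<Longrightarrow> L (\<pi>1 g v) = \<pi>2 g (L v)" using rep_equivE[OF assms(1)] by blast
  obtain K where K: "Vector_Spaces.linear sc2 sc3 K" "bij K"
    "\<And>g v. g \<in> carrier G \<Longrightarrow> K (\<pi>2 g v) = \<pi>3 g (K v)" using rep_equivE[OF assms(2)] by blast
  show ?thesis
    by (rule rep_equivI[OF Vector_Spaces.linear_compose[OF L(1) K(1)] bij_comp[OF L(2) K(2)]])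
      (simp add: L(3) K(3))
qed

lemma rep_equiv_sym:
  fixes \<pi> :: "'g \<Rightarrow> 'v::ab_group_add \<Rightarrow> 'v"
  assumes "vector_space sc" "rep_equiv G sc \<pi> sc \<pi>'" shows "rep_equiv G sc \<pi>' sc \<pi>"
proof -
  interpret complex_vector_space sc by (rule complex_vector_space.intro[OF assms(1)])
  obtain L where L: "lin L" "bij L" "\<And>g v. g \<in> carrier G \<Longrightarrow> L (\<pi> g v) = \<pi>' g (L v)"
    using rep_equivE[OF assms(2)] by blast
  show ?thesis
  proof (rule rep_equivI[OF lin_inv_into[OF L(1,2)] bij_imp_bij_inv[OF L(2)]])
    fix g v assume g: "g \<in> carrier G"
    have "L (\<pi> g (inv_into UNIV L v)) = \<pi>' g v"
      using L(3)[OF g] L(2) by (simp add: bij_is_surj surj_f_inv_f)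
    then show "inv_into UNIV L (\<pi>' g v) = \<pi> g (inv_into UNIV L v)"
      using L(2) by (metis bij_is_inj inv_into_f_f UNIV_I)
  qed
qed

section \<open>Blocks of different sizes: the abstract argument applied to the Levi subgroup\<close>

locale weighted_levi = weighted_blocks n k blk "TYPE('f)" e + levi_block n k blk av ds
  for n k :: nat and blk :: "nat \<Rightarrow> nat" and e :: "nat \<Rightarrow> int"
    and av :: "'f::field_char_0 \<Rightarrow> real" and ds :: "nat list"
begin

text \<open>The exponents e may be negative, but on M the determinants of complementary cuts are
  inverse to each other, so powers of either sign are polynomials.\<close>

lemma poly_map_R: "poly_map (R S)"
  unfolding poly_map_def
proof (intro conjI ballI allI impI)
  fix x y assume xy: "x < n" "y < n"
  let ?\<delta> = "\<lambda>m :: 'f mat. det (cut_mat n (part S) m)" and ?\<delta>' = "\<lambda>m :: 'f mat. det (cut_mat n (part (- S)) m)"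
  define p where "p = (\<lambda>m :: 'f mat. if x \<in> part S \<and> y \<in> part S then m $$ (x, y) else if x = y then 1 else 0)"
  define q :: "'f mat \<Rightarrow> 'f" where "q = (\<lambda>m. if 0 \<le> e (blk y) then ?\<delta>' m ^ nat (e (blk y)) else ?\<delta> m ^ nat (- e (blk y)))"
  have "p \<in> poly_funs n"
    unfolding p_def using xy
    by (cases "x \<in> part S \<and> y \<in> part S"; cases "x = y") (auto intro: poly_funs.intros)
  moreover have "q \<in> poly_funs n"
    unfolding q_def by (cases "0 \<le> e (blk y)") (simp_all add: poly_funs_power poly_funs_cut_det)
  ultimately have pq: "(\<lambda>m. p m * q m) \<in> poly_funs n" by (rule poly_funs.mult)
  have "R S m $$ (x, y) = p m * q m" if m: "m \<in> M" for m
  proof -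
    have i1: "inverse (?\<delta> m) = ?\<delta>' m"
      by (rule inverse_unique[OF det_cut_complement[OF m]])
    have i2: "inverse (?\<delta>' m) = ?\<delta> m" using i1 by (metis inverse_inverse_eq)
    have "inverse (?\<delta> m) powi e (blk y) = q m"
      unfolding i1 q_def power_int_def i2 ..
    then show ?thesis
      using xy by (simp add: R_def split_det_def dmat_mult_index p_def)
  qed
  then show "\<exists>q\<in>poly_funs n. \<forall>m\<in>M. R S m $$ (x, y) = q m" by (intro bexI[OF _ pq] ballI)
qed (rule R_closed)

lemma R_hom: "R S \<in> hom MG MG"
  by (auto simp: hom_def MG_simps R_closed R_mult)

lemma R_complement: assumes "i < k" "m \<in> M" shows "R {i} m * R ({..<k} - {i}) m = m"
proof -
  have "{i} \<union> ({..<k} - {i}) = {..<k}" using assms(1) by auto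
  then show ?thesis using R_union[of "{i}" "{..<k} - {i}" m] R_all[OF assms(2)] assms(2) by simp
qed

text \<open>The complementary homomorphism needed for the minimal operator of block i is
  \<open>R ({..<k} - {i})\<close>.\<close>

lemma levi_rep_discrete_series:
  assumes ds: "discrete_series MG MT sc \<sigma>"
  shows "levi_rep sc (SL n) M (normalizer (SL n) M) \<sigma> X k R perm"
proof -
  have sm: "smooth_representation MG MT sc \<sigma>" and irr: "irreducible_representation MG sc \<sigma>"
    using ds by (auto simp: discrete_series_def)
  interpret S: smooth_rep sc MG MT \<sigma> by (rule smooth_rep_MG[OF sm])
  have N: "g \<in> normalizer (SL n) M \<Longrightarrow> m \<in> M \<Longrightarrow> inv\<^bsub>SL n\<^esub> g * m * g \<in> M" for g m
    using normalizer_mem(4) by blast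
  have conj_hom: "inv\<^bsub>SL n\<^esub> g * (m * l) * g = (inv\<^bsub>SL n\<^esub> g * m * g) * (inv\<^bsub>SL n\<^esub> g * l * g)"
    if g: "g \<in> normalizer (SL n) M" and ml: "m \<in> M" "l \<in> M" for g m l
  proof -
    note gi = SL_inv[OF normalizer_mem(1)[OF g]] and gc = normalizer_mem(2)[OF g]
    have "(inv\<^bsub>SL n\<^esub> g * m * g) * (inv\<^bsub>SL n\<^esub> g * l * g)
        = inv\<^bsub>SL n\<^esub> g * m * (g * inv\<^bsub>SL n\<^esub> g) * (l * g)"
      using gi(1) gc M_carrier(1)[OF ml(1)] M_carrier(1)[OF ml(2)] by (simp add: assoc_square[of _ n])
    also have "\<dots> = inv\<^bsub>SL n\<^esub> g * (m * l) * g"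
      using gi gc M_carrier(1)[OF ml(1)] M_carrier(1)[OF ml(2)] by (simp add: assoc_square[of _ n])
    finally show ?thesis by simp
  qed
  show ?thesis
  proof (intro levi_rep.intro levi_rep_axioms.intro S.complex_vector_space_axioms group_SL)
    show "subgroup M (SL n)" by (rule M_subgroup)
    show "subgroup (normalizer (SL n) M) (SL n)" by (rule normalizer_subgroup)
    show "group_rep (SL n\<lparr>carrier := M\<rparr>) sc \<sigma>" using S.rep unfolding MG_eq .
    show "irreducible_representation (SL n\<lparr>carrier := M\<rparr>) sc \<sigma>" using irr unfolding MG_eq .
    show "(\<lambda>m. \<eta> (inv\<^bsub>SL n\<^esub> g \<otimes>\<^bsub>SL n\<^esub> m \<otimes>\<^bsub>SL n\<^esub> g)) \<in> X" if "\<eta> \<in> X" "g \<in> normalizer (SL n) M" for \<eta> g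
      unfolding SL_simps by (rule X_comp[OF that(1) poly_map_conj[OF that(2)] conj_hom[OF that(2)]])
    show "(\<lambda>m. \<eta> (R {i} m)) \<in> X" if "\<eta> \<in> X" "i < k" for \<eta> i
      by (rule X_comp[OF that(1) poly_map_R R_mult])
    show "\<exists>q'\<in>M. \<forall>m\<in>M. q \<otimes>\<^bsub>SL n\<^esub> R {i} m \<otimes>\<^bsub>SL n\<^esub> inv\<^bsub>SL n\<^esub> q = q' \<otimes>\<^bsub>SL n\<^esub> R {i} m \<otimes>\<^bsub>SL n\<^esub> inv\<^bsub>SL n\<^esub> q'"
      if "q \<in> normalizer (SL n) M" "i < k" "perm q i = i" for q i
      unfolding SL_simps by (rule inner[OF that]) blast
    show "R A m \<otimes>\<^bsub>SL n\<^esub> R B l = R B l \<otimes>\<^bsub>SL n\<^esub> R A m"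
      if "A \<inter> B = {}" "m \<in> M" "l \<in> M" for A B m l
      unfolding SL_simps by (rule R_commute[OF that])
    show "\<exists>p\<in>S.bicommutant (\<sigma> ` R {i} ` M). (\<exists>x. p x \<noteq> 0) \<and>
        (\<forall>m\<in>M. \<exists>c. \<forall>x. p (\<sigma> (R {i} m) (p x)) = sc c (p x))" if i: "i < k" for i
    proof -
      obtain p where p: "p \<in> S.bicommutant (\<sigma> ` R {i} ` carrier MG)" "\<exists>x. p x \<noteq> 0"
        "\<And>g. g \<in> carrier MG \<Longrightarrow> \<exists>c. \<forall>x. p (\<sigma> (R {i} g) (p x)) = sc c (p x)"
      proof (rule S.exists_minimal_operator_discrete_series[OF ds R_hom R_hom
            poly_map_continuous[OF poly_map_R] poly_map_continuous[OF poly_map_R]])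
        show "R {i} g \<otimes>\<^bsub>MG\<^esub> R ({..<k} - {i}) g = g" if "g \<in> carrier MG" for g
          using R_complement[OF i] that by (simp add: MG_simps)
        show "R {i} g \<otimes>\<^bsub>MG\<^esub> R ({..<k} - {i}) h = R ({..<k} - {i}) h \<otimes>\<^bsub>MG\<^esub> R {i} g"
          if "g \<in> carrier MG" "h \<in> carrier MG" for g h
          using R_commute[of "{i}" "{..<k} - {i}" g h] that by (simp add: MG_simps)
        show "topspace MT = carrier MG" by (simp add: topspace_MT MG_simps)
        show "finite ((\<lambda>g. \<sigma> g v) ` integral)" for v by (rule integral_finite_orbits[OF sm])
      qed (use integral_subgroup integral_open in blast)+
      then show ?thesis unfolding MG_simps by blast
    qed
  qed (simp_all add: SL_simps N X_mult X_nonzero X_one X_times X_inverse R_closed R_mult R_empty R_all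
      R_union perm(1) perm_mult R_conj)
qed

text \<open>The abstract result yields an intertwiner from the twist to its conjugate; the symmetry
  of equivalence turns it round.\<close>

lemma exists_fixed_twist:
  assumes ds: "discrete_series MG MT sc \<sigma>"
  shows "\<exists>\<eta>\<in>X. \<forall>g\<in>normalizer (SL n) M.
    (\<exists>\<theta>\<in>X. rep_equiv MG sc (conj_rep (SL n) g \<sigma>) sc (twist sc \<theta> \<sigma>)) \<longrightarrow>
    rep_equiv MG sc (conj_rep (SL n) g (twist sc \<eta> \<sigma>)) sc (twist sc \<eta> \<sigma>)"
proof -
  interpret L: levi_rep sc "SL n" M "normalizer (SL n) M" \<sigma> X k R perm
    by (rule levi_rep_discrete_series[OF ds])
  obtain \<eta> where \<eta>: "\<eta> \<in> X" "\<forall>g\<in>L.stab. \<exists>K. L.lin K \<and> bij K \<and> (\<forall>m\<in>M. \<forall>v.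
      K (sc (\<eta> m) (\<sigma> m v)) = sc (\<eta> (inv\<^bsub>SL n\<^esub> g \<otimes>\<^bsub>SL n\<^esub> m \<otimes>\<^bsub>SL n\<^esub> g))
        (\<sigma> (inv\<^bsub>SL n\<^esub> g \<otimes>\<^bsub>SL n\<^esub> m \<otimes>\<^bsub>SL n\<^esub> g) (K v)))"
    using L.exists_fixed_twist by blast
  have "rep_equiv MG sc (conj_rep (SL n) g (twist sc \<eta> \<sigma>)) sc (twist sc \<eta> \<sigma>)"
    if g: "g \<in> normalizer (SL n) M" and \<theta>: "\<theta> \<in> X"
      and eq: "rep_equiv MG sc (conj_rep (SL n) g \<sigma>) sc (twist sc \<theta> \<sigma>)" for g \<theta>
  proof -
    obtain K where K: "L.lin K" "bij K"
      "\<And>m v. m \<in> carrier MG \<Longrightarrow> K (conj_rep (SL n) g \<sigma> m v) = twist sc \<theta> \<sigma> m (K v)"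
      using rep_equivE[OF eq] by blast
    have "g \<in> L.stab"
      by (rule L.stabI[OF g \<theta> K(1,2)]) (use K(3) in \<open>simp add: conj_rep_def twist_def MG_simps\<close>)
    then obtain K' where K': "L.lin K'" "bij K'" "\<forall>m\<in>M. \<forall>v.
      K' (sc (\<eta> m) (\<sigma> m v)) = sc (\<eta> (inv\<^bsub>SL n\<^esub> g \<otimes>\<^bsub>SL n\<^esub> m \<otimes>\<^bsub>SL n\<^esub> g))
        (\<sigma> (inv\<^bsub>SL n\<^esub> g \<otimes>\<^bsub>SL n\<^esub> m \<otimes>\<^bsub>SL n\<^esub> g) (K' v))"
      using \<eta>(2) by blast
    have "rep_equiv MG sc (twist sc \<eta> \<sigma>) sc (conj_rep (SL n) g (twist sc \<eta> \<sigma>))"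
      by (rule rep_equivI[OF K'(1,2)]) (use K'(3) in \<open>simp add: conj_rep_def twist_def MG_simps\<close>)
    then show ?thesis by (rule rep_equiv_sym[OF L.vector_space_axioms])
  qed
  then show ?thesis using \<eta>(1) by blast
qed

end

section \<open>Block-diagonal subgroups described by their zero pattern\<close>

section \<open>Block sizes given by a list\<close>


fun block_index :: "nat list \<Rightarrow> nat \<Rightarrow> nat" where
  "block_index [] x = 0"
| "block_index (d # ds) x = (if x < d then 0 else Suc (block_index ds (x - d)))"

lemma block_index_less: "x < sum_list ds \<Longrightarrow> block_index ds x < length ds"
  by (induction ds arbitrary: x) auto

lemma card_block_index:
  "i < length ds \<Longrightarrow> card {x. x < sum_list ds \<and> block_index ds x = i} = ds ! i"
proof (induction ds arbitrary: i)
  case (Cons d ds)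
  show ?case
  proof (cases i)
    case 0
    then have "{x. x < sum_list (d # ds) \<and> block_index (d # ds) x = i} = {..<d}"
      by auto
    then show ?thesis using 0 by simp
  next
    case (Suc j)
    have "{x. x < sum_list (d # ds) \<and> block_index (d # ds) x = i}
        = (\<lambda>x. x + d) ` {x. x < sum_list ds \<and> block_index ds x = j}" (is "?A = ?f ` ?B")
    proof (intro equalityI subsetI)
      fix x assume x: "x \<in> ?A"
      then have "d \<le> x" using Suc by (auto split: if_splits)
      then have "x = ?f (x - d)" "x - d \<in> ?B" using x Suc by auto
      then show "x \<in> ?f ` ?B" by blast
    qed (use Suc in auto)
    then have "card ?A = card ?B" by (simp add: card_image)
    then show ?thesis using Cons Suc by simp
  qed
qed simp

lemma invertible_mat_iff_det:
  fixes A :: "'f::field mat"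
  assumes A: "A \<in> carrier_mat d d" shows "invertible_mat A \<longleftrightarrow> det A \<noteq> 0"
proof
  assume "invertible_mat A"
  then obtain B where B: "A * B = 1\<^sub>m d" "B * A = 1\<^sub>m (dim_row B)"
    using A by (auto simp: invertible_mat_def inverts_mat_def)
  have "dim_col B = d" using arg_cong[OF B(1), of dim_col] by simp
  moreover have "dim_row B = d" using arg_cong[OF B(2), of dim_col] A by simp
  ultimately have "det A * det B = 1" using det_mult[of A d B] A B(1) by auto
  then show "det A \<noteq> 0" by auto
next
  assume "det A \<noteq> 0"
  then obtain B where "B \<in> carrier_mat d d" "B * A = 1\<^sub>m d" "A * B = 1\<^sub>m d"
    using det_non_zero_imp_unit[OF A, of "()"] by (auto simp: Units_def ring_mat_def)
  then show "invertible_mat A"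
    using A by (auto simp: invertible_mat_def inverts_mat_def intro!: exI[of _ B])
qed

lemma GL_levi_Nil: "GL_levi [] = {0\<^sub>m 0 0}"
  by (simp add: GL_levi_def)

lemma GL_levi_Cons:
  "A \<in> GL_levi (d # ds) \<longleftrightarrow> (\<exists>B A'. B \<in> carrier_mat d d \<and> invertible_mat B \<and> A' \<in> GL_levi ds \<and>
    A = four_block_mat B (0\<^sub>m d (dim_col A')) (0\<^sub>m (dim_row A') d) A')"
proof
  assume "A \<in> GL_levi (d # ds)"
  then obtain Bs where "A = diag_block_mat Bs"
    "list_all2 (\<lambda>B d. B \<in> carrier_mat d d \<and> invertible_mat B) Bs (d # ds)"
    by (auto simp: GL_levi_def)
  then obtain B Bs' where B: "B \<in> carrier_mat d d" "invertible_mat B" "A = diag_block_mat (B # Bs')"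
    "list_all2 (\<lambda>B d. B \<in> carrier_mat d d \<and> invertible_mat B) Bs' ds"
    by (auto simp: list_all2_Cons2)
  have "diag_block_mat Bs' \<in> GL_levi ds" using B(4) by (auto simp: GL_levi_def)
  moreover have "A = four_block_mat B (0\<^sub>m d (dim_col (diag_block_mat Bs')))
      (0\<^sub>m (dim_row (diag_block_mat Bs')) d) (diag_block_mat Bs')"
    using B(1,3) by (simp add: Let_def)
  ultimately show "\<exists>B A'. B \<in> carrier_mat d d \<and> invertible_mat B \<and> A' \<in> GL_levi ds \<and>
    A = four_block_mat B (0\<^sub>m d (dim_col A')) (0\<^sub>m (dim_row A') d) A'"
    using B(1,2) by blast
next
  assume "\<exists>B A'. B \<in> carrier_mat d d \<and> invertible_mat B \<and> A' \<in> GL_levi ds \<and>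
    A = four_block_mat B (0\<^sub>m d (dim_col A')) (0\<^sub>m (dim_row A') d) A'"
  then obtain B Bs where B: "B \<in> carrier_mat d d" "invertible_mat B"
    "list_all2 (\<lambda>B d. B \<in> carrier_mat d d \<and> invertible_mat B) Bs ds"
    "A = four_block_mat B (0\<^sub>m d (dim_col (diag_block_mat Bs))) (0\<^sub>m (dim_row (diag_block_mat Bs)) d)
      (diag_block_mat Bs)"
    by (auto simp: GL_levi_def)
  have "A = diag_block_mat (B # Bs)" using B(1,4) by (simp add: Let_def)
  then show "A \<in> GL_levi (d # ds)"
    using B(1-3) by (auto simp: GL_levi_def intro!: exI[of _ "B # Bs"])
qed

text \<open>The first block is split off: determinants multiply, and an off-diagonal corner vanishes
  because its rows and columns carry different block labels.\<close>

lemma GL_levi_iff: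
  fixes A :: "'f::field mat"
  shows "A \<in> GL_levi ds \<longleftrightarrow> A \<in> carrier_mat (sum_list ds) (sum_list ds) \<and> det A \<noteq> 0 \<and>
    (\<forall>x<sum_list ds. \<forall>y<sum_list ds. block_index ds x \<noteq> block_index ds y \<longrightarrow> A $$ (x, y) = 0)"
proof (induction ds arbitrary: A)
  case Nil
  have "A = 0\<^sub>m 0 0" if "A \<in> carrier_mat 0 0" for A :: "'f mat" using that by (intro eq_matI) auto
  moreover have "det (0\<^sub>m 0 0 :: 'f mat) = 1" by (rule det_dim_zero) simp
  ultimately show ?case by (auto simp: GL_levi_Nil)
next
  case (Cons d ds)
  let ?s = "sum_list ds"
  show ?case
  proof
    assume "A \<in> GL_levi (d # ds)"
    then obtain B A' where B: "B \<in> carrier_mat d d" "invertible_mat B" "A' \<in> GL_levi ds"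
      "A = four_block_mat B (0\<^sub>m d (dim_col A')) (0\<^sub>m (dim_row A') d) A'"
      unfolding GL_levi_Cons by blast
    have A': "A' \<in> carrier_mat ?s ?s" "det A' \<noteq> 0"
      "\<And>x y. x < ?s \<Longrightarrow> y < ?s \<Longrightarrow> block_index ds x \<noteq> block_index ds y \<Longrightarrow> A' $$ (x, y) = 0"
      using B(3) unfolding Cons.IH by auto
    have AA: "A = four_block_mat B (0\<^sub>m d ?s) (0\<^sub>m ?s d) A'" using B(4) A'(1) by simp
    have "det A = det B * det A'"
      unfolding AA using B(1) A'(1) by (intro det_four_block_mat_lower_left_zero) auto
    then have "det A \<noteq> 0" using A'(2) B(1,2) invertible_mat_iff_det by auto
    moreover have "A $$ (x, y) = 0"
      if "x < sum_list (d # ds)" "y < sum_list (d # ds)" "block_index (d # ds) x \<noteq> block_index (d # ds) y" for x y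
      using that B(1) A' unfolding AA by (auto split: if_splits)
    moreover have "A \<in> carrier_mat (sum_list (d # ds)) (sum_list (d # ds))"
      unfolding AA using B(1) A'(1) by simp
    ultimately show "A \<in> carrier_mat (sum_list (d # ds)) (sum_list (d # ds)) \<and> det A \<noteq> 0 \<and>
      (\<forall>x<sum_list (d # ds). \<forall>y<sum_list (d # ds).
        block_index (d # ds) x \<noteq> block_index (d # ds) y \<longrightarrow> A $$ (x, y) = 0)" by blast
  next
    assume A: "A \<in> carrier_mat (sum_list (d # ds)) (sum_list (d # ds)) \<and> det A \<noteq> 0 \<and>
      (\<forall>x<sum_list (d # ds). \<forall>y<sum_list (d # ds).
        block_index (d # ds) x \<noteq> block_index (d # ds) y \<longrightarrow> A $$ (x, y) = 0)"
    then have dims: "dim_row A = d + ?s" "dim_col A = d + ?s" by auto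
    have zero: "A $$ (x, y) = 0" if "x < d + ?s" "y < d + ?s"
      "block_index (d # ds) x \<noteq> block_index (d # ds) y" for x y
      using A that by (metis sum_list.Cons)
    obtain A1 A2 A3 A4 where sp: "split_block A d d = (A1, A2, A3, A4)" by (metis prod_cases4)
    note sb = split_block[OF sp dims]
    have idx: "A $$ (x, y) = four_block_mat A1 A2 A3 A4 $$ (x, y)" for x y using sb(5) by simp
    have "A2 = 0\<^sub>m d ?s"
    proof (rule eq_matI)
      fix i j assume "i < dim_row (0\<^sub>m d ?s :: 'f mat)" "j < dim_col (0\<^sub>m d ?s :: 'f mat)"
      then show "A2 $$ (i, j) = 0\<^sub>m d ?s $$ (i, j)"
        using zero[of i "j + d"] idx[of i "j + d"] sb(1-4) by simp
    qed (use sb in auto)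
    moreover have "A3 = 0\<^sub>m ?s d"
    proof (rule eq_matI)
      fix i j assume "i < dim_row (0\<^sub>m ?s d :: 'f mat)" "j < dim_col (0\<^sub>m ?s d :: 'f mat)"
      then show "A3 $$ (i, j) = 0\<^sub>m ?s d $$ (i, j)"
        using zero[of "i + d" j] idx[of "i + d" j] sb(1-4) by simp
    qed (use sb in auto)
    ultimately have AA: "A = four_block_mat A1 (0\<^sub>m d ?s) (0\<^sub>m ?s d) A4" using sb(5) by simp
    have "det A = det A1 * det A4"
      unfolding AA using sb(1,4) by (intro det_four_block_mat_lower_left_zero) auto
    then have d: "det A1 \<noteq> 0" "det A4 \<noteq> 0" using A by auto
    have "A4 $$ (x, y) = 0" if "x < ?s" "y < ?s" "block_index ds x \<noteq> block_index ds y" for x y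
      using zero[of "x + d" "y + d"] idx[of "x + d" "y + d"] sb(1-4) that by simp
    then have "A4 \<in> GL_levi ds" unfolding Cons.IH using sb(4) d(2) by blast
    moreover have "invertible_mat A1" using d(1) invertible_mat_iff_det[OF sb(1)] by simp
    moreover have "A = four_block_mat A1 (0\<^sub>m d (dim_col A4)) (0\<^sub>m (dim_row A4) d) A4"
      using AA sb(4) by simp
    ultimately show "A \<in> GL_levi (d # ds)" unfolding GL_levi_Cons using sb(1) by blast
  qed
qed

lemma block_structure_list:
  assumes "n = sum_list ds" "\<forall>d\<in>set ds. 0 < d"
  shows "block_structure n (length ds) (block_index ds)"
proof
  show "block_index ds x < length ds" if "x < n" for x using block_index_less that assms(1) by simp
  show "\<exists>x<n. block_index ds x = i" if i: "i < length ds" for i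
  proof -
    have "card {x. x < sum_list ds \<and> block_index ds x = i} \<noteq> 0"
      using card_block_index[OF i] assms(2) i by auto
    then have "{x. x < sum_list ds \<and> block_index ds x = i} \<noteq> {}" by (metis card.empty)
    then show ?thesis using assms(1) by blast
  qed
qed

lemma levi_block_list:
  fixes av :: "'f::field_char_0 \<Rightarrow> real"
  assumes "nonarch_local_field av" "n = sum_list ds" "\<forall>d\<in>set ds. 0 < d"
  shows "levi_block n (length ds) (block_index ds) av ds"
proof -
  interpret block_structure n "length ds" "block_index ds" "TYPE('f)"
    by (rule block_structure_list[OF assms(2,3)])
  have "SL_levi n ds = (M :: 'f mat set)"
    unfolding SL_levi_def M_def by (auto simp: GL_levi_iff SL_simps bd_def assms(2)[symmetric])
  then show ?thesis
    by (intro levi_block.intro levi_block_axioms.intro block_structure_axioms assms(1))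
qed

section \<open>Discreteness of the valuation, unit parts and the case of the torus\<close>

section \<open>The diagonal torus\<close>


context nonarch_local_field begin

text \<open>Total boundedness forces the value group to be discrete: elements of value at least
  \<epsilon> in a common ball of radius \<epsilon> have equal value, so only finitely many values
  lie in the interval from \<epsilon> up to 1. The largest value below 1 generates.\<close>

lemma exists_uniformizer:
  "\<exists>\<rho>. \<rho> \<noteq> 0 \<and> av \<rho> < 1 \<and> (\<forall>x. x \<noteq> 0 \<longrightarrow> (\<exists>j::int. av x = av \<rho> powi j))"
proof -
  obtain x1 where x1: "x1 \<noteq> 0" "av x1 < 1" using exists_av_less_one by blast
  define \<epsilon> where "\<epsilon> = av x1"
  have \<epsilon>: "0 < \<epsilon>" "\<epsilon> < 1" using x1 av_pos by (simp_all add: \<epsilon>_def)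
  obtain C where C: "finite C" "\<forall>x. av x \<le> 1 \<longrightarrow> (\<exists>c\<in>C. av (x - c) < \<epsilon>)"
    using integers_totally_bounded[OF \<epsilon>(1)] by blast
  define V where "V = {av x | x. \<epsilon> \<le> av x \<and> av x < 1}"
  have same: "av x \<le> av y" if "av (x - c) < \<epsilon>" "av (y - c) < \<epsilon>" "\<epsilon> \<le> av x" for x y c
  proof -
    have "av (x - y) < \<epsilon>" using av_diff[of "x - c" "y - c"] that(1,2) by simp
    then show ?thesis using av_ultra[of "x - y" y] that(3) by simp
  qed
  have "V \<subseteq> (\<lambda>c. SOME v. \<exists>x. v = av x \<and> \<epsilon> \<le> av x \<and> av (x - c) < \<epsilon>) ` C"
  proof
    fix v assume "v \<in> V"
    then obtain x where x: "v = av x" "\<epsilon> \<le> av x" "av x < 1" by (auto simp: V_def)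
    then obtain c where c: "c \<in> C" "av (x - c) < \<epsilon>" using C(2) by force
    let ?w = "SOME v. \<exists>x. v = av x \<and> \<epsilon> \<le> av x \<and> av (x - c) < \<epsilon>"
    have "\<exists>x. ?w = av x \<and> \<epsilon> \<le> av x \<and> av (x - c) < \<epsilon>"
      by (rule someI[of _ v]) (use x c in blast)
    then obtain y where "?w = av y" "\<epsilon> \<le> av y" "av (y - c) < \<epsilon>" by blast
    then have "v = ?w" using same[OF c(2), of y] same[of y c x] x c(2) by force
    then show "v \<in> (\<lambda>c. SOME v. \<exists>x. v = av x \<and> \<epsilon> \<le> av x \<and> av (x - c) < \<epsilon>) ` C" using c(1) by blast
  qed
  then have V: "finite V" using C(1) finite_subset by blast
  have "\<epsilon> \<in> V" using \<epsilon> by (auto simp: V_def \<epsilon>_def)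
  then have "Max V \<in> V" using V by (intro Max_in) auto
  then obtain \<rho> where \<rho>: "av \<rho> = Max V" "\<epsilon> \<le> av \<rho>" "av \<rho> < 1" by (auto simp: V_def)
  define q where "q = av \<rho>"
  have q: "0 < q" "q < 1" using \<rho> \<epsilon> by (auto simp: q_def)
  have max: "av y \<le> q" if "av y < 1" for y
  proof (cases "\<epsilon> \<le> av y")
    case True
    then have "av y \<in> V" using that by (auto simp: V_def)
    then show ?thesis using V \<rho>(1) by (simp add: q_def)
  next
    case False
    then show ?thesis using \<rho>(2) by (simp add: q_def)
  qed
  have \<rho>0: "\<rho> \<noteq> 0" using q av_zero by (auto simp: q_def)
  show ?thesis
  proof (intro exI[of _ \<rho>] conjI allI impI \<rho>0 \<rho>(3))
    fix x :: 'f assume x: "x \<noteq> 0"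
    \<comment> \<open>With j the integer part of the logarithm of av x to the base q, the element y
      = x * \<rho> powi (- j) satisfies q < av y \<le> 1; as no value lies strictly between q and 1,
      av y is 1.\<close>
    define t where "t = ln (av x) / ln q"
    define j where "j = \<lfloor>t\<rfloor>"
    have lnq: "ln q < 0" using q by simp
    have "ln (av x) = t * ln q" using lnq by (simp add: t_def)
    then have "exp (ln (av x)) = q powr t" using q by (simp add: powr_def)
    then have ax: "av x = q powr t" using av_pos[OF x] by simp
    have powi: "q powi i = q powr of_int i" for i using q by (simp add: powr_real_of_int')
    have "q powr t \<le> q powr of_int j" using q by (intro powr_mono') (simp_all add: j_def)
    moreover have "q powr (of_int j + 1) < q powr t"
      using q by (intro powr_less_mono') (simp_all add: j_def)
    ultimately have b: "av x \<le> q powi j" "q powi (j + 1) < av x"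
      by (simp_all only: ax powi of_int_add of_int_1)
    define y where "y = x * \<rho> powi (- j)"
    have av_powi: "av (\<rho> powi i) = q powi i" for i
      using \<rho>0 by (simp add: power_int_def av_power av_inverse q_def)
    have ay: "av y * q powi j = av x"
    proof -
      have "q powi (- j) * q powi j = 1" using q by (simp add: power_int_minus)
      then show ?thesis unfolding y_def av_mult av_powi mult.assoc by simp
    qed
    have "q powi j > 0" using q by simp
    have "av y * q powi j \<le> 1 * q powi j" using b(1) ay by simp
    then have "av y \<le> 1" using \<open>q powi j > 0\<close> by (rule mult_right_le_imp_le)
    moreover have "q < av y"
    proof -
      have "q * q powi j < av y * q powi j" using b(2) ay q by (simp add: power_int_add mult.commute)
      then show ?thesis using \<open>q powi j > 0\<close> by simp
    qed
    ultimately have "av y = 1" using max[of y] by force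
    then show "\<exists>j::int. av x = av \<rho> powi j" using ay by (intro exI[of _ j]) (simp add: q_def)
  qed
qed

text \<open>The map x \<mapsto> x * \<rho> powi (- v x) projects the multiplicative group onto the
  units along the powers of a uniformiser \<rho>.\<close>

lemma exists_unit_part:
  "\<exists>\<kappa>. (\<forall>x y. x \<noteq> 0 \<longrightarrow> y \<noteq> 0 \<longrightarrow> \<kappa> (x * y) = \<kappa> x * \<kappa> y) \<and>
    (\<forall>x. x \<noteq> 0 \<longrightarrow> av (\<kappa> x) = 1) \<and> (\<forall>x. av x = 1 \<longrightarrow> \<kappa> x = x)"
proof -
  obtain \<rho> where \<rho>: "\<rho> \<noteq> 0" "av \<rho> < 1" "\<And>x. x \<noteq> 0 \<Longrightarrow> \<exists>j::int. av x = av \<rho> powi j"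
    using exists_uniformizer by blast
  define q where "q = av \<rho>"
  have q: "0 < q" "q < 1" using \<rho> av_pos by (simp_all add: q_def)
  have uniq: "i = j" if "q powi i = q powi j" for i j
  proof -
    have "q powi (i - j) = 1" using that q by (simp add: power_int_diff)
    moreover have "q powi (i - j) = q powr of_int (i - j)"
      by (rule powr_real_of_int'[symmetric]) (use q in auto)
    ultimately have "exp (of_int (i - j) * ln q) = 1" using q by (simp add: powr_def)
    then have "of_int (i - j) * ln q = 0" by (simp only: exp_eq_one_iff)
    then show ?thesis using q by simp
  qed
  define v where "v = (\<lambda>x. SOME j::int. av x = q powi j)"
  have v: "av x = q powi v x" if "x \<noteq> 0" for x
    using someI_ex[OF \<rho>(3)[OF that]] by (simp add: v_def q_def)
  have v_mult: "v (x * y) = v x + v y" if "x \<noteq> 0" "y \<noteq> 0" for x y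
    using v[of x] v[of y] v[of "x * y"] that q by (intro uniq) (simp add: av_mult power_int_add)
  define \<kappa> where "\<kappa> = (\<lambda>x. x * \<rho> powi (- v x))"
  have av_powi: "av (\<rho> powi i) = q powi i" for i
    using \<rho>(1) by (simp add: power_int_def av_power av_inverse q_def)
  show ?thesis
  proof (intro exI[of _ \<kappa>] conjI allI impI)
    fix x y :: 'f assume "x \<noteq> 0" "y \<noteq> 0"
    then show "\<kappa> (x * y) = \<kappa> x * \<kappa> y"
      using \<rho>(1) by (simp add: \<kappa>_def v_mult power_int_diff power_int_minus power_int_add)
  next
    fix x :: 'f assume x: "x \<noteq> 0"
    show "av (\<kappa> x) = 1"
      unfolding \<kappa>_def av_mult av_powi v[OF x] using q by (simp add: power_int_minus)
  next
    fix x :: 'f assume x: "av x = 1"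
    then have "x \<noteq> 0" using av_zero by auto
    then have "q powi v x = q powi 0" using v[of x] x by simp
    then have "v x = 0" by (rule uniq)
    then show "\<kappa> x = x" by (simp add: \<kappa>_def)
  qed
qed

end

context levi_block begin

lemma poly_funs_bounded_on_integral:
  assumes "p \<in> poly_funs n"
  shows "\<exists>b>0. \<forall>A\<in>integral. av (p A) \<le> b"
  using assms
proof induction
  case (const c)
  then show ?case using av_nonneg[of c] by (intro exI[of _ "av c + 1"]) simp
next
  case (entry i j)
  then show ?case by (intro exI[of _ 1]) (simp add: integral_def)
next
  case (add p q)
  then obtain a b where ab: "a > 0" "b > 0" "\<forall>A\<in>integral. av (p A) \<le> a" "\<forall>A\<in>integral. av (q A) \<le> b" by blast
  have "av (p A + q A) \<le> max a b" if "A \<in> integral" for A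
    using av_ultra[of "p A" "q A"] ab(3,4) that by (meson max.mono order_trans)
  then show ?case using ab(1) by (intro exI[of _ "max a b"]) auto
next
  case (mult p q)
  then obtain a b where ab: "a > 0" "b > 0" "\<forall>A\<in>integral. av (p A) \<le> a" "\<forall>A\<in>integral. av (q A) \<le> b" by blast
  then show ?case using av_nonneg by (intro exI[of _ "a * b"]) (auto simp: av_mult intro!: mult_mono)
qed

text \<open>A rational character is polynomial, hence bounded on the integral points; but these form
  a group, on which a value larger than 1 would have unbounded powers. The inverse gives the other
  inequality.\<close>

lemma integral_subset_SL_levi_1: "integral \<subseteq> SL_levi_1 av n ds"
proof
  fix A assume A: "A \<in> integral"
  have le: "av (\<psi> B) \<le> 1" if \<psi>: "\<psi> \<in> rational_characters n ds" and B: "B \<in> integral" for \<psi> B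
  proof (rule ccontr)
    assume "\<not> av (\<psi> B) \<le> 1"
    then have gt: "1 < av (\<psi> B)" by simp
    obtain p where p: "p \<in> poly_funs n" "\<forall>m\<in>M. \<psi> m = p m" and hom: "\<psi> \<in> hom MG units_group"
      using \<psi> by (auto simp: rational_characters_def M_eq)
    obtain b where b: "b > 0" "\<forall>A\<in>integral. av (p A) \<le> b"
      using poly_funs_bounded_on_integral[OF p(1)] by blast
    have one: "\<psi> (1\<^sub>m n) = 1"
      using hom M_one by (auto simp: hom_def MG_simps units_group_def Pi_def dest!: bspec[of _ _ "1\<^sub>m n"])
    have pow: "\<exists>D\<in>integral. \<psi> D = \<psi> B ^ N" for N
    proof (induction N)
      case 0
      then show ?case using subgroup.one_closed[OF integral_subgroup] one by (auto simp: MG_simps)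
    next
      case (Suc N)
      then obtain D where D: "D \<in> integral" "\<psi> D = \<psi> B ^ N" by blast
      have "\<psi> (B * D) = \<psi> B * \<psi> D"
        using hom B D(1) by (simp add: hom_def MG_simps units_group_def integral_def)
      moreover have "B * D \<in> integral"
        using subgroup.m_closed[OF integral_subgroup B D(1)] by (simp add: MG_simps)
      ultimately show ?case using D(2) by auto
    qed
    obtain N where "b < av (\<psi> B) ^ N" using real_arch_pow[OF gt] by blast
    moreover obtain D where D: "D \<in> integral" "\<psi> D = \<psi> B ^ N" using pow by blast
    ultimately show False using b(2) p(2) D av_power[of "\<psi> B" N] by (fastforce simp: integral_def)
  qed
  have "av (\<psi> A) = 1" if \<psi>: "\<psi> \<in> rational_characters n ds" for \<psi>
  proof -
    have AM: "A \<in> M" using A by (simp add: integral_def)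
    note Ai = SL_inv[OF M_carrier(4)[OF AM]]
    have hom: "\<psi> \<in> hom MG units_group" using \<psi> by (simp add: rational_characters_def)
    have one: "\<psi> (1\<^sub>m n) = 1"
      using hom M_one by (auto simp: hom_def MG_simps units_group_def Pi_def dest!: bspec[of _ _ "1\<^sub>m n"])
    have "\<psi> (A * inv\<^bsub>SL n\<^esub> A) = \<psi> A * \<psi> (inv\<^bsub>SL n\<^esub> A)"
      using hom AM M_inv[OF AM] by (simp add: hom_def MG_simps units_group_def)
    then have "av (\<psi> A) * av (\<psi> (inv\<^bsub>SL n\<^esub> A)) = 1"
      using Ai(4) one by (simp add: av_one flip: av_mult)
    moreover have "av (\<psi> A) \<le> 1" "av (\<psi> (inv\<^bsub>SL n\<^esub> A)) \<le> 1"
      using le[OF \<psi> A] le[OF \<psi> integral_inv[OF A]] .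
    ultimately show ?thesis
      using mult_mono[of "av (\<psi> A)" "av (\<psi> A)" "av (\<psi> (inv\<^bsub>SL n\<^esub> A))" 1] av_nonneg[of "\<psi> A"]
        av_nonneg[of "\<psi> (inv\<^bsub>SL n\<^esub> A)"] by simp
  qed
  then show "A \<in> SL_levi_1 av n ds" using A by (simp add: SL_levi_1_def M_eq integral_def)
qed

text \<open>For the torus, \<open>\<sigma>\<close> is a character \<open>\<omega>\<close>; it is replaced by the character which agrees with
  \<open>\<omega>\<close> on the units and is trivial on the diagonal matrices of powers of a uniformiser.\<close>

lemma exists_fixed_twist_torus:
  fixes sc :: "complex \<Rightarrow> 'v \<Rightarrow> 'v::ab_group_add"
  assumes ds: "discrete_series MG MT sc \<sigma>" and inj: "inj_on blk {..<n}"
  shows "\<exists>\<eta>\<in>X. \<forall>g\<in>normalizer (SL n) M.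
    (\<exists>\<theta>\<in>X. rep_equiv MG sc (conj_rep (SL n) g \<sigma>) sc (twist sc \<theta> \<sigma>)) \<longrightarrow>
    rep_equiv MG sc (conj_rep (SL n) g (twist sc \<eta> \<sigma>)) sc (twist sc \<eta> \<sigma>)"
proof -
  have irr: "irreducible_representation MG sc \<sigma>" and rep: "group_rep MG sc \<sigma>"
    and cen: "\<And>z. z \<in> center MG \<Longrightarrow> \<exists>c. norm c = 1 \<and> (\<forall>v. \<sigma> z v = sc c v)"
    using ds by (auto simp: discrete_series_def smooth_representation_def)
  interpret complex_vector_space sc
    using rep by (intro complex_vector_space.intro) (simp add: group_rep_def)
  obtain v0 where v0: "v0 \<noteq> (0 :: 'v)" using irr unfolding irreducible_representation_def by blast
  obtain \<kappa> where "(\<forall>x y. x \<noteq> 0 \<longrightarrow> y \<noteq> 0 \<longrightarrow> \<kappa> (x * y) = \<kappa> x * \<kappa> y) \<and>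
    (\<forall>x. x \<noteq> 0 \<longrightarrow> av (\<kappa> x) = 1) \<and> (\<forall>x. av x = 1 \<longrightarrow> \<kappa> x = x)"
    using exists_unit_part by (elim exE)
  then have \<kappa>: "x \<noteq> 0 \<Longrightarrow> y \<noteq> 0 \<Longrightarrow> \<kappa> (x * y) = \<kappa> x * \<kappa> y"
    "x \<noteq> 0 \<Longrightarrow> av (\<kappa> x) = 1" "av x = 1 \<Longrightarrow> \<kappa> x = x" for x y
    by simp_all
  define diag where "diag = (\<lambda>f. dmat n (\<lambda>x. f (blk x)) :: 'f mat)"
  have ex: "\<exists>f. m = diag f" if m: "m \<in> M" for m
  proof (intro exI[of _ "\<lambda>i. m $$ (inv_into {..<n} blk i, inv_into {..<n} blk i)"] mat_eqI[of _ n])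
    fix x y assume xy: "x < n" "y < n"
    have "m $$ (x, y) = 0" if "x \<noteq> y"
      using M_carrier(3)[OF m] xy inj that by (auto simp: bd_def inj_on_def)
    then show "m $$ (x, y) = diag (\<lambda>i. m $$ (inv_into {..<n} blk i, inv_into {..<n} blk i)) $$ (x, y)"
      using xy inj by (simp add: diag_def)
  qed (use M_carrier[OF m] in \<open>simp_all add: diag_def\<close>)
  have diag_M: "diag f \<in> M \<longleftrightarrow> (\<Prod>x<n. f (blk x)) = 1" for f
    using det_dmat[of n "\<lambda>x. f (blk x)"] by (auto simp: diag_def M_def SL_simps bd_def)
  have diag_mult: "diag f * diag g = diag (\<lambda>i. f i * g i)" for f g
    by (simp add: diag_def dmat_mult)
  have diag_nz: "f (blk x) \<noteq> 0" if "diag f \<in> M" "x < n" for f x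
  proof
    assume "f (blk x) = 0"
    then have "(\<Prod>x<n. f (blk x)) = 0" using that(2) by (intro prod_zero) auto
    then show False using that(1) unfolding diag_M by simp
  qed
  define K where "K = (\<lambda>m :: 'f mat. dmat n (\<lambda>x. \<kappa> (m $$ (x, x))))"
  have K_diag: "K (diag f) = diag (\<lambda>i. \<kappa> (f i))" for f
    by (rule mat_eqI[of _ n]) (auto simp: K_def diag_def)
  have \<kappa>1: "\<kappa> 1 = 1" by (rule \<kappa>(3)) (rule av_one)
  have \<kappa>_prod: "\<kappa> (\<Prod>x\<in>A. f x) = (\<Prod>x\<in>A. \<kappa> (f x))" if "finite A" "\<And>x. x \<in> A \<Longrightarrow> f x \<noteq> 0" for A :: "nat set" and f
    using that by (induction A) (simp_all add: \<kappa>(1) \<kappa>1)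
  have K_M: "K m \<in> M" and K_int: "K m \<in> integral" if m: "m \<in> M" for m
  proof -
    obtain f where f: "m = diag f" using ex[OF m] by blast
    have "(\<Prod>x<n. \<kappa> (f (blk x))) = \<kappa> (\<Prod>x<n. f (blk x))"
      by (rule \<kappa>_prod[symmetric]) (use diag_nz m f in auto)
    then show KM: "K m \<in> M" using m \<kappa>1 unfolding f K_diag diag_M by simp
    have "av (K m $$ (x, y)) \<le> 1" if "x < n" "y < n" for x y
    proof -
      have "f (blk x) \<noteq> 0" using diag_nz[of f x] m f that by simp
      then have "av (diag (\<lambda>i. \<kappa> (f i)) $$ (x, y)) \<le> 1"
        using that \<kappa>(2)[of "f (blk x)"] by (auto simp: diag_def av_zero)
      then show ?thesis unfolding f K_diag .
    qed
    then show "K m \<in> integral" using KM by (simp add: integral_def)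
  qed
  have K_mult: "K (m * l) = K m * K l" if ml: "m \<in> M" "l \<in> M" for m l
  proof -
    obtain f g where fg: "m = diag f" "l = diag g" using ex ml by blast
    have "\<kappa> (f (blk x) * g (blk x)) = \<kappa> (f (blk x)) * \<kappa> (g (blk x))" if "x < n" for x
      using diag_nz[of f x] diag_nz[of g x] ml fg that by (intro \<kappa>(1)) auto
    then show ?thesis unfolding fg K_diag diag_mult
      by (intro mat_eqI[of _ n]) (auto simp: diag_def)
  qed
  have comm: "m * l = l * m" if ml: "m \<in> M" "l \<in> M" for m l
  proof -
    obtain f g where fg: "m = diag f" "l = diag g" using ex ml by blast
    show ?thesis unfolding fg diag_mult by (simp add: mult.commute)
  qed
  \<comment> \<open>M is commutative, hence equal to its centre, and the unitarity of the central
    character makes \<sigma> a unitary character \<omega> times the identity.\<close>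
  have "\<forall>m\<in>M. \<exists>c. norm c = 1 \<and> (\<forall>v. \<sigma> m v = sc c v)"
    using cen comm by (simp add: center_def MG_simps)
  from bchoice[OF this] obtain \<omega> where "\<forall>m\<in>M. norm (\<omega> m) = 1 \<and> (\<forall>v. \<sigma> m v = sc (\<omega> m) v)" by blast
  then have \<omega>: "norm (\<omega> m) = 1" "\<sigma> m v = sc (\<omega> m) v" if "m \<in> M" for m v using that by auto
  have \<omega>_nz: "\<omega> m \<noteq> 0" if "m \<in> M" for m using \<omega>(1)[OF that] by auto
  have \<omega>_mult: "\<omega> (m * l) = \<omega> m * \<omega> l" if ml: "m \<in> M" "l \<in> M" for m l
  proof -
    have "\<sigma> (m * l) v0 = \<sigma> m (\<sigma> l v0)" using rep ml by (simp add: group_rep_def MG_simps)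
    then have "sc (\<omega> (m * l)) v0 = sc (\<omega> m * \<omega> l) v0" using ml M_mult by (simp add: \<omega>(2))
    then show ?thesis using v0 by simp
  qed
  define \<eta> where "\<eta> = (\<lambda>m. \<omega> (K m) * inverse (\<omega> m))"
  have "\<eta> \<in> X" unfolding X_iff
  proof (intro conjI ballI)
    show "\<eta> (m * l) = \<eta> m * \<eta> l" if "m \<in> M" "l \<in> M" for m l
      using that K_M by (simp add: \<eta>_def K_mult \<omega>_mult)
    show "norm (\<eta> m) = 1" if "m \<in> M" for m
      using that K_M \<omega>(1) by (simp add: \<eta>_def norm_mult norm_inverse)
    show "\<eta> m = 1" if m: "m \<in> SL_levi_1 av n ds" for m
    proof -
      have mM: "m \<in> M" using m by (simp add: SL_levi_1_def M_eq)
      \<comment> \<open>The diagonal entries are themselves rational characters, so on M^1 they are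
        units and K m = m.\<close>
      have "av (m $$ (x, x)) = 1" if x: "x < n" for x
      proof -
        have "(\<lambda>m :: 'f mat. m $$ (x, x)) \<in> hom MG units_group"
        proof -
          have "m $$ (x, x) \<noteq> 0" if m: "m \<in> M" for m
          proof -
            obtain f where f: "m = diag f" using ex[OF m] by blast
            have "f (blk x) \<noteq> 0" using diag_nz[of f x] m x f by simp
            then show ?thesis unfolding f diag_def using x by simp
          qed
          moreover have "(m * l) $$ (x, x) = m $$ (x, x) * l $$ (x, x)" if ml: "m \<in> M" "l \<in> M" for m l
          proof -
            obtain f g where fg: "m = diag f" "l = diag g" using ex ml by blast
            show ?thesis unfolding fg diag_mult using x by (simp add: diag_def)
          qed
          ultimately show ?thesis by (simp add: hom_def MG_simps units_group_def)
        qed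
        then have "(\<lambda>m :: 'f mat. m $$ (x, x)) \<in> rational_characters n ds"
          using poly_funs.entry[OF x x] by (auto simp: rational_characters_def)
        then show ?thesis using m by (auto simp: SL_levi_1_def)
      qed
      then have "K m = m"
        using M_carrier[OF mM] ex[OF mM] by (intro mat_eqI[of _ n]) (auto simp: K_def \<kappa>(3) diag_def)
      then show ?thesis using \<omega>_nz[OF mM] by (simp add: \<eta>_def)
    qed
  qed
  moreover have "rep_equiv MG sc (conj_rep (SL n) g (twist sc \<eta> \<sigma>)) sc (twist sc \<eta> \<sigma>)"
    if g: "g \<in> normalizer (SL n) M" and \<theta>: "\<theta> \<in> X"
      and eq: "rep_equiv MG sc (conj_rep (SL n) g \<sigma>) sc (twist sc \<theta> \<sigma>)" for g \<theta>
  proof -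
    let ?\<phi> = "\<lambda>m. inv\<^bsub>SL n\<^esub> g * m * g"
    note gi = SL_inv[OF normalizer_mem(1)[OF g]] and gc = normalizer_mem(2)[OF g]
    have \<phi>M: "?\<phi> m \<in> M" if "m \<in> M" for m by (rule normalizer_mem(4)[OF g that])
    have \<phi>_diag: "?\<phi> (diag f) = diag (\<lambda>i. f (perm g i))" for f
    proof -
      have "diag f * g = g * diag (\<lambda>i. f (perm g i))"
        unfolding diag_def by (rule perm_dmat_commute[OF g]) simp
      then have "?\<phi> (diag f) = (inv\<^bsub>SL n\<^esub> g * g) * diag (\<lambda>i. f (perm g i))"
        using gi(1) gc by (simp add: assoc_square[of _ n] diag_def)
      then show ?thesis using gi(3) by (simp add: diag_def)
    qed
    have K\<phi>: "K (?\<phi> m) = ?\<phi> (K m)" if m: "m \<in> M" for m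
    proof -
      obtain f where f: "m = diag f" using ex[OF m] by blast
      show ?thesis unfolding f \<phi>_diag K_diag ..
    qed
    obtain L where L: "lin L" "bij L"
      "\<And>m v. m \<in> carrier MG \<Longrightarrow> L (conj_rep (SL n) g \<sigma> m v) = twist sc \<theta> \<sigma> m (L v)"
      using rep_equivE[OF eq] by blast
    have \<omega>\<phi>: "\<omega> (?\<phi> m) = \<theta> m * \<omega> m" if m: "m \<in> M" for m
    proof -
      have "sc (\<omega> (?\<phi> m)) (L v0) = sc (\<theta> m * \<omega> m) (L v0)"
        using L(3)[of m v0] m \<phi>M[OF m]
        by (simp add: MG_simps conj_rep_def twist_def SL_simps \<omega>(2) lin_scale[OF L(1)])
      moreover have "L v0 \<noteq> 0"
        using v0 lin_zero[OF L(1)] bij_is_inj[OF L(2)] by (metis injD)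
      ultimately show ?thesis by simp
    qed
    have fixed: "\<omega> (K (?\<phi> m)) = \<omega> (K m)" if m: "m \<in> M" for m
    proof -
      \<comment> \<open>K m is integral, hence in M^1, where the unramified \<theta> is trivial; the
        twist between \<omega> and its conjugate disappears on the units.\<close>
      have "\<theta> (K m) = 1" using \<theta> K_int[OF m] integral_subset_SL_levi_1 by (auto simp: X_iff)
      then show ?thesis using \<omega>\<phi>[OF K_M[OF m]] K\<phi>[OF m] by simp
    qed
    \<comment> \<open>The twisted representation is given by the character m \<mapsto> \<omega> (K
      m), so the identity serves as intertwiner.\<close>
    have tw: "sc (\<eta> m) (\<sigma> m v) = sc (\<omega> (K m)) v" if "m \<in> M" for m v
      using \<omega>_nz[OF that] by (simp add: \<omega>(2)[OF that] \<eta>_def)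
    show ?thesis
      by (rule rep_equivI[OF lin_id(1) bij_id])
        (simp add: MG_simps conj_rep_def twist_def SL_simps tw \<phi>M fixed)
  qed
  ultimately show ?thesis by blast
qed

end

section \<open>Passage to cosets of the Weyl group, and the distinction of cases\<close>

section \<open>The theorem\<close>


context levi_block begin

text \<open>Here M is all of SL_n, so each g acts by an inner automorphism, and \<sigma> itself is
  fixed, with the trivial twist.\<close>

lemma exists_fixed_twist_single_block:
  assumes ds: "discrete_series MG MT sc \<sigma>" and k: "k = 1"
  shows "\<exists>\<eta>\<in>X. \<forall>g\<in>normalizer (SL n) M.
    (\<exists>\<theta>\<in>X. rep_equiv MG sc (conj_rep (SL n) g \<sigma>) sc (twist sc \<theta> \<sigma>)) \<longrightarrow>
    rep_equiv MG sc (conj_rep (SL n) g (twist sc \<eta> \<sigma>)) sc (twist sc \<eta> \<sigma>)"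
proof (intro bexI[OF _ X_one] ballI impI)
  fix g assume g: "g \<in> normalizer (SL n) M"
  have rep: "group_rep MG sc \<sigma>" using ds by (simp add: discrete_series_def smooth_representation_def)
  interpret complex_vector_space sc
    using rep by (intro complex_vector_space.intro) (simp add: group_rep_def)
  have tw: "twist sc (\<lambda>_. 1) \<sigma> = \<sigma>" by (simp add: twist_def)
  have "bd A" for A unfolding bd_def using blk_less k by (metis less_one)
  then have gM: "g \<in> M" using normalizer_mem(1)[OF g] by (simp add: M_def)
  have one: "\<one>\<^bsub>SL n\<^esub> \<in> normalizer (SL n) M" by (rule subgroup.one_closed[OF normalizer_subgroup])
  have "rep_equiv MG sc (conj_rep (SL n) (g \<otimes>\<^bsub>SL n\<^esub> \<one>\<^bsub>SL n\<^esub>) \<sigma>) sc (conj_rep (SL n) \<one>\<^bsub>SL n\<^esub> \<sigma>)"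
    unfolding MG_eq by (rule group.rep_equiv_conj_rep[OF group_SL M_subgroup rep[unfolded MG_eq] one gM])
  moreover have "g \<otimes>\<^bsub>SL n\<^esub> \<one>\<^bsub>SL n\<^esub> = g"
    using normalizer_mem(2)[OF g] by (simp add: SL_simps)
  ultimately have "rep_equiv MG sc (conj_rep (SL n) g \<sigma>) sc (conj_rep (SL n) \<one>\<^bsub>SL n\<^esub> \<sigma>)" by simp
  moreover have "rep_equiv MG sc (conj_rep (SL n) \<one>\<^bsub>SL n\<^esub> \<sigma>) sc \<sigma>"
  proof (rule rep_equivI[OF lin_id(1) bij_id])
    fix m v assume "m \<in> carrier MG"
    then have "m \<in> carrier_mat n n" using M_carrier(1) by (simp add: MG_simps)
    moreover have "inv\<^bsub>SL n\<^esub> \<one>\<^bsub>SL n\<^esub> = (\<one>\<^bsub>SL n\<^esub> :: 'f mat)" by (rule monoid.inv_one[OF group.is_monoid[OF group_SL]])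
    ultimately show "id (conj_rep (SL n) \<one>\<^bsub>SL n\<^esub> \<sigma> m v) = \<sigma> m (id v)"
      by (simp add: conj_rep_def SL_simps)
  qed
  ultimately show "rep_equiv MG sc (conj_rep (SL n) g (twist sc (\<lambda>_. 1) \<sigma>)) sc (twist sc (\<lambda>_. 1) \<sigma>)"
    unfolding tw by (rule rep_equiv_trans)
qed

text \<open>Membership of w in W_O is witnessed by one representative h, while the conclusion
  concerns every g in w. The two differ by an element of M, so \<open>rep_equiv_conj_rep\<close>
  carries the witness over.\<close>

lemma exists_fixed_point:
  assumes ds: "discrete_series MG MT sc \<sigma>"
    and fixed: "\<exists>\<eta>\<in>X. \<forall>g\<in>normalizer (SL n) M.
      (\<exists>\<theta>\<in>X. rep_equiv MG sc (conj_rep (SL n) g \<sigma>) sc (twist sc \<theta> \<sigma>)) \<longrightarrow>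
      rep_equiv MG sc (conj_rep (SL n) g (twist sc \<eta> \<sigma>)) sc (twist sc \<eta> \<sigma>)"
  shows "\<exists>\<sigma>' \<in> unramified_orbit av n ds sc \<sigma>. \<forall>w \<in> weyl_stabilizer av n ds sc \<sigma>. \<forall>g \<in> w.
    rep_equiv MG sc (conj_rep (SL n) g \<sigma>') sc \<sigma>'"
proof -
  obtain \<eta> where \<eta>: "\<eta> \<in> X" "\<And>g \<theta>. g \<in> normalizer (SL n) M \<Longrightarrow> \<theta> \<in> X \<Longrightarrow>
      rep_equiv MG sc (conj_rep (SL n) g \<sigma>) sc (twist sc \<theta> \<sigma>) \<Longrightarrow>
      rep_equiv MG sc (conj_rep (SL n) g (twist sc \<eta> \<sigma>)) sc (twist sc \<eta> \<sigma>)"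
    using fixed by blast
  have rep: "group_rep MG sc \<sigma>" using ds by (simp add: discrete_series_def smooth_representation_def)
  have "rep_equiv MG sc (conj_rep (SL n) g (twist sc \<eta> \<sigma>)) sc (twist sc \<eta> \<sigma>)"
    if w: "w \<in> weyl_stabilizer av n ds sc \<sigma>" and g: "g \<in> w" for w g
  proof -
    obtain h \<theta> where h: "h \<in> w" and \<theta>: "\<theta> \<in> X"
      and eq: "rep_equiv MG sc (conj_rep (SL n) h \<sigma>) sc (twist sc \<theta> \<sigma>)"
      using w unfolding weyl_stabilizer_def by blast
    have "w \<in> carrier (weyl_group n ds)" using w by (simp add: weyl_stabilizer_def)
    then obtain b where b: "b \<in> normalizer (SL n) M" "w = (\<Union>m\<in>M. {m * b})"
      unfolding weyl_group_def M_eq FactGroup_def RCOSETS_def r_coset_def by (auto simp: SL_simps)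
    obtain m where m: "m \<in> M" "g = m * b" using b(2) g by blast
    obtain l where l: "l \<in> M" "h = l * b" using b(2) h by blast
    have MN: "m \<in> normalizer (SL n) M" if "m \<in> M" for m
      using group.subgroup_in_normalizer[OF group_SL M_subgroup] that
      by (auto simp: normal_def subgroup_def)
    have hN: "h \<in> normalizer (SL n) M"
      unfolding l(2) using subgroup.m_closed[OF normalizer_subgroup MN[OF l(1)] b(1)] by (simp add: SL_simps)
    have gN: "g \<in> normalizer (SL n) M"
      unfolding m(2) using subgroup.m_closed[OF normalizer_subgroup MN[OF m(1)] b(1)] by (simp add: SL_simps)
    let ?i = "inv\<^bsub>SL n\<^esub> l"
    note li = SL_inv[OF M_carrier(4)[OF l(1)]]
    have "m * ?i * h = m * (?i * l) * b"
      unfolding l(2) using li(1) M_carrier(1)[OF m(1)] M_carrier(1)[OF l(1)] normalizer_mem(2)[OF b(1)]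
      by (simp add: assoc_square[of _ n])
    then have "m * ?i * h = g"
      using li(3) m(2) M_carrier(1)[OF m(1)] by simp
    moreover have "rep_equiv MG sc (conj_rep (SL n) ((m * ?i) \<otimes>\<^bsub>SL n\<^esub> h) \<sigma>) sc (conj_rep (SL n) h \<sigma>)"
      unfolding MG_eq
      by (rule group.rep_equiv_conj_rep[OF group_SL M_subgroup rep[unfolded MG_eq] hN M_mult[OF m(1) M_inv[OF l(1)]]])
    ultimately have "rep_equiv MG sc (conj_rep (SL n) g \<sigma>) sc (conj_rep (SL n) h \<sigma>)"
      by (simp add: SL_simps)
    from rep_equiv_trans[OF this eq] show ?thesis by (rule \<eta>(2)[OF gN \<theta>])
  qed
  moreover have "twist sc \<eta> \<sigma> \<in> unramified_orbit av n ds sc \<sigma>"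
    using \<eta>(1) by (auto simp: unramified_orbit_def)
  ultimately show ?thesis by blast
qed

end

lemma sum_list_block_sizes: "sum_list (block_sizes r a d) = (\<Sum>i = 1..r. a i * d i)"
  by (induction r) (simp_all add: block_sizes_def sum_list_replicate)

lemma set_block_sizes: "x \<in> set (block_sizes r a d) \<Longrightarrow> \<exists>i\<in>{1..r}. x = d i"
  by (auto simp: block_sizes_def)

text \<open>Since \<open>n\<close> is prime, the total size of the blocks of a fixed size is coprime to \<open>n\<close> unless all
  blocks have the same size; a Bezout relation provides the exponents of \<open>split_det\<close>.\<close>

lemma weighted_blocks_prime:
  assumes n: "prime n" "n = sum_list ds" "\<forall>d\<in>set ds. 0 < d"
    and ij: "i < length ds" "j < length ds" "ds ! i \<noteq> ds ! j"
  obtains e where "weighted_blocks n (length ds) (block_index ds) e"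
proof -
  interpret block_structure n "length ds" "block_index ds"
    by (rule block_structure_list[OF n(2,3)])
  \<comment> \<open>The indices in blocks of the same size as block i; block j lies outside, so
    their number is strictly between 0 and n.\<close>
  define C where "C = {x. x < n \<and> ds ! block_index ds x = ds ! i}"
  obtain x where "x < n" "block_index ds x = i" using blk_surj[OF ij(1)] by blast
  then have "x \<in> C" by (simp add: C_def)
  obtain y where "y < n" "block_index ds y = j" using blk_surj[OF ij(2)] by blast
  then have "y \<notin> C" "y \<in> {..<n}" using ij(3) by (simp_all add: C_def)
  moreover have sub: "C \<subseteq> {..<n}" by (auto simp: C_def)
  ultimately have "C \<subset> {..<n}" by blast
  then have "card C < n" using psubset_card_mono[of "{..<n}" C] by simp
  moreover have "finite C" using sub by (rule finite_subset) simp
  then have "0 < card C" using \<open>x \<in> C\<close> by (auto simp: card_gt_0_iff)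
  ultimately have "0 < card C" "card C < n" by simp_all
  then have "\<not> n dvd card C" by (auto dest: dvd_imp_le)
  then have "coprime n (card C)" by (rule prime_imp_coprime[OF n(1)])
  then have "gcd (int (card C)) (int n) = 1" by (simp add: gcd.commute)
  then obtain u v where uv: "u * int (card C) + v * int n = 1"
    using bezout_int[of "int (card C)" "int n"] by auto
  \<comment> \<open>The weight u on blocks of that size and an additional v on all blocks: the sum
    over the n indices is the left-hand side of the Bezout relation.\<close>
  define e where "e = (\<lambda>l. (if ds ! l = ds ! i then u else 0) + v)"
  have "weighted_blocks n (length ds) (block_index ds) e"
  proof unfold_locales
    have "(\<Sum>x<n. if ds ! block_index ds x = ds ! i then u else 0) = (\<Sum>x\<in>C. u)"
      unfolding C_def by (rule sum.mono_neutral_cong_right) auto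
    then have "(\<Sum>x<n. e (block_index ds x)) = u * int (card C) + v * int n"
      unfolding e_def by (simp add: sum.distrib mult.commute)
    then show "(\<Sum>x<n. e (block_index ds x)) = 1" using uv by simp
    fix l m assume "l < length ds" "m < length ds"
      "card {x. x < n \<and> block_index ds x = l} = card {x. x < n \<and> block_index ds x = m}"
    then have "ds ! l = ds ! m" using card_block_index n(2) by metis
    then show "e l = e m" by (simp add: e_def)
  qed
  then show ?thesis by (rule that)
qed

theorem theorem5p6:
  fixes av :: "'f::field_char_0 \<Rightarrow> real"
    and n r :: nat
    and a d :: "nat \<Rightarrow> nat"
    and sc :: "complex \<Rightarrow> 'v \<Rightarrow> 'v::ab_group_add"
    and \<sigma> :: "'f mat \<Rightarrow> 'v \<Rightarrow> 'v"
  assumes "nonarch_local_field av"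
    and "prime n" and "odd n"
    and "\<forall>i \<in> {1..r}. 0 < a i \<and> 0 < d i"
    and "n = (\<Sum>i = 1..r. a i * d i)"
    and "discrete_series (SL_levi_group n (block_sizes r a d))
           (SL_levi_topology av n (block_sizes r a d)) sc \<sigma>"
  shows "\<exists>\<sigma>' \<in> unramified_orbit av n (block_sizes r a d) sc \<sigma>.
           \<forall>w \<in> weyl_stabilizer av n (block_sizes r a d) sc \<sigma>. \<forall>g \<in> w.
             rep_equiv (SL_levi_group n (block_sizes r a d))
               sc (conj_rep (SL n) g \<sigma>') sc \<sigma>'"
proof -
  define ds where "ds = block_sizes r a d"
  have sum: "n = sum_list ds" using assms(5) by (simp add: ds_def sum_list_block_sizes)
  have pos: "\<forall>x\<in>set ds. 0 < x" using set_block_sizes assms(4) unfolding ds_def by blast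
  interpret L: levi_block n "length ds" "block_index ds" av ds
    by (rule levi_block_list[OF assms(1) sum pos])
  note ds = assms(6)[folded ds_def]
  have "\<exists>\<eta>\<in>L.X. \<forall>g\<in>normalizer (SL n) L.M.
    (\<exists>\<theta>\<in>L.X. rep_equiv L.MG sc (conj_rep (SL n) g \<sigma>) sc (twist sc \<theta> \<sigma>)) \<longrightarrow>
    rep_equiv L.MG sc (conj_rep (SL n) g (twist sc \<eta> \<sigma>)) sc (twist sc \<eta> \<sigma>)"
  proof (cases "\<exists>i<length ds. \<exists>j<length ds. ds ! i \<noteq> ds ! j")
    case True
    then obtain i j where ij: "i < length ds" "j < length ds" "ds ! i \<noteq> ds ! j" by blast
    obtain e where e: "weighted_blocks n (length ds) (block_index ds) e"
      using weighted_blocks_prime[OF assms(2) sum pos ij] .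
    interpret W: weighted_levi n "length ds" "block_index ds" e av ds
      by (intro weighted_levi.intro e L.levi_block_axioms)
    show ?thesis by (rule W.exists_fixed_twist[OF ds])
  next
    case False
    have "n \<noteq> 0" using assms(2) by (metis not_prime_0)
    then have "0 < length ds" using sum by (cases ds) simp_all
    define d0 where "d0 = ds ! 0"
    have nth: "ds ! i = d0" if "i < length ds" for i
      using False that \<open>0 < length ds\<close> unfolding d0_def by blast
    have "ds = replicate (length ds) d0" by (rule nth_equalityI) (simp_all add: nth)
    from arg_cong[OF this, of sum_list] have "n = length ds * d0"
      unfolding sum_list_replicate sum[symmetric] by simp
    then consider "length ds = 1" | "d0 = 1"
      using assms(2) prime_product[of "length ds" d0] by blast
    then show ?thesis
    proof cases
      case 1
      then show ?thesis by (rule L.exists_fixed_twist_single_block[OF ds])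
    next
      case 2
      have "inj_on (block_index ds) {..<n}"
      proof (rule inj_onI)
        fix x y assume xy: "x \<in> {..<n}" "y \<in> {..<n}" "block_index ds x = block_index ds y"
        have i: "block_index ds x < length ds" using L.blk_less xy(1) by simp
        have "card {z. z < sum_list ds \<and> block_index ds z = block_index ds x} = 1"
          using card_block_index[OF i] nth[OF i] 2 by simp
        then obtain c where c: "{z. z < sum_list ds \<and> block_index ds z = block_index ds x} = {c}"
          by (rule card_1_singletonE)
        have "x \<in> {c}" "y \<in> {c}" unfolding c[symmetric] using xy by (simp_all add: sum[symmetric])
        then show "x = y" by simp
      qed
      then show ?thesis by (rule L.exists_fixed_twist_torus[OF ds])
    qed
  qed
  from L.exists_fixed_point[OF ds this] show ?thesis unfolding ds_def .
qed

end
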